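(* Let $0<\eta\le 1$ and suppose that for each sufficiently large $k$, $(p_k,q_k)$ is a pair of homogeneous polynomials of degree $k$ in two complex variables such that $(p_k,q_k)$ maps the unit sphere $S^3\subset\mathbb{C}^2$ into the annulus $\{w\in\mathbb{C}^2:\sqrt{\eta}\le|w|\le1\}$. Let $F_k=p_k/q_k:\mathbb{CP}^1\to\mathbb{CP}^1$, a rational map of degree $k$. Then for every point $w\in\mathbb{CP}^1$ there is a constant $C$ such that for all sufficiently large $k$ and every $\mathcal{C}^2$ function $f$ on $S^2$, $$\left|\frac{1}{k}\sum_{i=1}^k f(x_i^k)-\frac{1}{|S^2|}\int_{S^2} f\right|\le \frac{C\,\|\triangle f\|_\infty}{k},$$ where $x_1^k,\dots,x_k^k$ are the points of the fiber $F_k^{-1}(w)$ counted with multiplicity. In particular the left-hand side tends to $0$ as $k\to\infty$.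
   Context: $S^2$ is identified with $\mathbb{CP}^1$ and carries the round (Fubini–Study) metric, in the affine coordinate $z$ given by $2\,|dz|^2/(1+|z|^2)^2$ up to the standard normalization, with total area $|S^2|=4\pi$; $\triangle$ is the Laplacian and $\int_{S^2}$ the integral with respect to this metric. *)

theory Defs
  imports "HOL-Analysis.Analysis" "HOL-Computational_Algebra.Polynomial"
begin

text \<open>The Riemann sphere CP^1 = S^2 is modelled as complex option:
  Some z is the point with affine coordinate z, i.e. [z:1]; None is the point at
  infinity [1:0].\<close>

type_synonym cp1 = "complex option"

definition hom_eval :: "(nat \<Rightarrow> complex) \<Rightarrow> nat \<Rightarrow> complex \<Rightarrow> complex \<Rightarrow> complex" where
  "hom_eval a k z0 z1 = (\<Sum>j\<le>k. a j * z0 ^ j * z1 ^ (k - j))"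

definition dehom :: "(nat \<Rightarrow> complex) \<Rightarrow> nat \<Rightarrow> complex poly" where
  "dehom a k = (\<Sum>j\<le>k. monom (a j) j)"

text \<open>Sum of g over the zeros in CP^1 of the homogeneous polynomial of degree k with
  coefficients a, counted with multiplicity; the point at infinity [1:0] has
  multiplicity k - degree of the dehomogenisation.\<close>
definition zero_sum :: "(nat \<Rightarrow> complex) \<Rightarrow> nat \<Rightarrow> (cp1 \<Rightarrow> real) \<Rightarrow> real" where
  "zero_sum a k g =
     (\<Sum>x\<in>{x. poly (dehom a k) x = 0}. real (order x (dehom a k)) * g (Some x))
     + real (k - degree (dehom a k)) * g None"

text \<open>Sum of g over the fibre F^{-1}(w), with multiplicity, of F = p/q where p, q are
  homogeneous of degree k with coefficients a, b. For w = [c:1] the fibre is the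
  zero set of p - c q, for w = [1:0] it is the zero set of q.\<close>
definition fiber_sum ::
  "(nat \<Rightarrow> complex) \<Rightarrow> (nat \<Rightarrow> complex) \<Rightarrow> nat \<Rightarrow> cp1 \<Rightarrow> (cp1 \<Rightarrow> real) \<Rightarrow> real" where
  "fiber_sum a b k w g =
     (case w of Some c \<Rightarrow> zero_sum (\<lambda>j. a j - c * b j) k g
              | None \<Rightarrow> zero_sum b k g)"

definition dx :: "(complex \<Rightarrow> real) \<Rightarrow> complex \<Rightarrow> real" where
  "dx g z = deriv (\<lambda>t::real. g (z + complex_of_real t)) 0"

definition dy :: "(complex \<Rightarrow> real) \<Rightarrow> complex \<Rightarrow> real" where
  "dy g z = deriv (\<lambda>t::real. g (z + \<i> * complex_of_real t)) 0"

definition C2_plane :: "(complex \<Rightarrow> real) \<Rightarrow> bool" where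
  "C2_plane g \<longleftrightarrow>
     continuous_on UNIV g \<and>
     (\<forall>h\<in>{g, dx g, dy g}. \<forall>z.
        ((\<lambda>t::real. h (z + complex_of_real t)) has_real_derivative dx h z) (at 0) \<and>
        ((\<lambda>t::real. h (z + \<i> * complex_of_real t)) has_real_derivative dy h z) (at 0)) \<and>
     (\<forall>h\<in>{dx g, dy g, dx (dx g), dy (dx g), dx (dy g), dy (dy g)}. continuous_on UNIV h)"

definition lap_plane :: "(complex \<Rightarrow> real) \<Rightarrow> complex \<Rightarrow> real" where
  "lap_plane g z = dx (dx g) z + dy (dy g) z"

text \<open>The two standard charts of CP^1: z \<mapsto> [z:1] and u \<mapsto> [1:u].\<close>
definition chart0 :: "(cp1 \<Rightarrow> real) \<Rightarrow> complex \<Rightarrow> real" where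
  "chart0 f z = f (Some z)"

definition chart1 :: "(cp1 \<Rightarrow> real) \<Rightarrow> complex \<Rightarrow> real" where
  "chart1 f u = (if u = 0 then f None else f (Some (1 / u)))"

definition C2_sphere :: "(cp1 \<Rightarrow> real) \<Rightarrow> bool" where
  "C2_sphere f \<longleftrightarrow> C2_plane (chart0 f) \<and> C2_plane (chart1 f)"

text \<open>Laplacian of the round metric 4|dz|^2/(1+|z|^2)^2 (total area 4 pi), computed
  in the chart z at finite points and in the chart u = 1/z at infinity.\<close>
definition sphere_lap :: "(cp1 \<Rightarrow> real) \<Rightarrow> cp1 \<Rightarrow> real" where
  "sphere_lap f p =
     (case p of Some z \<Rightarrow> (1 + (cmod z)\<^sup>2)\<^sup>2 / 4 * lap_plane (chart0 f) z
              | None \<Rightarrow> lap_plane (chart1 f) 0 / 4)"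

definition sup_norm :: "(cp1 \<Rightarrow> real) \<Rightarrow> real" where
  "sup_norm h = (SUP p. \<bar>h p\<bar>)"

text \<open>Integral over S^2 with respect to the round area form, computed in the chart z
  (the point at infinity has measure zero).\<close>
definition sphere_integral :: "(cp1 \<Rightarrow> real) \<Rightarrow> real" where
  "sphere_integral f = integral UNIV (\<lambda>z::complex. f (Some z) * (4 / (1 + (cmod z)\<^sup>2)\<^sup>2))"

definition sphere_area :: real where
  "sphere_area = 4 * pi"

end

theory Submission
  imports Defs "HOL-Computational_Algebra.Fundamental_Theorem_Algebra" "HOL-Real_Asymp.Real_Asymp"
begin

text \<open>
  Let \<open>P\<close> be the dehomogenised form cutting out the fibre, and let
  \<open>U = ln (|P|\<^sup>2 / (1 + |z|\<^sup>2)\<^sup>k)\<close>. Green's identity against \<open>ln |z - x|\<^sup>2\<close> and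
  \<open>ln (1 + |z|\<^sup>2)\<close> gives the Poincare-Lelong formula: the sum of \<open>f\<close> over the fibre minus
  \<open>k\<close> times its mean equals \<open>1 / (4 \<pi>)\<close> times the integral of \<open>U\<close> against the flat Laplacian
  of \<open>f\<close>. It therefore suffices to bound the \<open>L\<^sup>1\<close> norm of \<open>U\<close> on the sphere independently
  of \<open>k\<close>, and since \<open>U\<close> is bounded above, only its mean has to be bounded below.

  Up to a term depending only on \<open>k\<close>, the mean of \<open>U\<close> is the logarithmic height of \<open>P\<close> (leading
  coefficient and roots). The symmetry of the resultant of two members of the pencil spanned by
  \<open>p\<close> and \<open>q\<close>, together with the annulus condition at their zeros, shows that the heights
  of two members differ by a constant independent of \<open>k\<close>. Finally, averaging \<open>ln |p - w q|\<^sup>2\<close>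
  over \<open>w\<close> gives \<open>ln (|p|\<^sup>2 + |q|\<^sup>2)\<close>, which is at least \<open>ln \<eta>\<close> on the unit sphere;
  hence some member of the pencil has its mean bounded below.
\<close>

section \<open>Radial integration and logarithmic majorants in the plane\<close>

text \<open>The fibre polynomial has logarithmic singularities, so Green's identity is applied only
  to the smooth potentials \<open>ln (\<epsilon>\<^sup>2 + |z - a|\<^sup>2)\<close>, against
  \<open>f\<close> minus its value at infinity, whose decay kills the boundary terms. One family
  does two jobs: at scale 1 about 0 its Laplacian is the area density \<open>fs\<close>, and as the
  scale shrinks its Laplacian becomes \<open>4 * pi\<close> times the point mass at
  \<open>a\<close>. The degree drops out because the resultant identity compares \<open>k\<close>
  times each height with a sum of \<open>k\<close> pointwise logarithms, one per zero; each is
  bounded by a constant, so division by \<open>k\<close> leaves a constant. At a zero of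
  \<open>p - w q\<close> the vector \<open>(p, q)\<close> is a multiple of \<open>(w, 1)\<close> and
  is not short, so another member of the pencil can be small there only if its parameter is close to
  \<open>w\<close>. Hence the averaging argument looks for a good \<open>w\<close> in a ball kept
  away from the target: if every member in that ball had a very negative mean, the total average
  would be too small, and any single good member can then be compared with the target.\<close>

lemma distr_norm_complex_lborel:
  "distr (lborel :: complex measure) borel cmod
     = density lborel (\<lambda>r. ennreal (2 * pi * r) * indicator {0..} r)"
proof (rule measure_eqI_generator_eq[where E = "range atMost" and \<Omega> = UNIV
        and A = "\<lambda>i::nat. {..real i}"])
  show "Int_stable (range (atMost :: real \<Rightarrow> _))"
    by (auto simp: Int_stable_def)
  fix X :: "real set" assume "X \<in> range atMost"
  then obtain r where X: "X = {..r}" by auto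
  \<comment> \<open>It is enough to compare the two measures on half-lines, where both give the area
    of the disc of radius \<open>r\<close>; this yields radial integration without polar
    coordinates.\<close>
  have L: "emeasure (distr (lborel :: complex measure) borel cmod) X = ennreal (if r < 0 then 0 else pi * r\<^sup>2)"
  proof -
    have "cmod -` X \<inter> space lborel = cball 0 r" by (auto simp: X)
    then have "emeasure (distr (lborel :: complex measure) borel cmod) X = emeasure lborel (cball (0::complex) r)"
      by (subst emeasure_distr) (auto simp: X)
    then show ?thesis by (cases "r < 0") (auto simp: emeasure_cball unit_ball_vol_2)
  qed
  have R: "emeasure (density lborel (\<lambda>r. ennreal (2 * pi * r) * indicator {0..} r)) X
         = ennreal (if r < 0 then 0 else pi * r\<^sup>2)"
  proof -
    have "emeasure (density lborel (\<lambda>r. ennreal (2 * pi * r) * indicator {0..} r)) X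
        = (\<integral>\<^sup>+x. ennreal (2 * pi * x) * indicator {0..r} x \<partial>lborel)"
      by (subst emeasure_density) (auto simp: X intro!: nn_integral_cong split: split_indicator)
    also have "\<dots> = ennreal (if r < 0 then 0 else pi * r\<^sup>2)"
    proof (cases "r < 0")
      case False
      then show ?thesis
        by (subst nn_integral_FTC_Icc[where F = "\<lambda>x. pi * x\<^sup>2"])
           (auto intro!: derivative_eq_intros)
    qed auto
    finally show ?thesis .
  qed
  show "emeasure (distr (lborel :: complex measure) borel cmod) X
      = emeasure (density lborel (\<lambda>r. ennreal (2 * pi * r) * indicator {0..} r)) X"
    using L R by simp
next
  show "sets (distr (lborel :: complex measure) borel cmod) = sigma_sets UNIV (range atMost)"
    by (simp add: borel_eq_atMost)
  show "sets (density lborel (\<lambda>r. ennreal (2 * pi * r) * indicator {0..} r)) = sigma_sets UNIV (range atMost)"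
    by (simp add: borel_eq_atMost)
  show "(\<Union>i::nat. {..real i}) = UNIV"
    by (auto intro: real_arch_simple)
  fix i :: nat
  have "cmod -` {..real i} \<inter> space lborel = cball 0 (real i)" by auto
  then show "emeasure (distr (lborel :: complex measure) borel cmod) {..real i} \<noteq> \<infinity>"
    by (subst emeasure_distr) (auto simp: emeasure_cball)
qed auto

lemma nn_integral_radial:
  assumes [measurable]: "\<phi> \<in> borel_measurable borel"
  shows "(\<integral>\<^sup>+(z::complex). \<phi> (cmod z) \<partial>lborel) = (\<integral>\<^sup>+r. ennreal (2 * pi * r) * \<phi> r * indicator {0..} r \<partial>lborel)"
proof -
  have "(\<integral>\<^sup>+(z::complex). \<phi> (cmod z) \<partial>lborel) = (\<integral>\<^sup>+r. \<phi> r \<partial>distr (lborel :: complex measure) borel cmod)"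
    by (subst nn_integral_distr) auto
  also have "\<dots> = (\<integral>\<^sup>+r. ennreal (2 * pi * r) * \<phi> r * indicator {0..} r \<partial>lborel)"
    unfolding distr_norm_complex_lborel
    by (subst nn_integral_density) (auto intro!: nn_integral_cong simp: mult_ac)
  finally show ?thesis .
qed

text \<open>Nonnegativity lets the two limits of the antiderivative deliver integrability together
  with the value. The analytic hypotheses concern \<open>r > 0\<close> only, so that
  \<open>\<phi>\<close> may blow up at the origin.\<close>

lemma
  assumes [measurable]: "\<phi> \<in> borel_measurable borel"
    and nonneg: "\<And>r. 0 < r \<Longrightarrow> 0 \<le> \<phi> r"
    and cont: "\<And>r. 0 < r \<Longrightarrow> isCont \<phi> r"
    and deriv: "\<And>r. 0 < r \<Longrightarrow> DERIV F r :> 2 * pi * r * \<phi> r"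
    and A: "(F \<longlongrightarrow> A) (at_right 0)" and B: "(F \<longlongrightarrow> B) at_top"
  shows integrable_radial_FTC: "integrable lborel (\<lambda>z::complex. \<phi> (cmod z))"
    and integral_radial_FTC: "(\<integral>(z::complex). \<phi> (cmod z) \<partial>lborel) = B - A"
proof -
  let ?f = "\<lambda>r. 2 * pi * r * \<phi> r"
  have lim0: "((F \<circ> real_of_ereal) \<longlongrightarrow> A) (at_right (0::ereal))"
    using A by (simp add: zero_ereal_def ereal_tendsto_simps)
  have lim1: "((F \<circ> real_of_ereal) \<longlongrightarrow> B) (at_left \<infinity>)"
    using B by (simp add: ereal_tendsto_simps)
  have cont': "isCont ?f x" if "0 < x" for x
    using cont[OF that] by (intro continuous_intros)
  note FTC = interval_integral_FTC_nonneg[of 0 \<infinity> F ?f A B, OF _ _ _ _ lim0 lim1]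
  have int: "set_integrable lborel (einterval 0 \<infinity>) ?f"
    using deriv cont' nonneg by (intro FTC(1)) (auto simp: zero_ereal_def)
  have val: "(LBINT x=0..\<infinity>. ?f x) = B - A"
    using deriv cont' nonneg by (intro FTC(2)) (auto simp: zero_ereal_def)
  have "einterval 0 \<infinity> = {0<..}" by (auto simp: einterval_def zero_ereal_def)
  then have int': "integrable lborel (\<lambda>r. ?f r * indicator {0<..} r)"
    and val': "(\<integral>r. ?f r * indicator {0<..} r \<partial>lborel) = B - A"
    using int val by (auto simp: set_integrable_def interval_integral_eq_integral set_lebesgue_integral_def mult_ac
        interval_lebesgue_integral_def zero_ereal_def)
  have nn: "(\<integral>\<^sup>+r. ennreal (?f r * indicator {0<..} r) \<partial>lborel) = ennreal (B - A)"
    using nn_integral_eq_integral[OF int'] val' nonneg by (auto simp: indicator_def)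
  have BA: "0 \<le> B - A"
    unfolding val'[symmetric] using nonneg by (intro integral_nonneg_AE) (auto simp: indicator_def)
  have AE: "AE z::complex in lborel. 0 \<le> \<phi> (cmod z)"
    using AE_lborel_singleton[of 0] by eventually_elim (auto intro: nonneg)
  have "(\<integral>\<^sup>+(z::complex). ennreal (\<phi> (cmod z)) \<partial>lborel)
      = (\<integral>\<^sup>+r. ennreal (2 * pi * r) * ennreal (\<phi> r) * indicator {0..} r \<partial>lborel)"
    by (rule nn_integral_radial) simp
  also have "\<dots> = (\<integral>\<^sup>+r. ennreal (?f r * indicator {0<..} r) \<partial>lborel)"
    by (intro nn_integral_cong) (auto simp: indicator_def ennreal_mult' nonneg less_le)
  finally have eq: "(\<integral>\<^sup>+(z::complex). ennreal (\<phi> (cmod z)) \<partial>lborel) = ennreal (B - A)" using nn by simp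
  show "integrable lborel (\<lambda>z::complex. \<phi> (cmod z))"
    by (rule integrableI_nonneg) (use AE eq in auto)
  show "(\<integral>(z::complex). \<phi> (cmod z) \<partial>lborel) = B - A"
    using integral_eq_nn_integral[of "\<lambda>z::complex. \<phi> (cmod z)" lborel] AE eq BA by simp
qed

text \<open>The Fubini-Study area density in the chart \<open>z\<close>.\<close>

definition fs :: "complex \<Rightarrow> real" where
  "fs z = 4 / (1 + (cmod z)\<^sup>2)\<^sup>2"

lemma one_plus_norm_sq_pos [simp]: "0 < 1 + (cmod z)\<^sup>2" "1 + (cmod z)\<^sup>2 \<noteq> 0"
  by (smt (verit) zero_le_power2)+

lemma fs_pos: "0 < fs z" and fs_nonneg [simp]: "0 \<le> fs z"
  by (auto simp: fs_def intro!: divide_pos_pos)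

lemma borel_measurable_fs [measurable]: "fs \<in> borel_measurable borel"
  unfolding fs_def by measurable

lemma integrable_fs: "integrable lborel fs" and integral_fs: "(\<integral>z. fs z \<partial>lborel) = 4 * pi"
proof -
  define \<phi> where "\<phi> = (\<lambda>r::real. 4 / (1 + r\<^sup>2)\<^sup>2)"
  define F where "F = (\<lambda>r::real. - 4 * pi / (1 + r\<^sup>2))"
  have m: "\<phi> \<in> borel_measurable borel" unfolding \<phi>_def by measurable
  have p: "1 + r\<^sup>2 \<noteq> 0" for r :: real by (smt (verit) zero_le_power2)
  have 1: "0 \<le> \<phi> r" for r by (simp add: \<phi>_def)
  have 2: "isCont \<phi> r" for r unfolding \<phi>_def using p by (intro continuous_intros) auto
  have 3: "DERIV F r :> 2 * pi * r * \<phi> r" for r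
    unfolding F_def \<phi>_def using p[of r]
    by (auto intro!: derivative_eq_intros simp: divide_simps power2_eq_square) 
  have 4: "(F \<longlongrightarrow> - 4 * pi) (at_right 0)" unfolding F_def by real_asymp
  have 5: "(F \<longlongrightarrow> 0) at_top" unfolding F_def by real_asymp
  have fs: "fs = (\<lambda>z. \<phi> (cmod z))" by (simp add: fun_eq_iff fs_def \<phi>_def)
  show "integrable lborel fs" unfolding fs
    by (rule integrable_radial_FTC[OF m 1 2 3 4 5])
  show "(\<integral>z. fs z \<partial>lborel) = 4 * pi" unfolding fs
    by (rule integral_radial_FTC[OF m 1 2 3 4 5, simplified])
qed

section \<open>Integrability of logarithms against decaying densities\<close>

text \<open>The inverse square root absorbs a logarithm at the origin, and the total decay of order
  5/2 still exceeds the critical exponent 2 of the plane. With this choice the radial antiderivative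
  is elementary.\<close>

definition log_majorant :: "complex \<Rightarrow> real" where
  "log_majorant z = 1 / (sqrt (cmod z) * (1 + cmod z)\<^sup>2)"

lemma log_majorant_nonneg [simp]: "0 \<le> log_majorant z"
  by (simp add: log_majorant_def)

lemma integrable_log_majorant: "integrable lborel log_majorant"
proof -
  define \<phi> where "\<phi> = (\<lambda>r::real. 1 / (sqrt r * (1 + r)\<^sup>2))"
  \<comment> \<open>With \<open>r = s\<^sup>2\<close> the radial integrand becomes a multiple of
    \<open>s\<^sup>2 / (1 + s\<^sup>2)\<^sup>2\<close>, which integrates to an arctangent minus a
    rational term.\<close>
  define F where "F = (\<lambda>r::real. 2 * pi * (arctan (sqrt r) - sqrt r / (1 + r)))"
  have m: "\<phi> \<in> borel_measurable borel" unfolding \<phi>_def by measurable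
  have 1: "0 \<le> \<phi> r" if "0 < r" for r using that by (simp add: \<phi>_def)
  have 2: "isCont \<phi> r" if "0 < r" for r unfolding \<phi>_def using that by (intro continuous_intros) auto
  have 3: "DERIV F r :> 2 * pi * r * \<phi> r" if "0 < r" for r
  proof -
    define s where "s = sqrt r"
    have s: "0 < s" "r = s^2" using that by (auto simp: s_def)
    have s': "1 + s\<^sup>2 \<noteq> 0" "1 + s * s \<noteq> 0" using s by (smt (verit) zero_le_power2 power2_eq_square)+
    have "DERIV F r :> 2 * pi * (inverse s / 2 * inverse (1 + s\<^sup>2) - (inverse s / 2 * (1 + r) - s) / (1 + r)\<^sup>2)"
    proof -
      have "r \<noteq> -1" "1 + r \<noteq> 0" using that by auto
      moreover have "(sqrt r)\<^sup>2 = r" using that by simp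
      ultimately show ?thesis unfolding F_def s_def using that
        by (auto intro!: derivative_eq_intros simp: power2_eq_square)
    qed
    also have "2 * pi * (inverse s / 2 * inverse (1 + s\<^sup>2) - (inverse s / 2 * (1 + r) - s) / (1 + r)\<^sup>2) = 2 * pi * r * \<phi> r"
    proof -
      have "inverse s / 2 * inverse (1 + s\<^sup>2) - (inverse s / 2 * (1 + s\<^sup>2) - s) / (1 + s\<^sup>2)\<^sup>2 = s / (1 + s\<^sup>2)\<^sup>2"
        using s s' by (simp add: divide_simps) (simp add: power2_eq_square algebra_simps)?
      moreover have "r * \<phi> r = s / (1 + s\<^sup>2)\<^sup>2"
        unfolding \<phi>_def using s s' by (simp add: s_def[symmetric] power2_eq_square)
      ultimately show ?thesis unfolding s(2)[symmetric] mult.assoc by (simp only:)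
    qed
    finally show ?thesis .
  qed
  have 4: "(F \<longlongrightarrow> 0) (at_right 0)" unfolding F_def by real_asymp
  have 5: "(F \<longlongrightarrow> 2 * pi * (pi / 2)) at_top" unfolding F_def
  proof -
    have "((\<lambda>r::real. sqrt r / (1 + r)) \<longlongrightarrow> 0) at_top" by real_asymp
    moreover have "((\<lambda>r::real. arctan (sqrt r)) \<longlongrightarrow> pi / 2) at_top"
      by (rule filterlim_compose[OF tendsto_arctan_at_top sqrt_at_top])
    ultimately have "((\<lambda>r::real. arctan (sqrt r) - sqrt r / (1 + r)) \<longlongrightarrow> pi / 2 - 0) at_top"
      by (intro tendsto_diff)
    from tendsto_mult_left[OF this, of "2 * pi"]
    show "((\<lambda>r::real. 2 * pi * (arctan (sqrt r) - sqrt r / (1 + r))) \<longlongrightarrow> 2 * pi * (pi / 2)) at_top"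
      by simp
  qed
  have "integrable lborel (\<lambda>z::complex. \<phi> (cmod z))"
    by (rule integrable_radial_FTC[OF m 1 2 3 4 5])
  then show ?thesis by (simp add: log_majorant_def[abs_def] \<phi>_def)
qed

text \<open>In terms of \<open>s = sqrt r\<close> the logarithm is \<open>4 * ln s\<close>, and
  \<open>ln s\<close> lies between \<open>- 1 / s\<close> and \<open>s\<close>.\<close>

lemma abs_ln_mult_sqrt_le:
  fixes r :: real assumes "0 \<le> r" shows "\<bar>ln (r\<^sup>2)\<bar> * sqrt r \<le> 4 * (1 + r)"
proof (cases "r = 0")
  case False
  define s where "s = sqrt r"
  have s: "0 < s" "r = s\<^sup>2" using False assms by (auto simp: s_def)
  have eq: "ln (r\<^sup>2) = 4 * ln s" using s by (simp add: ln_realpow)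
  have a: "ln s \<le> s" using s ln_le_minus_one[of s] by simp
  have b: "- ln s \<le> 1 / s" using s ln_le_minus_one[of "1/s"] by (simp add: ln_div)
  have "\<bar>ln s\<bar> * s \<le> 1 + s\<^sup>2"
  proof (cases "0 \<le> ln s")
    case True
    have "ln s * s \<le> s * s" using mult_right_mono[OF a, of s] s(1) by simp
    with True show ?thesis by (simp add: power2_eq_square abs_of_nonneg del: ln_ge_zero_iff)
  next
    case False
    then have "\<bar>ln s\<bar> * s = - ln s * s" by (simp del: ln_ge_zero_iff)
    moreover have "- ln s * s \<le> 1" using mult_right_mono[OF b, of s] s(1) by simp
    moreover have "0 \<le> s\<^sup>2" by simp
    ultimately show ?thesis by linarith
  qed
  then show ?thesis unfolding s_def[symmetric] eq using s by (simp add: abs_mult)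
qed auto

lemma ln_log_majorant: "\<bar>ln ((cmod z)\<^sup>2)\<bar> / (1 + cmod z)^3 \<le> 4 * log_majorant z"
proof (cases "z = 0")
  case False
  have "\<bar>ln ((cmod z)\<^sup>2)\<bar> * sqrt (cmod z) \<le> 4 * (1 + cmod z)"
    by (rule abs_ln_mult_sqrt_le) simp
  then have "\<bar>ln ((cmod z)\<^sup>2)\<bar> \<le> 4 * (1 + cmod z) / sqrt (cmod z)"
    using False by (simp add: field_simps)
  then have "\<bar>ln ((cmod z)\<^sup>2)\<bar> / (1 + cmod z)^3 \<le> 4 * (1 + cmod z) / sqrt (cmod z) / (1 + cmod z)^3"
    by (intro divide_right_mono) auto
  also have "\<dots> = 4 * log_majorant z"
  proof -
    have "1 + cmod z \<noteq> 0" by (smt (verit) norm_ge_zero)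
    then show ?thesis using False unfolding log_majorant_def
      by (simp add: divide_simps) (simp add: power2_eq_square power3_eq_cube)
  qed
  finally show ?thesis .
\<comment> \<open>At \<open>z = 0\<close> the conventions \<open>ln 0 = 0\<close> and
  \<open>1 / 0 = 0\<close> make both sides vanish.\<close>
qed (simp add: log_majorant_def)

text \<open>Translating by \<open>a\<close> changes the weight \<open>1 + |z|\<close> by at most a
  constant factor, so decay rates about 0 can be read as decay rates about \<open>a\<close>.\<close>

lemma one_plus_norm_diff: "1 + cmod (z - a) \<le> (1 + cmod a) * (1 + cmod z)"
  using norm_triangle_ineq4[of z a] by (simp add: algebra_simps) (smt (verit) mult_nonneg_nonneg norm_ge_zero)

lemma integrable_translate:
  fixes f :: "complex \<Rightarrow> real"
  assumes "integrable lborel f" shows "integrable lborel (\<lambda>z. f (z - a))"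
proof -
  have f[measurable]: "f \<in> borel_measurable borel" using borel_measurable_integrable[OF assms] by simp
  have "integrable (distr lborel borel ((+) (-a))) f"
    unfolding lborel_distr_plus by fact
  then show ?thesis by (subst (asm) integrable_distr_eq) (auto simp: algebra_simps)
qed

lemma integral_translate:
  fixes f :: "complex \<Rightarrow> real"
  assumes [measurable]: "f \<in> borel_measurable borel" shows "(\<integral>z. f (z - a) \<partial>lborel) = (\<integral>z. f z \<partial>lborel)"
proof -
  have "(\<integral>z. f z \<partial>lborel) = (\<integral>z. f z \<partial>distr lborel borel ((+) (-a)))"
    unfolding lborel_distr_plus ..
  also have "\<dots> = (\<integral>z. f (z - a) \<partial>lborel)" by (subst integral_distr) (auto simp: algebra_simps)
  finally show ?thesis ..
qed

text \<open>The cubic weight is moved from centre 0 to centre \<open>a\<close>, where the logarithm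
  divided by it is dominated by a translate of \<open>log_majorant\<close>.\<close>

lemma integrable_ln_shift:
  assumes [measurable]: "g \<in> borel_measurable borel" and g: "\<And>z. \<bar>g z\<bar> \<le> K / (1 + cmod z)^3"
  shows "integrable lborel (\<lambda>z. ln ((cmod (z - a))\<^sup>2) * g z)"
proof (rule Bochner_Integration.integrable_bound)
  show "integrable lborel (\<lambda>z. K * (1 + cmod a)^3 * (4 * log_majorant (z - a)))"
    by (intro integrable_mult_right integrable_translate integrable_log_majorant)
  have K: "0 \<le> K" using g[of 0] by simp
  show "AE z in lborel. norm (ln ((cmod (z - a))\<^sup>2) * g z) \<le> norm (K * (1 + cmod a)^3 * (4 * log_majorant (z - a)))"
  proof (rule AE_I2)
    fix z
    have pos: "0 < 1 + cmod z" "0 < 1 + cmod (z-a)" "0 < 1 + cmod a" by (smt (verit) norm_ge_zero)+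
    have "(1 + cmod (z-a))^3 \<le> ((1 + cmod a) * (1 + cmod z))^3"
      using pos by (intro power_mono one_plus_norm_diff) auto
    then have "1 / (1 + cmod z)^3 \<le> (1 + cmod a)^3 / (1 + cmod (z-a))^3"
    proof -
      have "0 < (1 + cmod z)^3" "0 < (1 + cmod (z-a))^3" using pos by (auto intro: zero_less_power)
      with \<open>(1 + cmod (z-a))^3 \<le> ((1 + cmod a) * (1 + cmod z))^3\<close> show ?thesis
        unfolding power_mult_distrib by (metis (no_types) mult_1 divide_le_eq le_divide_eq times_divide_eq_left)
    qed
    then have "K * (1 / (1 + cmod z)^3) \<le> K * ((1 + cmod a)^3 / (1 + cmod (z-a))^3)"
      by (rule mult_left_mono) fact
    then have "\<bar>g z\<bar> \<le> K * ((1 + cmod a)^3 / (1 + cmod (z-a))^3)"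
      using g[of z] by simp
    then have "\<bar>ln ((cmod (z - a))\<^sup>2)\<bar> * \<bar>g z\<bar> \<le> \<bar>ln ((cmod (z - a))\<^sup>2)\<bar> * (K * ((1 + cmod a)^3 / (1 + cmod (z-a))^3))"
      by (intro mult_left_mono) auto
    also have "\<dots> = K * (1 + cmod a)^3 * (\<bar>ln ((cmod (z - a))\<^sup>2)\<bar> / (1 + cmod (z-a))^3)" by simp
    also have "\<dots> \<le> K * (1 + cmod a)^3 * (4 * log_majorant (z - a))"
      using K by (intro mult_left_mono ln_log_majorant) auto
    finally show "norm (ln ((cmod (z - a))\<^sup>2) * g z) \<le> norm (K * (1 + cmod a)^3 * (4 * log_majorant (z - a)))"
      using K by (simp add: abs_mult)
  qed
qed measurable

text \<open>The integrability criterion for decay of order 5/2, the worst rate met below: a factor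
  growing like a square root times one decaying cubically.\<close>

lemma integrable_decay:
  assumes [measurable]: "g \<in> borel_measurable borel"
    and g: "\<And>z. \<bar>g z\<bar> \<le> K / (sqrt (1 + cmod z) * (1 + cmod z)\<^sup>2)"
  shows "integrable lborel g"
proof (rule Bochner_Integration.integrable_bound)
  show "integrable lborel (\<lambda>z. K * log_majorant z)"
    by (intro integrable_mult_right integrable_log_majorant)
  have K: "0 \<le> K" using g[of 0] by simp
  show "AE z in lborel. norm (g z) \<le> norm (K * log_majorant z)"
    using AE_lborel_singleton[of 0]
  proof eventually_elim
    case (elim z)
    have "sqrt (cmod z) * (1 + cmod z)\<^sup>2 \<le> sqrt (1 + cmod z) * (1 + cmod z)\<^sup>2"
      by (intro mult_right_mono) auto
    moreover have "0 < sqrt (cmod z) * (1 + cmod z)\<^sup>2" using elim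
      by (intro mult_pos_pos zero_less_power) (auto intro: add_pos_nonneg)
    ultimately have "K / (sqrt (1 + cmod z) * (1 + cmod z)\<^sup>2) \<le> K / (sqrt (cmod z) * (1 + cmod z)\<^sup>2)"
      using K by (intro divide_left_mono mult_pos_pos) (auto intro: add_pos_nonneg)
    then show ?case using g[of z] K by (simp add: log_majorant_def)
  qed
qed (simp)

lemma fs_le: "fs z \<le> 16 / (1 + cmod z)^4"
proof -
  have "(1 + cmod z)\<^sup>2 \<le> 2 * (1 + (cmod z)\<^sup>2)"
    using zero_le_power2[of "1 - cmod z"] by (simp add: power2_eq_square algebra_simps)
  then have "((1 + cmod z)\<^sup>2)\<^sup>2 \<le> (2 * (1 + (cmod z)\<^sup>2))\<^sup>2" by (intro power_mono) auto
  also have "((1 + cmod z)\<^sup>2)\<^sup>2 = (1 + cmod z)^4" by (simp flip: power_mult)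
  also have "(2 * (1 + (cmod z)\<^sup>2))\<^sup>2 = 4 * (1 + (cmod z)\<^sup>2)\<^sup>2"
    by (simp only: power_mult_distrib) simp
  finally have "(1 + cmod z)^4 \<le> 4 * (1 + (cmod z)\<^sup>2)\<^sup>2" .
  moreover have "0 < (1 + cmod z)^4" by (intro zero_less_power add_pos_nonneg) auto
  moreover have "0 < (1 + (cmod z)\<^sup>2)\<^sup>2" by simp
  ultimately show ?thesis by (simp add: fs_def divide_simps)
qed

lemma fs_le_cube: "\<bar>fs z\<bar> \<le> 16 / (1 + cmod z)^3"
proof -
  have "(1 + cmod z)^3 \<le> (1 + cmod z)^4" by (intro power_increasing) auto
  moreover have "0 < (1 + cmod z)^3" by (intro zero_less_power add_pos_nonneg) auto
  ultimately have "16 / (1 + cmod z)^4 \<le> 16 / (1 + cmod z)^3"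
    by (intro divide_left_mono) (auto intro!: mult_pos_pos zero_less_power add_pos_nonneg)
  then show ?thesis using fs_le[of z] fs_nonneg[of z] by linarith
qed

lemma integrable_ln_fs: "integrable lborel (\<lambda>z. ln ((cmod (z - a))\<^sup>2) * fs z)"
  by (rule integrable_ln_shift[OF _ fs_le_cube]) measurable

lemma ln_one_plus_sq_le:
  fixes r :: real assumes "0 \<le> r" shows "ln (1 + r\<^sup>2) \<le> 4 * sqrt (1 + r)"
proof -
  have "ln (1 + r\<^sup>2) \<le> ln ((sqrt (1 + r))^4)"
  proof -
    have "(sqrt (1 + r))^4 = (1 + r)\<^sup>2" using assms
      by (simp add: power4_eq_xxxx power2_eq_square)
    moreover have "1 + r\<^sup>2 \<le> (1 + r)\<^sup>2" using assms by (simp add: power2_eq_square algebra_simps)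
    ultimately show ?thesis using assms by (subst ln_le_cancel_iff) (auto intro: add_pos_nonneg)
  qed
  also have "\<dots> = 4 * ln (sqrt (1 + r))" using assms by (subst ln_realpow) auto
  also have "ln (sqrt (1 + r)) \<le> sqrt (1 + r)"
    using ln_le_minus_one[of "sqrt (1+r)"] assms by auto
  finally show ?thesis by simp
qed

lemma integrable_ln_one_plus_fs: "integrable lborel (\<lambda>z. ln (1 + (cmod z)\<^sup>2) * fs z)"
proof (rule integrable_decay)
  fix z
  have p: "0 < 1 + cmod z" by (intro add_pos_nonneg) auto
  have "\<bar>ln (1 + (cmod z)\<^sup>2) * fs z\<bar> \<le> 4 * sqrt (1 + cmod z) * (16 / (1 + cmod z)^3)"
    unfolding abs_mult using ln_one_plus_sq_le[of "cmod z"] fs_le_cube[of z]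
    by (intro mult_mono) auto
  also have "\<dots> = 64 / (sqrt (1 + cmod z) * (1 + cmod z)\<^sup>2)"
  proof -
    define s where "s = sqrt (1 + cmod z)"
    have s: "s > 0" "1 + cmod z = s * s" using p by (auto simp: s_def)
    have "(4 * s) * (16 / (s * s)^3) = 64 / (s * (s * s)\<^sup>2)" using s(1)
      by (simp add: field_simps power2_eq_square power3_eq_cube)
    then show ?thesis unfolding s_def[symmetric] by (metis s(2))
  qed
  finally show "\<bar>ln (1 + (cmod z)\<^sup>2) * fs z\<bar> \<le> 64 / (sqrt (1 + cmod z) * (1 + cmod z)\<^sup>2)" .
qed measurable

text \<open>The inversion \<open>z \<mapsto> 1 / z\<close> preserves the spherical measure and flips
  the sign of the logarithm, which explains the value 0. The proof uses an antiderivative vanishing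
  at both ends; since the integrand changes sign, integrability on the half-line is transported from
  the plane instead of being read off the antiderivative.\<close>

lemma integral_ln_norm_fs: "(\<integral>z. ln ((cmod z)\<^sup>2) * fs z \<partial>lborel) = 0"
proof -
  let ?\<phi> = "\<lambda>r::real. ln (r\<^sup>2) * (4 / (1 + r\<^sup>2)\<^sup>2)"
  let ?f = "\<lambda>r. 2 * pi * r * ?\<phi> r"
  define F where "F = (\<lambda>r::real. 4 * pi * (r\<^sup>2 * ln (r\<^sup>2) / (1 + r\<^sup>2) - ln (1 + r\<^sup>2)))"
  have p: "1 + r\<^sup>2 \<noteq> 0" "0 < 1 + r\<^sup>2" for r :: real by (smt (verit) zero_le_power2)+
  have m[measurable]: "?\<phi> \<in> borel_measurable borel" by measurable
  have "integrable lborel (\<lambda>z::complex. ?\<phi> (cmod z))"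
    using integrable_ln_fs[of 0] by (simp add: fs_def)
  then have "integrable (distr (lborel :: complex measure) borel cmod) ?\<phi>"
    by (subst integrable_distr_eq) auto
  moreover have ind: "ennreal (2 * pi * r) * indicator {0..} r = ennreal (indicator {0..} r * (2 * pi * r))" for r :: real
    by (auto simp: indicator_def)
  ultimately have int: "integrable lborel (\<lambda>r. (indicator {0..} r * (2 * pi * r)) *\<^sub>R ?\<phi> r)"
    unfolding distr_norm_complex_lborel ind
    by (subst (asm) integrable_density) (auto simp: indicator_def)
  have "(\<integral>z. ln ((cmod z)\<^sup>2) * fs z \<partial>lborel) = (\<integral>r. ?\<phi> r \<partial>distr (lborel :: complex measure) borel cmod)"
    by (subst integral_distr) (auto simp: fs_def)
  also have "\<dots> = (\<integral>r. (indicator {0..} r * (2 * pi * r)) *\<^sub>R ?\<phi> r \<partial>lborel)"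
    unfolding distr_norm_complex_lborel ind
    by (subst integral_density) (auto simp: indicator_def)
  also have "\<dots> = (LBINT r=0..\<infinity>. ?f r)"
  proof -
    have "einterval 0 \<infinity> = {0<..}" by (auto simp: einterval_def zero_ereal_def)
    moreover have "(\<integral>r. (indicator {0..} r * (2 * pi * r)) *\<^sub>R ?\<phi> r \<partial>lborel)
        = (\<integral>r. indicator {0<..} r *\<^sub>R ?f r \<partial>lborel)"
      by (rule Bochner_Integration.integral_cong) (auto simp: indicator_def)
    ultimately show ?thesis
      by (simp add: interval_lebesgue_integral_def set_lebesgue_integral_def)
  qed
  also have "\<dots> = 0 - 0"
  proof (rule interval_integral_FTC_integrable)
    fix x :: real assume "0 < ereal x"
    then have x: "0 < x" by (simp add: zero_ereal_def)
    have "DERIV F x :> ?f x"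
    proof -
      have "DERIV F x :> 4 * pi * (((2 * x * ln (x\<^sup>2) + x\<^sup>2 * (2 * x / x\<^sup>2)) * (1 + x\<^sup>2) - x\<^sup>2 * ln (x\<^sup>2) * (2 * x))
              / ((1 + x\<^sup>2) * (1 + x\<^sup>2)) - 2 * x / (1 + x\<^sup>2))"
        unfolding F_def using x p[of x]
        by (auto intro!: derivative_eq_intros)
      moreover have "((2 * x * L + x\<^sup>2 * (2 * x / x\<^sup>2)) * (1 + x\<^sup>2) - x\<^sup>2 * L * (2 * x))
              / ((1 + x\<^sup>2) * (1 + x\<^sup>2)) - 2 * x / (1 + x\<^sup>2) = 2 * x * L / (1 + x\<^sup>2)\<^sup>2" for L
        using x p[of x] by (simp add: divide_simps) (simp add: power2_eq_square algebra_simps)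
      ultimately have "DERIV F x :> 4 * pi * (2 * x * ln (x\<^sup>2) / (1 + x\<^sup>2)\<^sup>2)" by (simp only:)
      then show ?thesis by (rule DERIV_cong) simp
    qed
    then show "(F has_vector_derivative ?f x) (at x)"
      by (simp add: has_real_derivative_iff_has_vector_derivative)
    show "isCont ?f x" using x p[of x] by (intro continuous_intros) auto
  next
    have "einterval 0 \<infinity> = {0<..}" by (auto simp: einterval_def zero_ereal_def)
    then show "set_integrable lborel (einterval 0 \<infinity>) ?f"
      using int unfolding set_integrable_def
      by (rule_tac Bochner_Integration.integrable_cong[THEN iffD1, OF refl _ int]) (auto simp: indicator_def)
    have "(F \<longlongrightarrow> 0) (at_right 0)" unfolding F_def by real_asymp
    then show "((F \<circ> real_of_ereal) \<longlongrightarrow> 0) (at_right (0::ereal))"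
      by (simp add: zero_ereal_def ereal_tendsto_simps)
    have "(F \<longlongrightarrow> 0) at_top" unfolding F_def by real_asymp
    then show "((F \<circ> real_of_ereal) \<longlongrightarrow> 0) (at_left \<infinity>)"
      by (simp add: ereal_tendsto_simps)
  qed auto
  finally show ?thesis by simp
qed

section \<open>Green's identity for functions decaying at infinity\<close>

lemma measurable_Complex_swap [measurable]:
  "(\<lambda>(y, x). Complex x y) \<in> borel_measurable (lborel \<Otimes>\<^sub>M lborel)"
proof -
  have "(\<lambda>p. complex_of_real (snd p) + \<i> * complex_of_real (fst p)) \<in> borel_measurable (lborel \<Otimes>\<^sub>M lborel)"
    by measurable
  then show ?thesis by (simp add: Complex_eq split_beta')
qed

text \<open>The imaginary part is the first component so that the inner integral in Fubini's theorem
  runs along horizontal lines.\<close>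

lemma lborel_complex_eq_distr_pair:
  "lborel = distr (lborel \<Otimes>\<^sub>M lborel) borel (\<lambda>(y, x). Complex x y)"
proof (rule lborel_eqI)
  fix l u :: complex
  assume le: "\<And>b. b \<in> Basis \<Longrightarrow> l \<bullet> b \<le> u \<bullet> b"
  have lu: "Re l \<le> Re u" "Im l \<le> Im u"
    using le[of 1] le[of \<i>] by (auto simp: Basis_complex_def inner_complex_def)
  have "(\<lambda>(y, x). Complex x y) -` box l u \<inter> space (lborel \<Otimes>\<^sub>M lborel) = {Im l<..<Im u} \<times> {Re l<..<Re u}"
    by (auto simp: in_box_complex_iff space_pair_measure)
  then have "emeasure (distr (lborel \<Otimes>\<^sub>M lborel) borel (\<lambda>(y, x). Complex x y)) (box l u)
      = emeasure (lborel \<Otimes>\<^sub>M lborel) ({Im l<..<Im u} \<times> {Re l<..<Re u})"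
    by (subst emeasure_distr) auto
  also have "\<dots> = ennreal (Im u - Im l) * ennreal (Re u - Re l)"
    using lu by (subst lborel.emeasure_pair_measure_Times) auto
  also have "\<dots> = ennreal (\<Prod>b\<in>Basis. (u - l) \<bullet> b)"
    using lu by (simp add: Basis_complex_def inner_complex_def ennreal_mult' mult.commute)
  finally show "emeasure (distr (lborel \<Otimes>\<^sub>M lborel) borel (\<lambda>(y, x). Complex x y)) (box l u)
      = ennreal (\<Prod>b\<in>Basis. (u - l) \<bullet> b)" .
qed simp

text \<open>Rotation by a quarter turn reduces vertical derivatives to horizontal ones.\<close>

lemma lborel_complex_eq_distr_rot: "lborel = distr lborel borel (\<lambda>z. \<i> * z)"
proof (rule lborel_eqI)
  fix l u :: complex
  assume le: "\<And>b. b \<in> Basis \<Longrightarrow> l \<bullet> b \<le> u \<bullet> b"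
  have lu: "Re l \<le> Re u" "Im l \<le> Im u"
    using le[of 1] le[of \<i>] by (auto simp: Basis_complex_def inner_complex_def)
  have "(\<lambda>z. \<i> * z) -` box l u \<inter> space lborel = box (Complex (Im l) (- Re u)) (Complex (Im u) (- Re l))"
    by (auto simp: in_box_complex_iff)
  then have "emeasure (distr lborel borel (\<lambda>z. \<i> * z)) (box l u)
      = emeasure lborel (box (Complex (Im l) (- Re u)) (Complex (Im u) (- Re l)))"
    by (subst emeasure_distr) auto
  also have "\<dots> = ennreal (\<Prod>b\<in>Basis. (u - l) \<bullet> b)"
    using lu by (auto simp: emeasure_lborel_box_eq Basis_complex_def inner_complex_def mult.commute)
  finally show "emeasure (distr lborel borel (\<lambda>z. \<i> * z)) (box l u) = ennreal (\<Prod>b\<in>Basis. (u - l) \<bullet> b)" .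
qed simp

lemma integral_real_derivative_zero:
  fixes F f :: "real \<Rightarrow> real"
  assumes F: "\<And>x. DERIV F x :> f x" and c: "continuous_on UNIV f" and i: "integrable lborel f"
    and l: "(F \<longlongrightarrow> 0) at_top" "(F \<longlongrightarrow> 0) at_bot"
  shows "(\<integral>x. f x \<partial>lborel) = 0"
proof -
  have "(LBINT x=-\<infinity>..\<infinity>. f x) = 0 - 0"
  proof (rule interval_integral_FTC_integrable)
    show "(F has_vector_derivative f x) (at x)" for x
      using F by (simp add: has_real_derivative_iff_has_vector_derivative)
    show "isCont f x" for x using c by (simp add: continuous_on_eq_continuous_at)
    show "set_integrable lborel (einterval (- \<infinity>) \<infinity>) f" using i by (simp add: set_integrable_def)
  qed (use l in \<open>auto simp: ereal_tendsto_simps\<close>)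
  then show ?thesis by (simp add: interval_lebesgue_integral_def set_lebesgue_integral_def)
qed

text \<open>On almost every horizontal line the fundamental theorem of calculus gives 0, because
  both ends of the line run to infinity, where \<open>V\<close> vanishes; Fubini adds up the
  lines.\<close>

lemma integral_partial_Re_zero:
  fixes V V' :: "complex \<Rightarrow> real"
  assumes D: "\<And>z. ((\<lambda>t. V (z + complex_of_real t)) has_real_derivative V' z) (at 0)"
    and c: "continuous_on UNIV V'" and i: "integrable lborel V'" and l: "(V \<longlongrightarrow> 0) at_infinity"
  shows "(\<integral>z. V' z \<partial>lborel) = 0"
proof -
  have [measurable]: "V' \<in> borel_measurable borel" using c by (rule borel_measurable_continuous_onI)
  define f where "f = (\<lambda>(y, x). V' (Complex x y))"
  have int: "integrable (lborel \<Otimes>\<^sub>M lborel) f"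
    using i unfolding f_def
    by (subst (asm) lborel_complex_eq_distr_pair, subst (asm) integrable_distr_eq) (auto simp: split_beta')
  have "(\<integral>z. V' z \<partial>lborel) = (\<integral>p. f p \<partial>(lborel \<Otimes>\<^sub>M lborel))"
    unfolding f_def
    by (subst lborel_complex_eq_distr_pair, subst integral_distr) (auto simp: split_beta')
  also have "\<dots> = (\<integral>y. (\<integral>x. f (y, x) \<partial>lborel) \<partial>lborel)"
    using lborel_pair.integral_fst'[OF int] by simp
  also have "\<dots> = (\<integral>(y::real). 0 \<partial>lborel)"
  proof (rule integral_cong_AE)
    \<comment> \<open>Integrability of \<open>V'\<close> passes to almost every line, not to all of
      them, hence the almost-everywhere argument.\<close>
    show "AE y in lborel. (\<integral>x. f (y, x) \<partial>lborel) = 0"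
      using lborel_pair.AE_integrable_fst'[OF int]
    proof eventually_elim
      case (elim y)
      show ?case
      proof (rule integral_real_derivative_zero[where F = "\<lambda>x. V (Complex x y)"])
        fix x
        have "((\<lambda>t. V (Complex (t + x) y)) has_real_derivative V' (Complex x y)) (at 0)"
          using D[of "Complex x y"] by (simp add: Complex_eq algebra_simps)
        then show "((\<lambda>x. V (Complex x y)) has_real_derivative f (y, x)) (at x)"
          using DERIV_shift[of "\<lambda>x. V (Complex x y)" "f (y, x)" 0 x] by (simp add: f_def)
      next
        show "continuous_on UNIV (\<lambda>x. f (y, x))" unfolding f_def Complex_eq
          by (auto intro!: continuous_intros continuous_on_compose2[OF c])
      next
        have *: "\<bar>x\<bar> \<le> norm (Complex x y)" for x using abs_Re_le_cmod[of "Complex x y"] by simp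
        have "filterlim (\<lambda>x. Complex x y) at_infinity at_top"
          by (rule filterlim_norm_at_top_imp_at_infinity, rule filterlim_at_top_mono[OF filterlim_abs_real]) (use * in auto)
        then show "((\<lambda>x. V (Complex x y)) \<longlongrightarrow> 0) at_top" by (rule filterlim_compose[OF l])
        have "filterlim (\<lambda>x. Complex x y) at_infinity at_bot"
          by (rule filterlim_norm_at_top_imp_at_infinity, rule filterlim_at_top_mono[OF filterlim_uminus_at_top_at_bot])
             (use * abs_ge_minus_self order_trans in \<open>blast intro: always_eventually\<close>)
        then show "((\<lambda>x. V (Complex x y)) \<longlongrightarrow> 0) at_bot" by (rule filterlim_compose[OF l])
      qed (use elim in simp)
    qed
  qed (use lborel_pair.integrable_fst'[OF int] in \<open>auto intro: borel_measurable_integrable\<close>)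
  finally show ?thesis by simp
qed

lemma integral_directional_derivative_zero:
  fixes V V' :: "complex \<Rightarrow> real"
  assumes e: "e \<in> {1, \<i>}"
    and D: "\<And>z. ((\<lambda>t. V (z + complex_of_real t * e)) has_real_derivative V' z) (at 0)"
    and c: "continuous_on UNIV V'" and i: "integrable lborel V'" and l: "(V \<longlongrightarrow> 0) at_infinity"
  shows "(\<integral>z. V' z \<partial>lborel) = 0"
proof (cases "e = 1")
  case True
  then show ?thesis using D by (intro integral_partial_Re_zero[OF _ c i l]) simp
next
  case False
  then have e: "e = \<i>" using e by simp
  have [measurable]: "V' \<in> borel_measurable borel" using c by (rule borel_measurable_continuous_onI)
  have "(\<integral>z. V' z \<partial>lborel) = (\<integral>z. V' (\<i> * z) \<partial>lborel)"
    by (subst lborel_complex_eq_distr_rot, subst integral_distr) auto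
  also have "\<dots> = 0"
  proof (rule integral_partial_Re_zero[where V = "\<lambda>z. V (\<i> * z)"])
    show "((\<lambda>t. V (\<i> * (z + complex_of_real t))) has_real_derivative V' (\<i> * z)) (at 0)" for z
      using D[of "\<i> * z"] by (simp add: e algebra_simps)
    show "continuous_on UNIV (\<lambda>z. V' (\<i> * z))"
      by (intro continuous_on_compose2[OF c] continuous_intros) auto
    show "integrable lborel (\<lambda>z. V' (\<i> * z))"
      using i by (subst (asm) lborel_complex_eq_distr_rot, subst (asm) integrable_distr_eq) auto
    have "filterlim (\<lambda>z::complex. \<i> * z) at_infinity at_infinity"
      by (rule tendsto_mult_filterlim_at_infinity[where c = \<i>]) (auto intro: filterlim_ident)
    then show "((\<lambda>z. V (\<i> * z)) \<longlongrightarrow> 0) at_infinity" by (rule filterlim_compose[OF l])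
  qed
  finally show ?thesis .
qed

section \<open>Growth classes and integration by parts\<close>

text \<open>The derivatives along the direction \<open>e\<close> are explicit arguments, so that
  closed formulas and the operators \<open>dx\<close>, \<open>dy\<close> can be used
  interchangeably. Only pure second derivatives are listed, as they make up the Laplacian.\<close>

definition C2_axes :: "(complex \<Rightarrow> real) \<Rightarrow> (complex \<Rightarrow> complex \<Rightarrow> real) \<Rightarrow> (complex \<Rightarrow> complex \<Rightarrow> real) \<Rightarrow> bool" where
  "C2_axes g g1 g2 \<longleftrightarrow> continuous_on UNIV g \<and>
     (\<forall>e\<in>{1, \<i>}. continuous_on UNIV (g1 e) \<and> continuous_on UNIV (g2 e) \<and>
        (\<forall>z. ((\<lambda>t. g (z + complex_of_real t * e)) has_real_derivative g1 e z) (at 0) \<and>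
             ((\<lambda>t. g1 e (z + complex_of_real t * e)) has_real_derivative g2 e z) (at 0)))"

text \<open>These are the rates of a C2 function of \<open>1 / z\<close> that vanishes at the
  origin, that is, of \<open>f\<close> near the point at infinity after subtracting its value
  there.\<close>

definition decaying :: "(complex \<Rightarrow> real) \<Rightarrow> (complex \<Rightarrow> complex \<Rightarrow> real) \<Rightarrow> (complex \<Rightarrow> complex \<Rightarrow> real) \<Rightarrow> bool" where
  "decaying g g1 g2 \<longleftrightarrow> C2_axes g g1 g2 \<and>
     (\<exists>K. \<forall>z. \<bar>g z\<bar> \<le> K / (1 + cmod z) \<and>
        (\<forall>e\<in>{1, \<i>}. \<bar>g1 e z\<bar> \<le> K / (1 + cmod z)\<^sup>2 \<and> \<bar>g2 e z\<bar> \<le> K / (1 + cmod z) ^ 3))"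

text \<open>A class containing both the constants and the regularised logarithms. Square-root growth
  is the slack that keeps the product with a cubically decaying second derivative
  integrable.\<close>

definition tempered :: "(complex \<Rightarrow> real) \<Rightarrow> (complex \<Rightarrow> complex \<Rightarrow> real) \<Rightarrow> (complex \<Rightarrow> complex \<Rightarrow> real) \<Rightarrow> bool" where
  "tempered g g1 g2 \<longleftrightarrow> C2_axes g g1 g2 \<and>
     (\<exists>K. \<forall>z. \<bar>g z\<bar> \<le> K * sqrt (1 + cmod z) \<and>
        (\<forall>e\<in>{1, \<i>}. \<bar>g1 e z\<bar> \<le> K \<and> \<bar>g2 e z\<bar> \<le> K / (1 + cmod z)\<^sup>2))"

lemma tendsto_const_over_norm_at_infinity:
  "((\<lambda>z::complex. K / (1 + cmod z)) \<longlongrightarrow> 0) at_infinity"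
proof -
  have "filterlim (\<lambda>z::complex. 1 + cmod z) at_top at_infinity"
    by (intro filterlim_tendsto_add_at_top[OF tendsto_const] filterlim_norm_at_top)
  then show ?thesis
    by (intro tendsto_divide_0[OF tendsto_const] filterlim_at_top_imp_at_infinity)
qed

text \<open>Each direction is treated separately: the rates of the two classes make both products
  integrable and the boundary term of order \<open>1 / |z|\<close> at worst.\<close>

lemma
  assumes g: "decaying g g1 g2" and \<psi>: "tempered \<psi> \<psi>1 \<psi>2"
  shows integrable_tempered_laplacian: "integrable lborel (\<lambda>z. \<psi> z * (g2 1 z + g2 \<i> z))"
    and integrable_laplacian_tempered: "integrable lborel (\<lambda>z. g z * (\<psi>2 1 z + \<psi>2 \<i> z))"
    and green_identity: "(\<integral>z. \<psi> z * (g2 1 z + g2 \<i> z) \<partial>lborel) = (\<integral>z. g z * (\<psi>2 1 z + \<psi>2 \<i> z) \<partial>lborel)"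
proof -
  obtain K where K: "\<And>z. \<bar>g z\<bar> \<le> K / (1 + cmod z)" "\<And>z e. e \<in> {1, \<i>} \<Longrightarrow> \<bar>g1 e z\<bar> \<le> K / (1 + cmod z)\<^sup>2"
    "\<And>z e. e \<in> {1, \<i>} \<Longrightarrow> \<bar>g2 e z\<bar> \<le> K / (1 + cmod z) ^ 3"
    using g unfolding decaying_def by blast
  obtain L where L: "\<And>z. \<bar>\<psi> z\<bar> \<le> L * sqrt (1 + cmod z)" "\<And>z e. e \<in> {1, \<i>} \<Longrightarrow> \<bar>\<psi>1 e z\<bar> \<le> L"
    "\<And>z e. e \<in> {1, \<i>} \<Longrightarrow> \<bar>\<psi>2 e z\<bar> \<le> L / (1 + cmod z)\<^sup>2"
    using \<psi> unfolding tempered_def by blast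
  have KL: "0 \<le> K" "0 \<le> L" using K(1)[of 0] L(1)[of 0] by auto
  have cg: "continuous_on UNIV g" "\<And>e. e \<in> {1, \<i>} \<Longrightarrow> continuous_on UNIV (g1 e)"
    "\<And>e. e \<in> {1, \<i>} \<Longrightarrow> continuous_on UNIV (g2 e)"
    using g unfolding decaying_def C2_axes_def by blast+
  have c\<psi>: "continuous_on UNIV \<psi>" "\<And>e. e \<in> {1, \<i>} \<Longrightarrow> continuous_on UNIV (\<psi>1 e)"
    "\<And>e. e \<in> {1, \<i>} \<Longrightarrow> continuous_on UNIV (\<psi>2 e)"
    using \<psi> unfolding tempered_def C2_axes_def by blast+
  have dg: "((\<lambda>t. g (z + complex_of_real t * e)) has_real_derivative g1 e z) (at 0)"
    "((\<lambda>t. g1 e (z + complex_of_real t * e)) has_real_derivative g2 e z) (at 0)" if "e \<in> {1, \<i>}" for e z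
    using g that unfolding decaying_def C2_axes_def by blast+
  have d\<psi>: "((\<lambda>t. \<psi> (z + complex_of_real t * e)) has_real_derivative \<psi>1 e z) (at 0)"
    "((\<lambda>t. \<psi>1 e (z + complex_of_real t * e)) has_real_derivative \<psi>2 e z) (at 0)" if "e \<in> {1, \<i>}" for e z
    using \<psi> that unfolding tempered_def C2_axes_def by blast+
  have bd: "K * L * sqrt x / x ^ 3 = K * L / (sqrt x * x\<^sup>2)" "K * L / x ^ 3 \<le> K * L / (sqrt x * x\<^sup>2)"
    if "1 \<le> x" for x :: real
  proof -
    define s where "s = sqrt x"
    have s: "1 \<le> s" "x = s * s" using that by (auto simp: s_def)
    show "K * L * sqrt x / x ^ 3 = K * L / (sqrt x * x\<^sup>2)"
      unfolding s_def[symmetric] unfolding s(2) using s(1)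
      by (simp add: field_simps power2_eq_square power3_eq_cube)
    have "sqrt x * x\<^sup>2 \<le> x ^ 3"
      using that real_sqrt_le_mono[of x "x * x"] mult_right_mono[of 1 x x] mult_right_mono[of "sqrt x" x "x\<^sup>2"]
      by (simp add: power2_eq_square power3_eq_cube)
    then show "K * L / x ^ 3 \<le> K * L / (sqrt x * x\<^sup>2)"
      using that KL by (intro divide_left_mono) auto
  qed
  have b1: "\<bar>\<psi> z * g2 e z\<bar> \<le> K * L / (sqrt (1 + cmod z) * (1 + cmod z)\<^sup>2)" if "e \<in> {1, \<i>}" for e z
  proof -
    have "\<bar>\<psi> z\<bar> * \<bar>g2 e z\<bar> \<le> (L * sqrt (1 + cmod z)) * (K / (1 + cmod z) ^ 3)"
      using L(1)[of z] K(3)[OF that, of z] KL by (intro mult_mono) auto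
    also have "\<dots> = K * L * sqrt (1 + cmod z) / (1 + cmod z) ^ 3" by simp
    finally show ?thesis using bd(1)[of "1 + cmod z"] by (simp add: abs_mult)
  qed
  have b2: "\<bar>g z * \<psi>2 e z\<bar> \<le> K * L / (sqrt (1 + cmod z) * (1 + cmod z)\<^sup>2)" if "e \<in> {1, \<i>}" for e z
  proof -
    have "\<bar>g z\<bar> * \<bar>\<psi>2 e z\<bar> \<le> (K / (1 + cmod z)) * (L / (1 + cmod z)\<^sup>2)"
      using L(3)[OF that, of z] K(1)[of z] KL by (intro mult_mono) auto
    also have "\<dots> = K * L / (1 + cmod z) ^ 3" by (simp add: power2_eq_square power3_eq_cube)
    finally show ?thesis using bd(2)[of "1 + cmod z"] by (simp add: abs_mult)
  qed
  have i1: "integrable lborel (\<lambda>z. \<psi> z * g2 e z)" if "e \<in> {1, \<i>}" for e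
    using b1[OF that] c\<psi>(1) cg(3)[OF that]
    by (intro integrable_decay[where K = "K * L"] borel_measurable_continuous_onI continuous_intros) auto
  have i2: "integrable lborel (\<lambda>z. g z * \<psi>2 e z)" if "e \<in> {1, \<i>}" for e
    using b2[OF that] cg(1) c\<psi>(3)[OF that]
    by (intro integrable_decay[where K = "K * L"] borel_measurable_continuous_onI continuous_intros) auto
  \<comment> \<open>The integrand is the derivative along \<open>e\<close> of
    \<open>\<psi> z * g1 e z - g z * \<psi>1 e z\<close>, since the products of the two first
    derivatives cancel.\<close>
  have eq: "(\<integral>z. \<psi> z * g2 e z - g z * \<psi>2 e z \<partial>lborel) = 0" if e: "e \<in> {1, \<i>}" for e
  proof (rule integral_directional_derivative_zero[OF e, where V = "\<lambda>z. \<psi> z * g1 e z - g z * \<psi>1 e z"])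
    show "((\<lambda>t. \<psi> (z + complex_of_real t * e) * g1 e (z + complex_of_real t * e) -
                g (z + complex_of_real t * e) * \<psi>1 e (z + complex_of_real t * e)) has_real_derivative
          \<psi> z * g2 e z - g z * \<psi>2 e z) (at 0)" for z
      by (rule derivative_eq_intros dg[OF e] d\<psi>[OF e] refl)+ simp
    show "continuous_on UNIV (\<lambda>z. \<psi> z * g2 e z - g z * \<psi>2 e z)"
      using c\<psi>(1) cg(3)[OF e] cg(1) c\<psi>(3)[OF e] by (intro continuous_intros)
    show "integrable lborel (\<lambda>z. \<psi> z * g2 e z - g z * \<psi>2 e z)"
      using i1[OF e] i2[OF e] by simp
    show "((\<lambda>z. \<psi> z * g1 e z - g z * \<psi>1 e z) \<longlongrightarrow> 0) at_infinity"
    proof (rule Lim_null_comparison[OF always_eventually tendsto_const_over_norm_at_infinity[of "2 * (K * L)"]], rule allI)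
      fix z
      have p: "1 \<le> 1 + cmod z" by simp
      have "sqrt (1 + cmod z) \<le> 1 + cmod z"
        using real_sqrt_le_mono[of "1 + cmod z" "(1 + cmod z) * (1 + cmod z)"] mult_right_mono[of 1 "1 + cmod z" "1 + cmod z"] by simp
      have "\<bar>\<psi> z * g1 e z\<bar> \<le> (L * sqrt (1 + cmod z)) * (K / (1 + cmod z)\<^sup>2)"
        unfolding abs_mult using L(1)[of z] K(2)[OF e, of z] KL by (intro mult_mono) auto
      also have "\<dots> \<le> (L * (1 + cmod z)) * (K / (1 + cmod z)\<^sup>2)"
        using \<open>sqrt (1 + cmod z) \<le> 1 + cmod z\<close> KL by (intro mult_right_mono mult_left_mono) auto
      also have "\<dots> = K * L / (1 + cmod z)" using p by (auto simp: power2_eq_square)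
      finally have 1: "\<bar>\<psi> z * g1 e z\<bar> \<le> K * L / (1 + cmod z)" .
      have "\<bar>g z * \<psi>1 e z\<bar> \<le> (K / (1 + cmod z)) * L"
        unfolding abs_mult using L(2)[OF e, of z] K(1)[of z] KL by (intro mult_mono) auto
      then show "norm (\<psi> z * g1 e z - g z * \<psi>1 e z) \<le> 2 * (K * L) / (1 + cmod z)"
        using 1 by (simp add: abs_le_iff)
    qed
  qed
  have e: "1 \<in> {1, \<i>}" "\<i> \<in> {1, \<i>}" by auto
  show I1: "integrable lborel (\<lambda>z. \<psi> z * (g2 1 z + g2 \<i> z))"
    using i1[OF e(1)] i1[OF e(2)] by (simp add: distrib_left)
  show I2: "integrable lborel (\<lambda>z. g z * (\<psi>2 1 z + \<psi>2 \<i> z))"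
    using i2[OF e(1)] i2[OF e(2)] by (simp add: distrib_left)
  show "(\<integral>z. \<psi> z * (g2 1 z + g2 \<i> z) \<partial>lborel) = (\<integral>z. g z * (\<psi>2 1 z + \<psi>2 \<i> z) \<partial>lborel)"
    using eq[OF e(1)] eq[OF e(2)] i1[OF e(1)] i1[OF e(2)] i2[OF e(1)] i2[OF e(2)]
    by (simp add: distrib_left)
qed

lemma tempered_one: "tempered (\<lambda>_. 1) (\<lambda>_ _. 0) (\<lambda>_ _. 0)"
  unfolding tempered_def C2_axes_def by (auto intro!: exI[of _ 1])

lemma
  assumes "decaying g g1 g2"
  shows integrable_laplacian: "integrable lborel (\<lambda>z. g2 1 z + g2 \<i> z)"
    and integral_laplacian: "(\<integral>z. g2 1 z + g2 \<i> z \<partial>lborel) = 0"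
  using integrable_tempered_laplacian[OF assms tempered_one] green_identity[OF assms tempered_one] by simp_all

section \<open>Logarithmic potentials\<close>

text \<open>The parameter \<open>\<epsilon>\<close> smooths the singularity at \<open>a\<close>. The
  case \<open>\<epsilon> = 1\<close>, \<open>a = 0\<close> is the potential
  \<open>ln (1 + |z|\<^sup>2)\<close> of the spherical metric.\<close>

definition logp :: "real \<Rightarrow> complex \<Rightarrow> complex \<Rightarrow> real" where
  "logp \<epsilon> a z = ln (\<epsilon>\<^sup>2 + (cmod (z - a))\<^sup>2)"

definition logp1 :: "real \<Rightarrow> complex \<Rightarrow> complex \<Rightarrow> complex \<Rightarrow> real" where
  "logp1 \<epsilon> a e z = 2 * ((z - a) \<bullet> e) / (\<epsilon>\<^sup>2 + (cmod (z - a))\<^sup>2)"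

definition logp2 :: "real \<Rightarrow> complex \<Rightarrow> complex \<Rightarrow> complex \<Rightarrow> real" where
  "logp2 \<epsilon> a e z = 2 / (\<epsilon>\<^sup>2 + (cmod (z - a))\<^sup>2) - 4 * ((z - a) \<bullet> e)\<^sup>2 / (\<epsilon>\<^sup>2 + (cmod (z - a))\<^sup>2)\<^sup>2"

lemma norm_sq_along_axis:
  assumes "e \<in> {1, \<i>}"
  shows "(cmod (z + complex_of_real t * e - a))\<^sup>2 = (cmod (z - a))\<^sup>2 + 2 * t * ((z - a) \<bullet> e) + t\<^sup>2"
  using assms unfolding cmod_power2 by (auto simp: inner_complex_def power2_eq_square algebra_simps)

lemma inner_along_axis:
  assumes "e \<in> {1, \<i>}"
  shows "(z + complex_of_real t * e - a) \<bullet> e = (z - a) \<bullet> e + t"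
  using assms by (auto simp: inner_complex_def)

lemma reg_norm_pos: "0 < \<epsilon> \<Longrightarrow> 0 < \<epsilon>\<^sup>2 + (cmod z)\<^sup>2"
  by (simp add: add_pos_nonneg)

lemma C2_axes_logp:
  assumes "0 < \<epsilon>" shows "C2_axes (logp \<epsilon> a) (logp1 \<epsilon> a) (logp2 \<epsilon> a)"
proof -
  have p: "\<epsilon>\<^sup>2 + (cmod z)\<^sup>2 \<noteq> 0" "0 < \<epsilon>\<^sup>2 + (cmod z)\<^sup>2" for z using reg_norm_pos[OF assms, of z] by auto
  show ?thesis
    unfolding C2_axes_def
  proof (intro conjI ballI allI)
    show "continuous_on UNIV (logp \<epsilon> a)" unfolding logp_def using p by (intro continuous_intros) auto
    fix e :: complex assume e: "e \<in> {1, \<i>}"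
    show "continuous_on UNIV (logp1 \<epsilon> a e)" unfolding logp1_def using p by (intro continuous_intros) auto
    show "continuous_on UNIV (logp2 \<epsilon> a e)" unfolding logp2_def using p by (intro continuous_intros) auto
    fix z
    show "((\<lambda>t. logp \<epsilon> a (z + complex_of_real t * e)) has_real_derivative logp1 \<epsilon> a e z) (at 0)"
      unfolding logp_def logp1_def norm_sq_along_axis[OF e] using p[of "z - a"]
      by (auto intro!: derivative_eq_intros)
    show "((\<lambda>t. logp1 \<epsilon> a e (z + complex_of_real t * e)) has_real_derivative logp2 \<epsilon> a e z) (at 0)"
    proof -
      define D where "D = \<epsilon>\<^sup>2 + (cmod (z - a))\<^sup>2"
      define I where "I = (z - a) \<bullet> e"
      have D: "D \<noteq> 0" using p[of "z - a"] by (simp add: D_def)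
      have "((\<lambda>t. 2 * (I + t) / (D + 2 * t * I + t\<^sup>2)) has_real_derivative (2 * D - 2 * I * (2 * I)) / (D * D)) (at 0)"
        using D by (auto intro!: derivative_eq_intros)
      also have "(2 * D - 2 * I * (2 * I)) / (D * D) = 2 / D - 4 * I\<^sup>2 / D\<^sup>2"
        using D by (simp add: diff_divide_distrib power2_eq_square)
      finally show ?thesis
        unfolding logp1_def logp2_def norm_sq_along_axis[OF e] inner_along_axis[OF e] D_def I_def
        by (simp add: add.assoc)
    qed
  qed
qed

lemma abs_inner_axis_le: "e \<in> {1, \<i>} \<Longrightarrow> \<bar>z \<bullet> e\<bar> \<le> cmod z"
  using Cauchy_Schwarz_ineq2[of z e] by auto

lemma one_plus_norm_le: "1 + cmod z \<le> (1 + cmod a) * (1 + cmod (z - a))"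
  using one_plus_norm_diff[of "z - a" "- a"] by simp

lemma one_plus_sq_le: fixes r :: real shows "(1 + r)\<^sup>2 \<le> 2 * (1 + r\<^sup>2)"
  using zero_le_power2[of "1 - r"] by (simp add: power2_eq_square algebra_simps)

lemma reg_norm_ge:
  assumes "0 < \<epsilon>"
  shows "(1 + cmod z)\<^sup>2 \<le> 2 * (1 + cmod a)\<^sup>2 * (1 + 1 / \<epsilon>\<^sup>2) * (\<epsilon>\<^sup>2 + (cmod (z - a))\<^sup>2)"
proof -
  have "(1 + cmod z)\<^sup>2 \<le> ((1 + cmod a) * (1 + cmod (z - a)))\<^sup>2"
    by (intro power_mono one_plus_norm_le) auto
  also have "\<dots> = (1 + cmod a)\<^sup>2 * (1 + cmod (z - a))\<^sup>2" by (simp add: power_mult_distrib)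
  also have "\<dots> \<le> (1 + cmod a)\<^sup>2 * (2 * (1 + (cmod (z - a))\<^sup>2))"
    by (intro mult_left_mono one_plus_sq_le) auto
  also have "\<dots> = 2 * (1 + cmod a)\<^sup>2 * (1 + (cmod (z - a))\<^sup>2)" by simp
  also have "\<dots> \<le> 2 * (1 + cmod a)\<^sup>2 * ((1 + 1 / \<epsilon>\<^sup>2) * (\<epsilon>\<^sup>2 + (cmod (z - a))\<^sup>2))"
    using assms by (intro mult_left_mono) (auto simp: field_simps)
  finally show ?thesis by (simp add: mult_ac)
qed

lemma tempered_logp:
  assumes "0 < \<epsilon>" shows "tempered (logp \<epsilon> a) (logp1 \<epsilon> a) (logp2 \<epsilon> a)"
proof -
  define c where "c = 2 * (1 + cmod a)\<^sup>2 * (1 + 1 / \<epsilon>\<^sup>2)"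
  define K0 where "K0 = \<bar>ln (\<epsilon>\<^sup>2)\<bar> + ln (1 + \<epsilon>\<^sup>2) + 4 * sqrt (1 + cmod a)"
  \<comment> \<open>The summands serve the function, its first and its second derivatives in turn.
    The bound degenerates as \<open>\<epsilon>\<close> tends to 0, which is harmless since Green's
    identity is used for one \<open>\<epsilon>\<close> at a time.\<close>
  define K where "K = K0 + (1 + 1 / \<epsilon>\<^sup>2) + 6 * c"
  have c0: "0 \<le> c" by (simp add: c_def)
  have K00: "0 \<le> K0" using assms by (simp add: K0_def ln_ge_zero)
  have e0: "0 \<le> 1 + 1 / \<epsilon>\<^sup>2" by simp
  have KK: "K0 \<le> K" "1 + 1 / \<epsilon>\<^sup>2 \<le> K" "6 * c \<le> K" using c0 K00 e0 by (auto simp: K_def)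
  have "\<bar>logp \<epsilon> a z\<bar> \<le> K * sqrt (1 + cmod z)" for z
  proof -
    let ?r = "cmod (z - a)" and ?D = "\<epsilon>\<^sup>2 + (cmod (z - a))\<^sup>2"
    have D: "0 < ?D" by (rule reg_norm_pos) fact
    have s1: "1 \<le> sqrt (1 + cmod z)" by simp
    have "ln (\<epsilon>\<^sup>2) \<le> ln ?D" using assms D by (subst ln_le_cancel_iff) auto
    moreover have "ln ?D \<le> ln (1 + \<epsilon>\<^sup>2) + ln (1 + ?r\<^sup>2)"
    proof -
      have "ln ?D \<le> ln ((1 + \<epsilon>\<^sup>2) * (1 + ?r\<^sup>2))"
        using D assms by (subst ln_le_cancel_iff) (auto simp: algebra_simps intro!: add_pos_nonneg)
      also have "\<dots> = ln (1 + \<epsilon>\<^sup>2) + ln (1 + ?r\<^sup>2)"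
        using assms by (intro ln_mult_pos) (auto intro!: add_pos_nonneg)
      finally show ?thesis .
    qed
    moreover have "ln (1 + ?r\<^sup>2) \<le> 4 * sqrt (1 + ?r)" by (rule ln_one_plus_sq_le) simp
    moreover have "sqrt (1 + ?r) \<le> sqrt (1 + cmod a) * sqrt (1 + cmod z)"
      using one_plus_norm_diff[of z a] by (simp flip: real_sqrt_mult)
    moreover have "0 \<le> ln (1 + \<epsilon>\<^sup>2)" by simp
    ultimately have "\<bar>ln ?D\<bar> \<le> \<bar>ln (\<epsilon>\<^sup>2)\<bar> + ln (1 + \<epsilon>\<^sup>2) + 4 * (sqrt (1 + cmod a) * sqrt (1 + cmod z))"
      by (smt (verit) real_sqrt_ge_zero norm_ge_zero mult_nonneg_nonneg)
    also have "\<dots> \<le> (\<bar>ln (\<epsilon>\<^sup>2)\<bar> + ln (1 + \<epsilon>\<^sup>2)) * sqrt (1 + cmod z) + 4 * (sqrt (1 + cmod a) * sqrt (1 + cmod z))"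
      using s1 mult_left_mono[OF s1, of "\<bar>ln (\<epsilon>\<^sup>2)\<bar> + ln (1 + \<epsilon>\<^sup>2)"] by simp
    also have "\<dots> = K0 * sqrt (1 + cmod z)" by (simp add: K0_def algebra_simps)
    also have "\<dots> \<le> K * sqrt (1 + cmod z)" using KK by (intro mult_right_mono) auto
    finally show ?thesis by (simp add: logp_def)
  qed
  moreover have "\<bar>logp1 \<epsilon> a e z\<bar> \<le> K \<and> \<bar>logp2 \<epsilon> a e z\<bar> \<le> K / (1 + cmod z)\<^sup>2" if e: "e \<in> {1, \<i>}" for e z
  proof -
    define r where "r = cmod (z - a)"
    define D where "D = \<epsilon>\<^sup>2 + r\<^sup>2"
    define I where "I = (z - a) \<bullet> e"
    have D: "0 < D" unfolding D_def r_def by (rule reg_norm_pos) fact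
    have I: "\<bar>I\<bar> \<le> r" using abs_inner_axis_le[OF e] by (simp add: I_def r_def)
    have "\<bar>I\<bar>\<^sup>2 \<le> r\<^sup>2" using I by (intro power_mono) auto
    then have "I\<^sup>2 \<le> r\<^sup>2" by simp
    then have I2: "I\<^sup>2 \<le> D" using zero_le_power2[of \<epsilon>] unfolding D_def by linarith
    have "2 * r \<le> 1 + r\<^sup>2" using zero_le_power2[of "1 - r"] by (simp add: power2_eq_square algebra_simps)
    also have "\<dots> \<le> (1 + 1 / \<epsilon>\<^sup>2) * D" using assms by (simp add: D_def field_simps)
    finally have "2 * \<bar>I\<bar> \<le> (1 + 1 / \<epsilon>\<^sup>2) * D" using I by simp
    then have "2 * \<bar>I\<bar> / D \<le> 1 + 1 / \<epsilon>\<^sup>2" using D by (simp add: pos_divide_le_eq)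
    then have 1: "\<bar>logp1 \<epsilon> a e z\<bar> \<le> K" using KK D by (simp add: logp1_def abs_mult flip: r_def D_def I_def)
    have "\<bar>2 / D - 4 * I\<^sup>2 / D\<^sup>2\<bar> \<le> 2 / D + 4 * I\<^sup>2 / D\<^sup>2"
      using D by (intro abs_leI) auto
    also have "4 * I\<^sup>2 / D\<^sup>2 \<le> 4 * D / D\<^sup>2" using I2 by (intro divide_right_mono) auto
    also have "2 / D + 4 * D / D\<^sup>2 = 6 / D" using D by (simp add: power2_eq_square)
    also have "6 / D \<le> 6 * c / (1 + cmod z)\<^sup>2"
    proof -
      have "(1 + cmod z)\<^sup>2 \<le> c * D" using reg_norm_ge[OF assms, of z a] by (simp add: c_def D_def r_def)
      moreover have "0 < (1 + cmod z)\<^sup>2" by (intro zero_less_power add_pos_nonneg) auto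
      ultimately show ?thesis using D by (simp add: divide_le_eq le_divide_eq)
    qed
    also have "\<dots> \<le> K / (1 + cmod z)\<^sup>2" using KK by (intro divide_right_mono) auto
    finally show ?thesis using 1 by (simp add: logp2_def flip: r_def D_def I_def)
  qed
  ultimately show ?thesis using C2_axes_logp[OF assms] unfolding tempered_def by blast
qed

text \<open>The squares of the two inner products add up to \<open>|z - a|\<^sup>2\<close>, which
  leaves only the \<open>\<epsilon>\<^sup>2\<close> term. The result is \<open>fs\<close> recentred
  at \<open>a\<close> and rescaled by \<open>\<epsilon>\<close>: an approximate identity of mass
  \<open>4 * pi\<close>.\<close>

lemma laplacian_logp:
  assumes "0 < \<epsilon>"
  shows "logp2 \<epsilon> a 1 z + logp2 \<epsilon> a \<i> z = 4 * \<epsilon>\<^sup>2 / (\<epsilon>\<^sup>2 + (cmod (z - a))\<^sup>2)\<^sup>2"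
proof -
  define D where "D = \<epsilon>\<^sup>2 + (cmod (z - a))\<^sup>2"
  have D: "0 < D" unfolding D_def by (rule reg_norm_pos) fact
  have "((z - a) \<bullet> 1)\<^sup>2 + ((z - a) \<bullet> \<i>)\<^sup>2 = D - \<epsilon>\<^sup>2"
    by (simp add: D_def cmod_power2 inner_complex_def)
  then have "4 * ((z - a) \<bullet> 1)\<^sup>2 / D\<^sup>2 + 4 * ((z - a) \<bullet> \<i>)\<^sup>2 / D\<^sup>2 = 4 * (D - \<epsilon>\<^sup>2) / D\<^sup>2"
    by (simp only: add_divide_distrib[symmetric] distrib_left[symmetric])
  moreover have "4 / D - 4 * (D - \<epsilon>\<^sup>2) / D\<^sup>2 = 4 * \<epsilon>\<^sup>2 / D\<^sup>2"
    using D by (simp add: field_simps power2_eq_square)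
  ultimately show ?thesis unfolding logp2_def D_def[symmetric] by simp
qed

lemma laplacian_logp_one: "logp2 1 a 1 z + logp2 1 a \<i> z = fs (z - a)"
  using laplacian_logp[of 1 a z] by (simp add: fs_def)

lemma integral_fs_scaled:
  fixes g :: "complex \<Rightarrow> real"
  assumes "0 < \<epsilon>" and [measurable]: "g \<in> borel_measurable borel"
  shows "(\<integral>z. g z * (4 * \<epsilon>\<^sup>2 / (\<epsilon>\<^sup>2 + (cmod (z - a))\<^sup>2)\<^sup>2) \<partial>lborel) = (\<integral>z. g (a + \<epsilon> *\<^sub>R z) * fs z \<partial>lborel)"
proof -
  let ?h = "\<lambda>z. g z * (4 * \<epsilon>\<^sup>2 / (\<epsilon>\<^sup>2 + (cmod (z - a))\<^sup>2)\<^sup>2)"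
  have "(\<integral>z. ?h z \<partial>lborel) = (\<integral>z. \<epsilon>\<^sup>2 * ?h (a + \<epsilon> *\<^sub>R z) \<partial>lborel)"
    using assms(1)
    by (subst lborel_affine[of \<epsilon> a], simp, subst integral_density) (auto simp: integral_distr)
  also have "\<dots> = (\<integral>z. g (a + \<epsilon> *\<^sub>R z) * fs z \<partial>lborel)"
  proof (rule Bochner_Integration.integral_cong[OF refl])
    fix z
    have e: "\<epsilon>\<^sup>2 + (\<epsilon> * cmod z)\<^sup>2 = \<epsilon>\<^sup>2 * (1 + (cmod z)\<^sup>2)" by (simp add: algebra_simps power_mult_distrib)
    have "\<epsilon>\<^sup>2 * (4 * \<epsilon>\<^sup>2 / (\<epsilon>\<^sup>2 * (1 + (cmod z)\<^sup>2))\<^sup>2) = fs z"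
      using assms(1) by (simp add: fs_def power_mult_distrib) (simp add: power4_eq_xxxx power2_eq_square)
    moreover have "?h (a + \<epsilon> *\<^sub>R z) = g (a + \<epsilon> *\<^sub>R z) * (4 * \<epsilon>\<^sup>2 / (\<epsilon>\<^sup>2 * (1 + (cmod z)\<^sup>2))\<^sup>2)"
      using assms(1) e by simp
    ultimately show "\<epsilon>\<^sup>2 * ?h (a + \<epsilon> *\<^sub>R z) = g (a + \<epsilon> *\<^sub>R z) * fs z"
      by (metis mult.left_commute)
  qed
  finally show ?thesis .
qed

lemma decaying_bounds:
  assumes "decaying g g1 g2"
  shows "\<exists>K. \<forall>z. \<bar>g z\<bar> \<le> K \<and> \<bar>g2 1 z + g2 \<i> z\<bar> \<le> K / (1 + cmod z) ^ 3"
proof -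
  obtain K where K: "\<And>z. \<bar>g z\<bar> \<le> K / (1 + cmod z)"
    "\<And>z e. e \<in> {1, \<i>} \<Longrightarrow> \<bar>g2 e z\<bar> \<le> K / (1 + cmod z) ^ 3"
    using assms unfolding decaying_def by blast
  have K0: "0 \<le> K" using K(1)[of 0] by auto
  show ?thesis
  proof (intro exI[of _ "2 * K"] allI conjI)
    fix z
    have "K / (1 + cmod z) \<le> K" using K0 by (simp add: divide_le_eq add_pos_nonneg mult_left_mono[of 1 "1 + cmod z" K, simplified])
    then show "\<bar>g z\<bar> \<le> 2 * K" using K(1)[of z] K0 by linarith
    show "\<bar>g2 1 z + g2 \<i> z\<bar> \<le> 2 * K / (1 + cmod z) ^ 3"
      using K(2)[of 1 z] K(2)[of \<i> z] by (simp add: abs_le_iff)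
  qed
qed

lemma borel_measurable_decaying:
  assumes "decaying g g1 g2"
  shows "g \<in> borel_measurable borel" "(\<lambda>z. g2 1 z + g2 \<i> z) \<in> borel_measurable borel"
  using assms unfolding decaying_def C2_axes_def
  by (auto intro!: borel_measurable_continuous_onI continuous_on_add)

lemma integrable_ln_laplacian:
  assumes "decaying g g1 g2"
  shows "integrable lborel (\<lambda>z. ln ((cmod (z - a))\<^sup>2) * (g2 1 z + g2 \<i> z))"
proof -
  obtain K where "\<And>z. \<bar>g z\<bar> \<le> K" and "\<And>z. \<bar>g2 1 z + g2 \<i> z\<bar> \<le> K / (1 + cmod z) ^ 3"
    using decaying_bounds[OF assms] by metis
  with borel_measurable_decaying[OF assms] show ?thesis by (intro integrable_ln_shift) auto
qed

text \<open>This is the distributional identity that \<open>ln |z - a|\<^sup>2\<close> has Laplacian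
  \<open>4 * pi\<close> times the point mass at \<open>a\<close>. Green's identity holds for each
  regularisation, and both sides converge by dominated convergence.\<close>

lemma integral_ln_laplacian:
  assumes g: "decaying g g1 g2"
  shows "(\<integral>z. ln ((cmod (z - a))\<^sup>2) * (g2 1 z + g2 \<i> z) \<partial>lborel) = 4 * pi * g a"
proof -
  let ?lap = "\<lambda>z. g2 1 z + g2 \<i> z"
  define \<epsilon> where "\<epsilon> = (\<lambda>n. 1 / real (Suc n))"
  have \<epsilon>: "0 < \<epsilon> n" "\<epsilon> n \<le> 1" for n by (auto simp: \<epsilon>_def)
  have \<epsilon>lim: "\<epsilon> \<longlonglongrightarrow> 0" unfolding \<epsilon>_def using LIMSEQ_inverse_real_of_nat by (simp add: inverse_eq_divide)
  have cont: "continuous_on UNIV g" using g unfolding decaying_def C2_axes_def by blast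
  note [measurable] = borel_measurable_decaying[OF g]
  obtain K where K: "\<And>z. \<bar>g z\<bar> \<le> K" and "\<And>z. \<bar>g2 1 z + g2 \<i> z\<bar> \<le> K / (1 + cmod z) ^ 3"
    using decaying_bounds[OF g] by metis
  have eq: "(\<integral>z. logp (\<epsilon> n) a z * ?lap z \<partial>lborel) = (\<integral>z. g (a + \<epsilon> n *\<^sub>R z) * fs z \<partial>lborel)" for n
    using green_identity[OF g tempered_logp[OF \<epsilon>(1)], of n a] integral_fs_scaled[OF \<epsilon>(1), of g n a]
    unfolding laplacian_logp[OF \<epsilon>(1)] by simp
  have "(\<lambda>n. \<integral>z. logp (\<epsilon> n) a z * ?lap z \<partial>lborel) \<longlonglongrightarrow> (\<integral>z. ln ((cmod (z - a))\<^sup>2) * ?lap z \<partial>lborel)"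
  proof (rule integral_dominated_convergence)
    show "(\<lambda>z. ln ((cmod (z - a))\<^sup>2) * ?lap z) \<in> borel_measurable lborel" by measurable
    show "(\<lambda>z. logp (\<epsilon> n) a z * ?lap z) \<in> borel_measurable lborel" for n unfolding logp_def by measurable
    \<comment> \<open>For \<open>\<epsilon> n \<le> 1\<close> the regularised logarithm lies between
      \<open>ln |z - a|\<^sup>2\<close> and \<open>logp 1 a z\<close>, so the sum of their absolute
      values dominates.\<close>
    show "integrable lborel (\<lambda>z. \<bar>ln ((cmod (z - a))\<^sup>2) * ?lap z\<bar> + \<bar>logp 1 a z * ?lap z\<bar>)"
      using integrable_ln_laplacian[OF g] integrable_tempered_laplacian[OF g tempered_logp[of 1 a]] by simp
    show "AE z in lborel. (\<lambda>n. logp (\<epsilon> n) a z * ?lap z) \<longlonglongrightarrow> ln ((cmod (z - a))\<^sup>2) * ?lap z"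
      using AE_lborel_singleton[of a]
    proof eventually_elim
      case (elim z)
      have "(\<lambda>n. logp (\<epsilon> n) a z) \<longlonglongrightarrow> ln (0\<^sup>2 + (cmod (z - a))\<^sup>2)"
        unfolding logp_def using elim by (intro tendsto_intros \<epsilon>lim) auto
      then show ?case by (intro tendsto_intros) simp
    qed
    show "AE z in lborel. norm (logp (\<epsilon> n) a z * ?lap z) \<le> \<bar>ln ((cmod (z - a))\<^sup>2) * ?lap z\<bar> + \<bar>logp 1 a z * ?lap z\<bar>" for n
      using AE_lborel_singleton[of a]
    proof eventually_elim
      case (elim z)
      have r: "0 < (cmod (z - a))\<^sup>2" using elim by simp
      have "(\<epsilon> n)\<^sup>2 \<le> 1" using \<epsilon>[of n] by (simp add: power_le_one)
      then have "ln ((cmod (z - a))\<^sup>2) \<le> logp (\<epsilon> n) a z" "logp (\<epsilon> n) a z \<le> logp 1 a z"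
        unfolding logp_def using r reg_norm_pos[OF \<epsilon>(1), of n "z - a"] by (auto simp: add_pos_pos)
      then have "\<bar>logp (\<epsilon> n) a z\<bar> \<le> \<bar>ln ((cmod (z - a))\<^sup>2)\<bar> + \<bar>logp 1 a z\<bar>" by linarith
      then have "\<bar>logp (\<epsilon> n) a z\<bar> * \<bar>?lap z\<bar> \<le> (\<bar>ln ((cmod (z - a))\<^sup>2)\<bar> + \<bar>logp 1 a z\<bar>) * \<bar>?lap z\<bar>"
        by (rule mult_right_mono) simp
      then show ?case by (simp add: abs_mult distrib_right)
    qed
  qed
  moreover have "(\<lambda>n. \<integral>z. g (a + \<epsilon> n *\<^sub>R z) * fs z \<partial>lborel) \<longlonglongrightarrow> (\<integral>z. g a * fs z \<partial>lborel)"
  proof (rule integral_dominated_convergence)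
    show "integrable lborel (\<lambda>z. K * fs z)" using integrable_fs by simp
    show "AE z in lborel. (\<lambda>n. g (a + \<epsilon> n *\<^sub>R z) * fs z) \<longlonglongrightarrow> g a * fs z"
    proof (rule AE_I2)
      fix z
      have "(\<lambda>n. a + \<epsilon> n *\<^sub>R z) \<longlonglongrightarrow> a + 0 *\<^sub>R z" by (intro tendsto_intros \<epsilon>lim)
      then have "(\<lambda>n. g (a + \<epsilon> n *\<^sub>R z)) \<longlonglongrightarrow> g a"
        using cont by (intro isCont_tendsto_compose[of a g]) (auto simp: continuous_on_eq_continuous_at)
      then show "(\<lambda>n. g (a + \<epsilon> n *\<^sub>R z) * fs z) \<longlonglongrightarrow> g a * fs z" by (intro tendsto_intros)
    qed
    show "AE z in lborel. norm (g (a + \<epsilon> n *\<^sub>R z) * fs z) \<le> K * fs z" for n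
      using K by (auto simp: abs_mult intro!: mult_right_mono)
  qed measurable
  ultimately show ?thesis
    unfolding eq using LIMSEQ_unique integral_fs by fastforce
qed

section \<open>The spherical mean of a logarithmic potential\<close>

text \<open>Here \<open>x\<close> stands for \<open>1 + |z|\<close>, the \<open>D\<close>s for the
  regularised squared distances and the \<open>I\<close>s for the inner products with an axis. Since
  the two centres are a bounded distance apart, subtracting gains a power of \<open>1 / x\<close>
  over the size of each derivative.\<close>

lemma log_difference_bounds:
  fixes x c D0 D1 I0 I1 :: real
  assumes "1 \<le> x" "0 \<le> c" "0 < D0" "0 < D1" and D: "1 / D0 \<le> c / x\<^sup>2" "1 / D1 \<le> c / x\<^sup>2"
    and dD: "\<bar>D0 - D1\<bar> \<le> c * x" and I: "\<bar>I0\<bar> \<le> x" "\<bar>I1\<bar> \<le> c * x" "\<bar>I0 - I1\<bar> \<le> c"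
  shows "\<bar>ln D0 - ln D1\<bar> \<le> c\<^sup>2 / x"
    and "\<bar>2 * I0 / D0 - 2 * I1 / D1\<bar> \<le> (2 * c^3 + 2 * c\<^sup>2) / x\<^sup>2"
    and "\<bar>(2 / D0 - 4 * I0\<^sup>2 / D0\<^sup>2) - (2 / D1 - 4 * I1\<^sup>2 / D1\<^sup>2)\<bar> \<le> (2 * c^3 + 2 * (2 * c^3 + 2 * c\<^sup>2) * (c + c\<^sup>2)) / x^3"
proof -
  have x: "0 < x" using assms by simp
  have lnle: "ln u - ln v \<le> \<bar>u - v\<bar> * (1 / v)" if "0 < u" "0 < v" for u v :: real
  proof -
    have "(u - v) / v \<le> \<bar>u - v\<bar> / v" using that by (intro divide_right_mono) auto
    then show ?thesis using ln_diff_le[OF that] by simp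
  qed
  have "c * x * (c / x\<^sup>2) = c\<^sup>2 / x" using x by (simp add: power2_eq_square)
  moreover have "\<bar>D0 - D1\<bar> * (1 / D1) \<le> c * x * (c / x\<^sup>2)" "\<bar>D1 - D0\<bar> * (1 / D0) \<le> c * x * (c / x\<^sup>2)"
    using dD D assms x by (auto intro!: mult_mono simp: abs_minus_commute simp del: times_divide_eq_right)
  ultimately show "\<bar>ln D0 - ln D1\<bar> \<le> c\<^sup>2 / x"
    using lnle[of D0 D1] lnle[of D1 D0] assms by (simp add: abs_le_iff)
  have inv: "\<bar>1 / D0 - 1 / D1\<bar> \<le> c^3 / x^3"
  proof -
    have "\<bar>1 / D0 - 1 / D1\<bar> = \<bar>D0 - D1\<bar> * ((1 / D0) * (1 / D1))"
      using assms by (simp add: abs_minus_commute diff_frac_eq abs_mult)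
    also have "\<dots> \<le> (c * x) * ((c / x\<^sup>2) * (c / x\<^sup>2))"
      using dD D assms x by (intro mult_mono) auto
    also have "\<dots> = c^3 / x^3" using x by (simp add: power2_eq_square power3_eq_cube)
    finally show ?thesis .
  qed
  have d1: "\<bar>I0 / D0 - I1 / D1\<bar> \<le> (c^3 + c\<^sup>2) / x\<^sup>2"
  proof -
    have "I0 / D0 - I1 / D1 = I0 * (1 / D0 - 1 / D1) + (I0 - I1) * (1 / D1)"
      by (simp add: algebra_simps diff_divide_distrib)
    also have "\<bar>\<dots>\<bar> \<le> \<bar>I0\<bar> * \<bar>1 / D0 - 1 / D1\<bar> + \<bar>I0 - I1\<bar> * \<bar>1 / D1\<bar>"
      by (metis abs_mult abs_triangle_ineq)
    also have "\<dots> \<le> x * (c^3 / x^3) + c * (c / x\<^sup>2)"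
      using I D inv assms by (intro add_mono mult_mono) auto
    also have "\<dots> = (c^3 + c\<^sup>2) / x\<^sup>2" using x by (simp add: field_simps power2_eq_square power3_eq_cube)
    finally show ?thesis .
  qed
  have "2 * I0 / D0 - 2 * I1 / D1 = 2 * (I0 / D0 - I1 / D1)" by simp
  then have "\<bar>2 * I0 / D0 - 2 * I1 / D1\<bar> = 2 * \<bar>I0 / D0 - I1 / D1\<bar>" by (simp only: abs_mult)
  also have "\<dots> \<le> 2 * ((c^3 + c\<^sup>2) / x\<^sup>2)" by (rule mult_left_mono[OF d1]) simp
  finally show "\<bar>2 * I0 / D0 - 2 * I1 / D1\<bar> \<le> (2 * c^3 + 2 * c\<^sup>2) / x\<^sup>2" by (simp add: distrib_left)
  have s: "\<bar>I0 / D0 + I1 / D1\<bar> \<le> (c + c\<^sup>2) / x"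
  proof -
    have "\<bar>I0 / D0 + I1 / D1\<bar> \<le> \<bar>I0\<bar> * (1 / D0) + \<bar>I1\<bar> * (1 / D1)"
      using abs_triangle_ineq[of "I0 / D0" "I1 / D1"] assms by simp
    also have "\<dots> \<le> x * (c / x\<^sup>2) + (c * x) * (c / x\<^sup>2)"
      using I D assms by (intro add_mono mult_mono) auto
    also have "\<dots> = (c + c\<^sup>2) / x" using x by (simp add: field_simps power2_eq_square)
    finally show ?thesis .
  qed
  \<comment> \<open>The difference of squares is factored: one factor is of order
    \<open>1 / x\<^sup>2\<close> by the previous estimate, the other of order
    \<open>1 / x\<close>.\<close>
  have "(2 / D0 - 4 * I0\<^sup>2 / D0\<^sup>2) - (2 / D1 - 4 * I1\<^sup>2 / D1\<^sup>2)
      = 2 * (1 / D0 - 1 / D1) - 4 * ((I0 / D0 - I1 / D1) * (I0 / D0 + I1 / D1))"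
    by (simp add: power2_eq_square algebra_simps)
  also have "\<bar>\<dots>\<bar> \<le> 2 * \<bar>1 / D0 - 1 / D1\<bar> + 4 * (\<bar>I0 / D0 - I1 / D1\<bar> * \<bar>I0 / D0 + I1 / D1\<bar>)"
  proof -
    have "\<bar>2 * A - 4 * B\<bar> \<le> 2 * \<bar>A\<bar> + 4 * \<bar>B\<bar>" for A B :: real by linarith
    from this[of "1 / D0 - 1 / D1" "(I0 / D0 - I1 / D1) * (I0 / D0 + I1 / D1)"]
    show ?thesis unfolding abs_mult[of "I0 / D0 - I1 / D1"] .
  qed
  also have "\<dots> \<le> 2 * (c^3 / x^3) + 4 * (((c^3 + c\<^sup>2) / x\<^sup>2) * ((c + c\<^sup>2) / x))"
    using inv d1 s assms by (intro add_mono mult_left_mono mult_mono) auto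
  also have "\<dots> = (2 * c^3 + 2 * (2 * c^3 + 2 * c\<^sup>2) * (c + c\<^sup>2)) / x^3"
    using x by (simp add: field_simps power2_eq_square power3_eq_cube)
  finally show "\<bar>(2 / D0 - 4 * I0\<^sup>2 / D0\<^sup>2) - (2 / D1 - 4 * I1\<^sup>2 / D1\<^sup>2)\<bar> \<le> (2 * c^3 + 2 * (2 * c^3 + 2 * c\<^sup>2) * (c + c\<^sup>2)) / x^3" .
qed

text \<open>Each potential alone is unbounded, but equal total masses make the difference an
  admissible test function; its Laplacian is \<open>fs z - fs (z - b)\<close>.\<close>

lemma decaying_logp_difference:
  "decaying (\<lambda>z. logp 1 0 z - logp 1 b z) (\<lambda>e z. logp1 1 0 e z - logp1 1 b e z) (\<lambda>e z. logp2 1 0 e z - logp2 1 b e z)"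
proof -
  define c where "c = 2 * (1 + cmod b)\<^sup>2"
  define K where "K = c\<^sup>2 + (2 * c^3 + 2 * c\<^sup>2) + (2 * c^3 + 2 * (2 * c^3 + 2 * c\<^sup>2) * (c + c\<^sup>2))"
  have c0: "0 \<le> c" by (simp add: c_def)
  have c1: "2 \<le> c" using power_mono[of 1 "1 + cmod b" 2] by (simp add: c_def)
  have KK: "c\<^sup>2 \<le> K" "2 * c^3 + 2 * c\<^sup>2 \<le> K" "2 * c^3 + 2 * (2 * c^3 + 2 * c\<^sup>2) * (c + c\<^sup>2) \<le> K"
    using c0 by (auto simp: K_def)
  have b: "\<bar>logp 1 0 z - logp 1 b z\<bar> \<le> K / (1 + cmod z) \<and> \<bar>logp1 1 0 e z - logp1 1 b e z\<bar> \<le> K / (1 + cmod z)\<^sup>2 \<and>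
     \<bar>logp2 1 0 e z - logp2 1 b e z\<bar> \<le> K / (1 + cmod z)^3" if e: "e \<in> {1, \<i>}" for z e
  proof -
    define x where "x = 1 + cmod z"
    define D0 where "D0 = 1 + (cmod z)\<^sup>2"
    define D1 where "D1 = 1 + (cmod (z - b))\<^sup>2"
    define I0 where "I0 = z \<bullet> e"
    define I1 where "I1 = (z - b) \<bullet> e"
    have x: "1 \<le> x" by (simp add: x_def)
    have D: "0 < D0" "0 < D1" by (simp_all add: D0_def D1_def)
    have "x\<^sup>2 \<le> 2 * D0" unfolding x_def D0_def by (rule one_plus_sq_le)
    also have "\<dots> \<le> c * D0" using c1 D by (intro mult_right_mono) auto
    finally have h0: "1 / D0 \<le> c / x\<^sup>2" using D x by (simp add: divide_simps mult.commute)
    have "x\<^sup>2 \<le> (1 + cmod b)\<^sup>2 * (1 + cmod (z - b))\<^sup>2"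
      unfolding x_def power_mult_distrib[symmetric] by (intro power_mono one_plus_norm_le) auto
    also have "\<dots> \<le> (1 + cmod b)\<^sup>2 * (2 * D1)" unfolding D1_def by (intro mult_left_mono one_plus_sq_le) auto
    also have "\<dots> = c * D1" by (simp add: c_def)
    finally have h1: "1 / D1 \<le> c / x\<^sup>2" using D x by (simp add: divide_simps mult.commute)
    have n1: "cmod (z - b) \<le> cmod z + cmod b" "cmod z \<le> cmod (z - b) + cmod b"
      using norm_triangle_ineq4[of z b] norm_triangle_ineq[of "z - b" b] by auto
    have cc: "c = 2 + 4 * cmod b + 2 * (cmod b * cmod b)" by (simp add: c_def power2_eq_square algebra_simps)
    have bz: "0 \<le> cmod b * cmod z" "0 \<le> cmod b * cmod b" "0 \<le> cmod b * cmod b * cmod z" by auto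
    have dD: "\<bar>D0 - D1\<bar> \<le> c * x"
    proof -
      have "D0 - D1 = (cmod z - cmod (z - b)) * (cmod z + cmod (z - b))"
        by (simp add: D0_def D1_def power2_eq_square algebra_simps)
      also have "\<bar>\<dots>\<bar> \<le> cmod b * (2 * cmod z + cmod b)"
        unfolding abs_mult using n1 by (intro mult_mono) auto
      also have "\<dots> \<le> c * x" unfolding cc x_def using bz by (simp add: algebra_simps)
      finally show ?thesis .
    qed
    have i0: "\<bar>I0\<bar> \<le> x" using abs_inner_axis_le[OF e, of z] by (simp add: I0_def x_def)
    have "c * x = 2 + cmod z * 2 + cmod b * 4 + 2 * (cmod b * cmod b) + 4 * (cmod b * cmod z) + 2 * (cmod b * cmod b * cmod z)"
      unfolding cc x_def by (simp add: algebra_simps)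
    then have i1: "\<bar>I1\<bar> \<le> c * x" using abs_inner_axis_le[OF e, of "z - b"] n1 bz norm_ge_zero[of b] norm_ge_zero[of z]
      unfolding I1_def by linarith
    have "I0 - I1 = b \<bullet> e" by (simp add: I0_def I1_def inner_diff_left)
    then have i2: "\<bar>I0 - I1\<bar> \<le> c" using abs_inner_axis_le[OF e, of b] bz(2) norm_ge_zero[of b] unfolding cc by linarith
    note bounds = log_difference_bounds[OF x c0 D h0 h1 dD i0 i1 i2]
    have "c\<^sup>2 / x \<le> K / x" "(2 * c^3 + 2 * c\<^sup>2) / x\<^sup>2 \<le> K / x\<^sup>2"
      "(2 * c^3 + 2 * (2 * c^3 + 2 * c\<^sup>2) * (c + c\<^sup>2)) / x^3 \<le> K / x^3"
      using KK x by (auto intro!: divide_right_mono)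
    with bounds show ?thesis
      unfolding logp_def logp1_def logp2_def
      by (simp flip: x_def D0_def D1_def I0_def I1_def)
  qed
  have C: "C2_axes (logp 1 0) (logp1 1 0) (logp2 1 0)" "C2_axes (logp 1 b) (logp1 1 b) (logp2 1 b)"
    by (auto intro: C2_axes_logp)
  have "C2_axes (\<lambda>z. logp 1 0 z - logp 1 b z) (\<lambda>e z. logp1 1 0 e z - logp1 1 b e z) (\<lambda>e z. logp2 1 0 e z - logp2 1 b e z)"
    using C unfolding C2_axes_def by (auto intro!: continuous_intros DERIV_diff)
  with b show ?thesis unfolding decaying_def by blast
qed

text \<open>The point-mass formula at \<open>a\<close> is applied to the difference of the
  potentials centred at 0 and \<open>a\<close>. Of the two integrals that appear, the one with
  \<open>fs (z - a)\<close> is a translate of \<open>integral_ln_norm_fs\<close> and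
  vanishes.\<close>

lemma integral_ln_fs: "(\<integral>z. ln ((cmod (z - a))\<^sup>2) * fs z \<partial>lborel) = 4 * pi * ln (1 + (cmod a)\<^sup>2)"
proof -
  have "4 * pi * (logp 1 0 a - logp 1 a a)
      = (\<integral>z. ln ((cmod (z - a))\<^sup>2) * (fs z - fs (z - a)) \<partial>lborel)"
    unfolding integral_ln_laplacian[OF decaying_logp_difference, symmetric]
    using laplacian_logp_one[of 0] laplacian_logp_one[of a]
    by (intro Bochner_Integration.integral_cong) (auto simp: algebra_simps)
  also have "\<dots> = (\<integral>z. ln ((cmod (z - a))\<^sup>2) * fs z \<partial>lborel) - (\<integral>z. ln ((cmod (z - a))\<^sup>2) * fs (z - a) \<partial>lborel)"
    using integrable_ln_fs[of a] integrable_translate[OF integrable_ln_fs[of 0], of a]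
    by (simp add: right_diff_distrib)
  also have "(\<integral>z. ln ((cmod (z - a))\<^sup>2) * fs (z - a) \<partial>lborel) = 0"
    using integral_translate[of "\<lambda>z. ln ((cmod z)\<^sup>2) * fs z" a] integral_ln_norm_fs by simp
  finally show ?thesis by (simp add: logp_def)
qed

section \<open>Functions of class C2 on the sphere\<close>

text \<open>\<open>C2_plane\<close> speaks of axis derivatives only, while the chain rule under
  inversion needs total derivatives; continuity of one partial bridges the gap.\<close>

lemma has_derivative_of_partials:
  fixes h hx hy :: "complex \<Rightarrow> real"
  assumes hx: "\<And>z. ((\<lambda>t::real. h (z + complex_of_real t)) has_real_derivative hx z) (at 0)"
    and hy: "\<And>z. ((\<lambda>t::real. h (z + \<i> * complex_of_real t)) has_real_derivative hy z) (at 0)"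
    and c: "continuous_on UNIV hy"
  shows "(h has_derivative (\<lambda>v. hx z * Re v + hy z * Im v)) (at z)"
proof -
  define f where "f = (\<lambda>x y. h (Complex x y))"
  have fx: "((\<lambda>x. f x y) has_derivative (\<lambda>t. hx (Complex x y) * t)) (at x)" for x y
  proof -
    have "((\<lambda>t. f (t + x) y) has_real_derivative hx (Complex x y)) (at 0)"
      using hx[of "Complex x y"] by (simp add: f_def Complex_eq algebra_simps)
    then have "((\<lambda>x. f x y) has_real_derivative hx (Complex x y)) (at x)"
      using DERIV_shift[of "\<lambda>x. f x y" _ 0 x] by simp
    then show ?thesis by (simp add: has_field_derivative_def)
  qed
  have fy: "((\<lambda>y. f x y) has_derivative blinfun_apply (blinfun_mult_right (hy (Complex x y)))) (at y)" for x y
  proof -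
    have "((\<lambda>t. f x (t + y)) has_real_derivative hy (Complex x y)) (at 0)"
      using hy[of "Complex x y"] by (simp add: f_def Complex_eq algebra_simps)
    then have "((\<lambda>y. f x y) has_real_derivative hy (Complex x y)) (at y)"
      using DERIV_shift[of "\<lambda>y. f x y" _ 0 y] by simp
    then show ?thesis by (simp add: has_field_derivative_def)
  qed
  have "continuous_on UNIV (\<lambda>p. blinfun_mult_right (hy (Complex (fst p) (snd p))))"
    unfolding Complex_eq
    by (intro bounded_linear.continuous_on[OF bounded_linear_blinfun_mult_right]
        continuous_on_compose2[OF c] continuous_intros) auto
  then have "continuous (at (Re z, Im z) within UNIV \<times> UNIV) (\<lambda>(x, y). blinfun_mult_right (hy (Complex x y)))"
    by (simp add: continuous_on_eq_continuous_at split_beta')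
  from has_derivative_partialsI[of f "Im z" _ "Re z" UNIV UNIV, OF _ _ this] fx fy
  have D: "((\<lambda>p. f (fst p) (snd p)) has_derivative (\<lambda>p. hx z * fst p + hy z * snd p)) (at (Re z, Im z))"
    by (fastforce simp: split_beta')
  have E: "((\<lambda>z. (Re z, Im z)) has_derivative (\<lambda>v. (Re v, Im v))) (at z)"
    by (auto intro!: derivative_eq_intros)
  show ?thesis using has_derivative_compose[OF E D] by (simp add: f_def)
qed

lemma C2_plane_partials:
  assumes "C2_plane h" "k \<in> {h, dx h, dy h}"
  shows "((\<lambda>t::real. k (z + complex_of_real t)) has_real_derivative dx k z) (at 0)"
    "((\<lambda>t::real. k (z + \<i> * complex_of_real t)) has_real_derivative dy k z) (at 0)"
    "continuous_on UNIV k" "continuous_on UNIV (dx k)" "continuous_on UNIV (dy k)"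
  using assms unfolding C2_plane_def by blast+

lemma C2_plane_has_derivative:
  assumes "C2_plane h" "k \<in> {h, dx h, dy h}"
  shows "(k has_derivative (\<lambda>v. dx k z * Re v + dy k z * Im v)) (at z)"
  by (intro has_derivative_of_partials C2_plane_partials[OF assms])

lemma has_derivative_along_curve:
  fixes u :: "real \<Rightarrow> complex"
  assumes "(k has_derivative (\<lambda>v. a * Re v + b * Im v)) (at (u 0))" "(u has_vector_derivative w) (at 0)"
  shows "((\<lambda>t. k (u t)) has_real_derivative (a * Re w + b * Im w)) (at 0)"
proof -
  have "(\<lambda>t. a * Re (t *\<^sub>R w) + b * Im (t *\<^sub>R w)) = (*) (a * Re w + b * Im w)"
    by (auto simp: fun_eq_iff algebra_simps)
  then show ?thesis
    using has_derivative_compose[OF assms(2)[unfolded has_vector_derivative_def] assms(1)]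
    by (simp add: has_field_derivative_def)
qed

text \<open>First and second derivative in direction \<open>e\<close> of \<open>z \<mapsto> h (1 / z)\<close>.\<close>

definition inv1 :: "(complex \<Rightarrow> real) \<Rightarrow> complex \<Rightarrow> complex \<Rightarrow> real" where
  "inv1 h e z = dx h (1 / z) * Re (- e / z\<^sup>2) + dy h (1 / z) * Im (- e / z\<^sup>2)"

definition inv2 :: "(complex \<Rightarrow> real) \<Rightarrow> complex \<Rightarrow> complex \<Rightarrow> real" where
  "inv2 h e z =
     (dx (dx h) (1 / z) * Re (- e / z\<^sup>2) + dy (dx h) (1 / z) * Im (- e / z\<^sup>2)) * Re (- e / z\<^sup>2)
   + (dx (dy h) (1 / z) * Re (- e / z\<^sup>2) + dy (dy h) (1 / z) * Im (- e / z\<^sup>2)) * Im (- e / z\<^sup>2)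
   + dx h (1 / z) * Re (2 * e\<^sup>2 / z ^ 3) + dy h (1 / z) * Im (2 * e\<^sup>2 / z ^ 3)"

section \<open>Inversion and the chart at infinity\<close>

lemma has_vector_derivative_recip:
  fixes z e :: complex
  assumes "z \<noteq> 0"
  shows "((\<lambda>t. 1 / (z + complex_of_real t * e)) has_vector_derivative - e / z\<^sup>2) (at 0)"
    and "((\<lambda>t. - e / (z + complex_of_real t * e)\<^sup>2) has_vector_derivative 2 * e\<^sup>2 / z ^ 3) (at 0)"
proof -
  have l: "((\<lambda>t. z + complex_of_real t * e) has_vector_derivative e) (at 0)"
    by (auto intro!: derivative_eq_intros)
  have "((\<lambda>w. 1 / w) has_field_derivative - 1 / z\<^sup>2) (at (z + complex_of_real 0 * e))"
    using assms by (auto intro!: derivative_eq_intros simp: power2_eq_square)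
  from field_vector_diff_chain_at[OF l this]
  show "((\<lambda>t. 1 / (z + complex_of_real t * e)) has_vector_derivative - e / z\<^sup>2) (at 0)"
    by (simp add: o_def)
  have "((\<lambda>w. - e / w\<^sup>2) has_field_derivative 2 * e / z ^ 3) (at (z + complex_of_real 0 * e))"
    using assms by (auto intro!: derivative_eq_intros simp: power2_eq_square power3_eq_cube field_simps)
  from field_vector_diff_chain_at[OF l this]
  show "((\<lambda>t. - e / (z + complex_of_real t * e)\<^sup>2) has_vector_derivative 2 * e\<^sup>2 / z ^ 3) (at 0)"
    by (simp add: o_def power2_eq_square mult_ac)
qed

lemma has_derivative_inv1:
  assumes h: "C2_plane h" and z: "z \<noteq> 0"
  shows "((\<lambda>t. h (1 / (z + complex_of_real t * e))) has_real_derivative inv1 h e z) (at 0)"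
    and "((\<lambda>t. inv1 h e (z + complex_of_real t * e)) has_real_derivative inv2 h e z) (at 0)"
proof -
  let ?u = "\<lambda>t. 1 / (z + complex_of_real t * e)"
  have c: "((\<lambda>t. k (?u t)) has_real_derivative (dx k (1 / z) * Re (- e / z\<^sup>2) + dy k (1 / z) * Im (- e / z\<^sup>2))) (at 0)"
    if "k \<in> {h, dx h, dy h}" for k
    using has_vector_derivative_recip(1)[OF z] C2_plane_has_derivative[OF h that]
    by (intro has_derivative_along_curve) auto
  show "((\<lambda>t. h (?u t)) has_real_derivative inv1 h e z) (at 0)"
    using c[of h] by (simp add: inv1_def)
  have re: "((\<lambda>t. Re (- e / (z + complex_of_real t * e)\<^sup>2)) has_real_derivative Re (2 * e\<^sup>2 / z ^ 3)) (at 0)"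
    and im: "((\<lambda>t. Im (- e / (z + complex_of_real t * e)\<^sup>2)) has_real_derivative Im (2 * e\<^sup>2 / z ^ 3)) (at 0)"
    using has_vector_derivative_recip(2)[OF z, of e]
    by (auto simp: has_vector_derivative_complex_iff)
  have c1: "((\<lambda>t. dx h (?u t)) has_real_derivative (dx (dx h) (1 / z) * Re (- e / z\<^sup>2) + dy (dx h) (1 / z) * Im (- e / z\<^sup>2))) (at 0)"
    and c2: "((\<lambda>t. dy h (?u t)) has_real_derivative (dx (dy h) (1 / z) * Re (- e / z\<^sup>2) + dy (dy h) (1 / z) * Im (- e / z\<^sup>2))) (at 0)"
    using c[of "dx h"] c[of "dy h"] by simp_all
  have s0: "z + complex_of_real 0 * e = z" by simp
  show "((\<lambda>t. inv1 h e (z + complex_of_real t * e)) has_real_derivative inv2 h e z) (at 0)"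
    unfolding inv1_def
    by (rule DERIV_cong, rule DERIV_add[OF DERIV_mult[OF c1 re] DERIV_mult[OF c2 im]])
       (simp add: inv2_def s0 algebra_simps)
qed

text \<open>Inversion is holomorphic, so the Laplacian only picks up the squared modulus of its
  derivative: the first-order terms cancel because the squares of 1 and \<open>\<i>\<close> sum to
  0, and the mixed second derivatives occur with opposite signs in the two directions.\<close>

lemma laplacian_inversion:
  assumes "z \<noteq> 0"
  shows "inv2 h 1 z + inv2 h \<i> z = lap_plane h (1 / z) / (cmod z) ^ 4"
proof -
  define w where "w = - 1 / z\<^sup>2"
  have w: "- \<i> / z\<^sup>2 = \<i> * w" "- 1 / z\<^sup>2 = w" by (auto simp: w_def)
  have "(Re w)\<^sup>2 + (Im w)\<^sup>2 = 1 / (cmod z) ^ 4"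
  proof -
    have "(cmod w)\<^sup>2 = 1 / (cmod z) ^ 4"
      by (simp add: w_def norm_divide norm_power power_divide flip: power_mult)
    then show ?thesis by (simp add: cmod_power2)
  qed
  moreover have "inv2 h 1 z + inv2 h \<i> z = lap_plane h (1 / z) * ((Re w)\<^sup>2 + (Im w)\<^sup>2)"
    unfolding inv2_def w lap_plane_def
    by (simp add: power2_eq_square algebra_simps)
  ultimately show ?thesis by simp
qed

lemma chart0_eq_chart1: "z \<noteq> 0 \<Longrightarrow> chart0 f z = chart1 f (1 / z)"
  by (simp add: chart0_def chart1_def)

definition axis1 :: "(complex \<Rightarrow> real) \<Rightarrow> complex \<Rightarrow> complex \<Rightarrow> real" where
  "axis1 g e = (if e = 1 then dx g else dy g)"

definition axis2 :: "(complex \<Rightarrow> real) \<Rightarrow> complex \<Rightarrow> complex \<Rightarrow> real" where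
  "axis2 g e = (if e = 1 then dx (dx g) else dy (dy g))"

lemma axis2_laplacian: "axis2 g 1 z + axis2 g \<i> z = lap_plane g z"
  by (simp add: axis2_def lap_plane_def)

lemma C2_plane_axes:
  assumes "C2_plane g" shows "C2_axes g (axis1 g) (axis2 g)"
  using assms unfolding C2_plane_def C2_axes_def axis1_def axis2_def
  by (simp add: mult.commute[of _ \<i>])

text \<open>Along a line through \<open>z\<close> the function \<open>chart0 f\<close> agrees near
  \<open>z\<close> with \<open>chart1 f\<close> after inversion, so uniqueness of derivatives
  applies twice. This turns continuity at the point at infinity into decay in the plane.\<close>

lemma axis_eq_inv:
  assumes f: "C2_sphere f" and z: "z \<noteq> 0" and e: "e \<in> {1, \<i>}"
  shows "axis1 (chart0 f) e z = inv1 (chart1 f) e z" "axis2 (chart0 f) e z = inv2 (chart1 f) e z"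
proof -
  have h: "C2_plane (chart1 f)" and g: "C2_axes (chart0 f) (axis1 (chart0 f)) (axis2 (chart0 f))"
    using f C2_plane_axes by (auto simp: C2_sphere_def)
  have ev: "\<forall>\<^sub>F t in nhds 0. w + complex_of_real t * e \<noteq> 0" if "w \<noteq> 0" for w
  proof (rule tendsto_imp_eventually_ne)
    have "isCont (\<lambda>t. w + complex_of_real t * e) 0" by (intro continuous_intros)
    then show "((\<lambda>t. w + complex_of_real t * e) \<longlongrightarrow> w) (nhds 0)"
      using tendsto_at_iff_tendsto_nhds[of "\<lambda>t. w + complex_of_real t * e" 0] by (simp add: isCont_def)
  qed fact
  have 1: "axis1 (chart0 f) e z = inv1 (chart1 f) e z" if "z \<noteq> 0" for z
  proof (rule DERIV_unique)
    show "((\<lambda>t. chart0 f (z + complex_of_real t * e)) has_real_derivative axis1 (chart0 f) e z) (at 0)"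
      using g e unfolding C2_axes_def by blast
    have "\<forall>\<^sub>F t in nhds 0. chart0 f (z + complex_of_real t * e) = chart1 f (1 / (z + complex_of_real t * e))"
      using ev[OF that] by eventually_elim (rule chart0_eq_chart1)
    then show "((\<lambda>t. chart0 f (z + complex_of_real t * e)) has_real_derivative inv1 (chart1 f) e z) (at 0)"
      using has_derivative_inv1(1)[OF h that, of e] by (subst DERIV_cong_ev) auto
  qed
  show "axis1 (chart0 f) e z = inv1 (chart1 f) e z" by (rule 1[OF z])
  show "axis2 (chart0 f) e z = inv2 (chart1 f) e z"
  proof (rule DERIV_unique)
    show "((\<lambda>t. axis1 (chart0 f) e (z + complex_of_real t * e)) has_real_derivative axis2 (chart0 f) e z) (at 0)"
      using g e unfolding C2_axes_def by blast
    have "\<forall>\<^sub>F t in nhds 0. axis1 (chart0 f) e (z + complex_of_real t * e) = inv1 (chart1 f) e (z + complex_of_real t * e)"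
      using ev[OF z] by eventually_elim (rule 1)
    then show "((\<lambda>t. axis1 (chart0 f) e (z + complex_of_real t * e)) has_real_derivative inv2 (chart1 f) e z) (at 0)"
      using has_derivative_inv1(2)[OF h z, of e] by (subst DERIV_cong_ev) auto
  qed
qed

lemma finite_continuous_bounded_on_cball:
  fixes S :: "(complex \<Rightarrow> real) set"
  assumes "finite S" "\<And>k. k \<in> S \<Longrightarrow> continuous_on UNIV k"
  shows "\<exists>M\<ge>0. \<forall>k\<in>S. \<forall>u\<in>cball 0 1. \<bar>k u\<bar> \<le> M"
  using assms
proof (induction S rule: finite_induct)
  case (insert k S)
  then obtain M where M: "M \<ge> 0" "\<forall>k\<in>S. \<forall>u\<in>cball 0 1. \<bar>k u\<bar> \<le> M" by blast
  have "continuous_on (cball 0 1) k" using insert.prems[of k] by (auto intro: continuous_on_subset)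
  then have "bounded (k ` cball 0 1)" by (intro compact_imp_bounded compact_continuous_image) auto
  then obtain N where "\<forall>u\<in>cball 0 1. \<bar>k u\<bar> \<le> N" by (auto simp: bounded_iff)
  with M show ?case by (intro exI[of _ "max M N"]) force
qed auto

text \<open>The closed unit discs of the two charts cover the sphere, so bounding this finite list
  there bounds everything. The mixed derivatives of \<open>chart1 f\<close> are included because
  they enter \<open>inv2\<close>.\<close>

definition chart_functions :: "(cp1 \<Rightarrow> real) \<Rightarrow> (complex \<Rightarrow> real) set" where
  "chart_functions f = {\<lambda>z. chart0 f z - f None, dx (chart0 f), dy (chart0 f), dx (dx (chart0 f)), dy (dy (chart0 f)),
     dx (chart1 f), dy (chart1 f), dx (dx (chart1 f)), dy (dx (chart1 f)), dx (dy (chart1 f)), dy (dy (chart1 f))}"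

lemma C2_sphere_chart_bounds:
  assumes f: "C2_sphere f"
  shows "\<exists>M\<ge>0. \<forall>k\<in>chart_functions f. \<forall>u\<in>cball 0 1. \<bar>k u\<bar> \<le> M"
proof (rule finite_continuous_bounded_on_cball)
  show "continuous_on UNIV k" if "k \<in> chart_functions f" for k
    using f that unfolding C2_sphere_def C2_plane_def chart_functions_def by (auto intro!: continuous_on_diff)
qed (simp add: chart_functions_def)

text \<open>\<open>sup_norm\<close> is a supremum of reals and dominates the values only if the
  range is bounded. Outside the unit disc the conformal factor is compensated by the factor
  \<open>1 / |z| ^ 4\<close> from inversion.\<close>

lemma sphere_lap_bounded:
  assumes f: "C2_sphere f"
  shows "bdd_above (range (\<lambda>p. \<bar>sphere_lap f p\<bar>))"
proof -
  obtain M where "0 \<le> M" "\<forall>k\<in>chart_functions f. \<forall>u\<in>cball 0 1. \<bar>k u\<bar> \<le> M"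
    using C2_sphere_chart_bounds[OF f] by blast
  then have M: "0 \<le> M" "\<And>u k. cmod u \<le> 1 \<Longrightarrow> k \<in> chart_functions f \<Longrightarrow> \<bar>k u\<bar> \<le> M"
    by simp_all
  have l0: "\<bar>lap_plane (chart0 f) u\<bar> \<le> 2 * M" and l1: "\<bar>lap_plane (chart1 f) u\<bar> \<le> 2 * M" if "cmod u \<le> 1" for u
    using M(2)[OF that, of "dx (dx (chart0 f))"] M(2)[OF that, of "dy (dy (chart0 f))"]
      M(2)[OF that, of "dx (dx (chart1 f))"] M(2)[OF that, of "dy (dy (chart1 f))"]
    by (auto simp: lap_plane_def chart_functions_def)
  have "\<bar>sphere_lap f p\<bar> \<le> 2 * M" for p
  proof (cases p)
    case None
    then show ?thesis using l1[of 0] M(1) by (simp add: sphere_lap_def)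
  next
    case (Some z)
    show ?thesis
    proof (cases "cmod z \<le> 1")
      case True
      then have "(1 + (cmod z)\<^sup>2)\<^sup>2 \<le> 2\<^sup>2" by (intro power_mono) (auto simp: power_le_one)
      then have "(1 + (cmod z)\<^sup>2)\<^sup>2 / 4 * \<bar>lap_plane (chart0 f) z\<bar> \<le> 1 * (2 * M)"
        using l0[OF True] by (intro mult_mono) auto
      then show ?thesis by (simp add: Some sphere_lap_def abs_mult)
    next
      case False
      then have z: "z \<noteq> 0" "1 \<le> cmod z" "cmod (1 / z) \<le> 1" by (auto simp: norm_divide divide_le_eq_1)
      have "lap_plane (chart0 f) z = lap_plane (chart1 f) (1 / z) / (cmod z) ^ 4"
        using axis_eq_inv(2)[OF f z(1), of 1] axis_eq_inv(2)[OF f z(1), of \<i>] laplacian_inversion[OF z(1), of "chart1 f"]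
        by (simp add: axis2_laplacian[symmetric])
      then have "\<bar>sphere_lap f p\<bar> = ((1 + (cmod z)\<^sup>2)\<^sup>2 / 4 / (cmod z) ^ 4) * \<bar>lap_plane (chart1 f) (1 / z)\<bar>"
        by (simp add: Some sphere_lap_def abs_mult)
      also have "\<dots> \<le> 1 * (2 * M)"
      proof (intro mult_mono l1 z(3))
        have "1 + (cmod z)\<^sup>2 \<le> 2 * (cmod z)\<^sup>2" using z(2) by (simp add: one_le_power)
        then have "(1 + (cmod z)\<^sup>2)\<^sup>2 \<le> (2 * (cmod z)\<^sup>2)\<^sup>2" by (intro power_mono) auto
        also have "\<dots> = 4 * (cmod z) ^ 4" by (simp add: power_mult_distrib flip: power_mult)
        finally show "(1 + (cmod z)\<^sup>2)\<^sup>2 / 4 / (cmod z) ^ 4 \<le> 1" using z by (simp add: divide_simps)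
      qed auto
      finally show ?thesis by simp
    qed
  qed
  then show ?thesis by (intro bdd_aboveI2)
qed

lemma abs_laplacian_le_sup_norm:
  assumes "C2_sphere f"
  shows "\<bar>lap_plane (chart0 f) z\<bar> \<le> sup_norm (sphere_lap f) * fs z"
proof -
  have "\<bar>sphere_lap f (Some z)\<bar> \<le> sup_norm (sphere_lap f)"
    unfolding sup_norm_def by (rule cSUP_upper[OF UNIV_I sphere_lap_bounded[OF assms]])
  then have "\<bar>sphere_lap f (Some z)\<bar> * fs z \<le> sup_norm (sphere_lap f) * fs z"
    by (rule mult_right_mono) simp
  moreover have "\<bar>sphere_lap f (Some z)\<bar> * fs z = \<bar>lap_plane (chart0 f) z\<bar>"
    using one_plus_norm_sq_pos(2)[of z] by (simp add: sphere_lap_def fs_def abs_mult)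
  ultimately show ?thesis by simp
qed

lemma sup_norm_nonneg: "C2_sphere f \<Longrightarrow> 0 \<le> sup_norm (sphere_lap f)"
  using order_trans[OF abs_ge_zero abs_laplacian_le_sup_norm[of f 0]] fs_pos[of 0]
  by (simp add: zero_le_mult_iff)

lemma recip_power_le:
  fixes r :: real assumes "1 \<le> r" shows "1 / r ^ n \<le> 2 ^ n / (1 + r) ^ n"
proof -
  have "(1 / r) ^ n \<le> (2 / (1 + r)) ^ n" using assms by (intro power_mono) (auto simp: field_simps)
  then show ?thesis by (simp add: power_divide)
qed

lemma abs_Re_Im_combination_le:
  assumes "\<bar>a\<bar> \<le> M" "\<bar>b\<bar> \<le> M" shows "\<bar>a * Re w + b * Im w\<bar> \<le> 2 * M * cmod w"
proof -
  have "0 \<le> M" using assms by linarith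
  have "\<bar>a * Re w + b * Im w\<bar> \<le> \<bar>a\<bar> * \<bar>Re w\<bar> + \<bar>b\<bar> * \<bar>Im w\<bar>"
    by (metis abs_mult abs_triangle_ineq)
  also have "\<dots> \<le> M * cmod w + M * cmod w"
    using assms \<open>0 \<le> M\<close> abs_Re_le_cmod abs_Im_le_cmod by (intro add_mono mult_mono) auto
  finally show ?thesis by simp
qed

lemma decaying_C2_sphere:
  assumes f: "C2_sphere f"
  shows "decaying (\<lambda>z. chart0 f z - f None) (axis1 (chart0 f)) (axis2 (chart0 f))"
proof -
  let ?g = "chart0 f" and ?h = "chart1 f"
  have g: "C2_axes ?g (axis1 ?g) (axis2 ?g)" and h: "C2_plane ?h"
    using f C2_plane_axes by (auto simp: C2_sphere_def)
  have C: "C2_axes (\<lambda>z. ?g z - f None) (axis1 ?g) (axis2 ?g)"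
    using g unfolding C2_axes_def by (auto intro!: continuous_intros derivative_eq_intros)
  obtain M where "0 \<le> M" "\<forall>k\<in>chart_functions f. \<forall>u\<in>cball 0 1. \<bar>k u\<bar> \<le> M"
    using C2_sphere_chart_bounds[OF f] by blast
  then have M: "0 \<le> M" "\<And>u k. cmod u \<le> 1 \<Longrightarrow> k \<in> chart_functions f \<Longrightarrow> \<bar>k u\<bar> \<le> M"
    by simp_all
  have h0: "\<bar>?h u - f None\<bar> \<le> 2 * M * cmod u" if "cmod u \<le> 1" for u
  proof -
    \<comment> \<open>The mean value inequality on the convex unit disc turns the gradient bound
      into a bound proportional to \<open>|u|\<close>, which becomes decay of order
      \<open>1 / |z|\<close>.\<close>
    have "norm (?h u - ?h 0) \<le> 2 * M * norm (u - 0)"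
    proof (rule differentiable_bound[of "cball 0 1" ?h "\<lambda>u v. dx ?h u * Re v + dy ?h u * Im v"])
      fix x :: complex assume "x \<in> cball 0 1"
      then have x: "cmod x \<le> 1" by simp
      show "(?h has_derivative (\<lambda>v. dx ?h x * Re v + dy ?h x * Im v)) (at x within cball 0 1)"
        using C2_plane_has_derivative[OF h, of ?h x] by (auto intro: has_derivative_at_withinI)
      show "onorm (\<lambda>v. dx ?h x * Re v + dy ?h x * Im v) \<le> 2 * M"
      proof (rule onorm_le)
        fix v
        show "norm (dx ?h x * Re v + dy ?h x * Im v) \<le> 2 * M * cmod v"
          unfolding real_norm_def by (rule abs_Re_Im_combination_le) (rule M(2)[OF x]; simp add: chart_functions_def)+
      qed
    qed (use that in auto)
    then show ?thesis by (simp add: chart1_def)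
  qed
  \<comment> \<open>The largest constant comes from the second derivatives outside the unit disc:
    \<open>8 * M / r ^ 3\<close>, times the \<open>2 ^ 3\<close> lost in replacing \<open>r\<close>
    by \<open>1 + r\<close>.\<close>
  define K where "K = 64 * M"
  have "\<bar>?g z - f None\<bar> \<le> K / (1 + cmod z)
      \<and> \<bar>axis1 ?g e z\<bar> \<le> K / (1 + cmod z)\<^sup>2 \<and> \<bar>axis2 ?g e z\<bar> \<le> K / (1 + cmod z) ^ 3" if e: "e \<in> {1, \<i>}" for e z
  proof (cases "cmod z \<le> 1")
    case True
    have "M \<le> K / (1 + cmod z) ^ n" if "n \<le> 3" for n
    proof -
      have "(1 + cmod z) ^ n \<le> 2 ^ n" using True by (intro power_mono) auto
      also have "\<dots> \<le> 2 ^ 3" using that by (intro power_increasing) auto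
      finally have "M * (1 + cmod z) ^ n \<le> M * 64" using M(1) by (intro mult_left_mono) auto
      then show ?thesis by (simp add: K_def le_divide_eq add_pos_nonneg)
    qed
    from this[of 1] this[of 2] this[of 3] show ?thesis
      using M(2)[OF True, of "\<lambda>z. ?g z - f None"] M(2)[OF True, of "axis1 ?g e"] M(2)[OF True, of "axis2 ?g e"] e
      by (auto simp: axis1_def axis2_def chart_functions_def)
  next
    case False
    then have z: "z \<noteq> 0" "1 \<le> cmod z" "cmod (1 / z) \<le> 1" by (auto simp: norm_divide divide_le_eq_1)
    have ne: "cmod e = 1" using e by auto
    define r where "r = cmod z"
    have r: "1 \<le> r" using z by (simp add: r_def)
    have w: "cmod (- e / z\<^sup>2) = 1 / r\<^sup>2" "cmod (2 * e\<^sup>2 / z ^ 3) = 2 / r ^ 3"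
      by (simp_all add: norm_divide norm_mult norm_power ne r_def)
    have "\<bar>?g z - f None\<bar> \<le> 2 * M * (1 / r ^ 1)"
      using h0[OF z(3)] chart0_eq_chart1[OF z(1), of f] by (simp add: r_def norm_divide)
    also have "\<dots> \<le> 2 * M * (2 ^ 1 / (1 + r) ^ 1)" using M(1) r by (intro mult_left_mono recip_power_le) auto
    also have "\<dots> \<le> K / (1 + r)" using M(1) r by (simp add: K_def divide_right_mono)
    finally have 1: "\<bar>?g z - f None\<bar> \<le> K / (1 + r)" .
    have "\<bar>axis1 ?g e z\<bar> \<le> 2 * M * (1 / r\<^sup>2)"
      unfolding axis_eq_inv(1)[OF f z(1) e] inv1_def w(1)[symmetric]
      by (rule abs_Re_Im_combination_le) (rule M(2)[OF z(3)]; simp add: chart_functions_def)+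
    also have "\<dots> \<le> 2 * M * (2\<^sup>2 / (1 + r)\<^sup>2)" using M(1) r by (intro mult_left_mono recip_power_le) auto
    also have "\<dots> \<le> K / (1 + r)\<^sup>2" using M(1) r by (simp add: K_def divide_right_mono)
    finally have 2: "\<bar>axis1 ?g e z\<bar> \<le> K / (1 + r)\<^sup>2" .
    define A where "A = dx (dx ?h) (1 / z) * Re (- e / z\<^sup>2) + dy (dx ?h) (1 / z) * Im (- e / z\<^sup>2)"
    define B where "B = dx (dy ?h) (1 / z) * Re (- e / z\<^sup>2) + dy (dy ?h) (1 / z) * Im (- e / z\<^sup>2)"
    have A: "\<bar>A\<bar> \<le> 2 * M * (1 / r\<^sup>2)" "\<bar>B\<bar> \<le> 2 * M * (1 / r\<^sup>2)"
      unfolding A_def B_def w(1)[symmetric]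
      by (rule abs_Re_Im_combination_le; rule M(2)[OF z(3)]; simp add: chart_functions_def)+
    have T1: "\<bar>A * Re (- e / z\<^sup>2) + B * Im (- e / z\<^sup>2)\<bar> \<le> 2 * (2 * M * (1 / r\<^sup>2)) * (1 / r\<^sup>2)"
      unfolding w(1)[symmetric] by (rule abs_Re_Im_combination_le) (use A w in auto)
    have T2: "\<bar>dx ?h (1 / z) * Re (2 * e\<^sup>2 / z ^ 3) + dy ?h (1 / z) * Im (2 * e\<^sup>2 / z ^ 3)\<bar> \<le> 2 * M * (2 / r ^ 3)"
      unfolding w(2)[symmetric] by (rule abs_Re_Im_combination_le) (rule M(2)[OF z(3)]; simp add: chart_functions_def)+
    have "axis2 ?g e z = (A * Re (- e / z\<^sup>2) + B * Im (- e / z\<^sup>2))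
        + (dx ?h (1 / z) * Re (2 * e\<^sup>2 / z ^ 3) + dy ?h (1 / z) * Im (2 * e\<^sup>2 / z ^ 3))"
      unfolding axis_eq_inv(2)[OF f z(1) e] inv2_def A_def B_def by simp
    then have "\<bar>axis2 ?g e z\<bar> \<le> 2 * (2 * M * (1 / r\<^sup>2)) * (1 / r\<^sup>2) + 2 * M * (2 / r ^ 3)"
      using T1 T2 by linarith
    also have "2 * (2 * M * (1 / r\<^sup>2)) * (1 / r\<^sup>2) \<le> 4 * M * (1 / r ^ 3)"
    proof -
      have "r ^ 3 \<le> r ^ 4" using r by (intro power_increasing) auto
      then have "1 / r ^ 4 \<le> 1 / r ^ 3" using r by (intro divide_left_mono) auto
      then have "4 * M * (1 / r ^ 4) \<le> 4 * M * (1 / r ^ 3)" using M(1) by (intro mult_left_mono) auto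
      moreover have "2 * (2 * M * (1 / r\<^sup>2)) * (1 / r\<^sup>2) = 4 * M * (1 / r ^ 4)"
        by (simp flip: power_add)
      ultimately show ?thesis by simp
    qed
    also have "4 * M * (1 / r ^ 3) + 2 * M * (2 / r ^ 3) = 8 * M * (1 / r ^ 3)" by simp
    also have "\<dots> \<le> 8 * M * (2 ^ 3 / (1 + r) ^ 3)" using M(1) r by (intro mult_left_mono recip_power_le) auto
    also have "\<dots> = K / (1 + r) ^ 3" by (simp add: K_def)
    finally show ?thesis using 1 2 by (simp add: r_def)
  qed
  then show ?thesis using C unfolding decaying_def by blast
qed

section \<open>Zeros of polynomials\<close>

text \<open>Finite roots only; the root at infinity always enters as a separate term of weight
  \<open>k - degree P\<close>.\<close>

definition root_sum :: "complex poly \<Rightarrow> (complex \<Rightarrow> real) \<Rightarrow> real" where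
  "root_sum P \<phi> = (\<Sum>x | poly P x = 0. real (order x P) * \<phi> x)"

lemma root_sum_one:
  assumes "P \<noteq> 0" shows "root_sum P (\<lambda>_. 1) = real (degree P)"
proof -
  have "degree P = degree (smult (lead_coeff P) (\<Prod>z|poly P z = 0. [:-z, 1:] ^ order z P))"
    by (subst complex_poly_decompose) simp
  also have "\<dots> = (\<Sum>z | poly P z = 0. order z P)"
    using assms by (simp add: degree_prod_eq_sum_degree degree_linear_power)
  finally show ?thesis by (simp add: root_sum_def)
qed

lemma root_sum_linear:
  "root_sum P (\<lambda>x. \<phi> x + \<psi> x) = root_sum P \<phi> + root_sum P \<psi>"
  "root_sum P (\<lambda>x. \<phi> x - \<psi> x) = root_sum P \<phi> - root_sum P \<psi>"
  "root_sum P (\<lambda>x. c * \<phi> x) = c * root_sum P \<phi>"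
  by (simp_all add: root_sum_def sum.distrib sum_subtractf sum_distrib_left algebra_simps)

lemma root_sum_const:
  assumes "P \<noteq> 0" shows "root_sum P (\<lambda>_. c) = real (degree P) * c"
  using root_sum_linear(3)[of P c "\<lambda>_. 1"] root_sum_one[OF assms] by simp

lemma root_sum_mono:
  assumes "\<And>x. poly P x = 0 \<Longrightarrow> \<phi> x \<le> \<psi> x" shows "root_sum P \<phi> \<le> root_sum P \<psi>"
  unfolding root_sum_def using assms by (intro sum_mono mult_left_mono) auto

lemma root_sum_cong:
  assumes "\<And>x. poly P x = 0 \<Longrightarrow> \<phi> x = \<psi> x" shows "root_sum P \<phi> = root_sum P \<psi>"
  unfolding root_sum_def using assms by (intro sum.cong) auto

lemma root_sum_swap:
  "root_sum P (\<lambda>x. root_sum Q (\<lambda>y. F x y)) = root_sum Q (\<lambda>y. root_sum P (\<lambda>x. F x y))"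
  unfolding root_sum_def sum_distrib_left
  by (subst sum.swap) (simp add: mult.left_commute)

lemma ln_norm_poly:
  assumes "P \<noteq> 0" "poly P z \<noteq> 0"
  shows "ln ((cmod (poly P z))\<^sup>2) = ln ((cmod (lead_coeff P))\<^sup>2) + root_sum P (\<lambda>x. ln ((cmod (z - x))\<^sup>2))"
proof -
  have fin: "finite {x. poly P x = 0}" using assms(1) by (rule poly_roots_finite)
  have ne: "((cmod (z - x))\<^sup>2) ^ order x P \<noteq> 0" if "x \<in> {x. poly P x = 0}" for x
    using that assms by auto
  have "poly P z = poly (smult (lead_coeff P) (\<Prod>x|poly P x = 0. [:-x, 1:] ^ order x P)) z"
    by (subst complex_poly_decompose) simp
  also have "\<dots> = lead_coeff P * (\<Prod>x | poly P x = 0. (z - x) ^ order x P)"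
    by (simp add: poly_prod)
  finally have "(cmod (poly P z))\<^sup>2 = (cmod (lead_coeff P))\<^sup>2 * (\<Prod>x | poly P x = 0. ((cmod (z - x))\<^sup>2) ^ order x P)"
    by (simp add: norm_mult power_mult_distrib norm_power prod_norm[symmetric] prod_power_distrib
        power_mult[symmetric] mult.commute)
  then have "ln ((cmod (poly P z))\<^sup>2) = ln ((cmod (lead_coeff P))\<^sup>2) + ln (\<Prod>x | poly P x = 0. ((cmod (z - x))\<^sup>2) ^ order x P)"
    using assms ne fin by (simp only:) (subst ln_mult, auto)
  also have "ln (\<Prod>x | poly P x = 0. ((cmod (z - x))\<^sup>2) ^ order x P) = root_sum P (\<lambda>x. ln ((cmod (z - x))\<^sup>2))"
    unfolding root_sum_def using fin ne
    by (subst ln_prod) (auto intro!: sum.cong simp: ln_realpow)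
  finally show ?thesis .
qed

lemma AE_poly_nonzero:
  assumes "P \<noteq> 0" shows "AE z in lborel. poly P z \<noteq> (0 :: complex)"
  using AE_not_in[OF finite_imp_null_set_lborel[OF poly_roots_finite[OF assms]]] by simp

lemma borel_measurable_poly [measurable]: "poly P \<in> borel_measurable (borel :: complex measure)"
  by (intro borel_measurable_continuous_onI continuous_intros)

text \<open>Off the finite set of roots, \<open>ln |P|\<^sup>2\<close> is a constant plus finitely
  many logarithmic potentials. The density \<open>\<mu>\<close> is left general because it is later
  both \<open>fs\<close> and the Laplacian of \<open>f\<close>.\<close>

lemma
  fixes \<mu> :: "complex \<Rightarrow> real"
  assumes P: "P \<noteq> 0" and \<mu>: "integrable lborel \<mu>"
    and ln: "\<And>a. integrable lborel (\<lambda>z. ln ((cmod (z - a))\<^sup>2) * \<mu> z)"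
  shows integrable_ln_poly: "integrable lborel (\<lambda>z. ln ((cmod (poly P z))\<^sup>2) * \<mu> z)"
    and integral_ln_poly: "(\<integral>z. ln ((cmod (poly P z))\<^sup>2) * \<mu> z \<partial>lborel)
      = ln ((cmod (lead_coeff P))\<^sup>2) * (\<integral>z. \<mu> z \<partial>lborel) + root_sum P (\<lambda>a. \<integral>z. ln ((cmod (z - a))\<^sup>2) * \<mu> z \<partial>lborel)"
proof -
  let ?h = "\<lambda>z. ln ((cmod (lead_coeff P))\<^sup>2) * \<mu> z + (\<Sum>x | poly P x = 0. real (order x P) * (ln ((cmod (z - x))\<^sup>2) * \<mu> z))"
  have [measurable]: "\<mu> \<in> borel_measurable borel" using \<mu> by simp
  have h: "integrable lborel ?h" using \<mu> ln by simp
  have ae: "AE z in lborel. ?h z = ln ((cmod (poly P z))\<^sup>2) * \<mu> z"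
    using AE_poly_nonzero[OF P]
    by eventually_elim (simp add: ln_norm_poly[OF P] root_sum_def distrib_right sum_distrib_right mult.assoc)
  show "integrable lborel (\<lambda>z. ln ((cmod (poly P z))\<^sup>2) * \<mu> z)"
    by (rule integrable_cong_AE_imp[OF h _ ae]) measurable
  have "(\<integral>z. ln ((cmod (poly P z))\<^sup>2) * \<mu> z \<partial>lborel) = (\<integral>z. ?h z \<partial>lborel)"
    by (rule integral_cong_AE) (use ae in \<open>auto elim: eventually_mono\<close>)
  also have "\<dots> = ln ((cmod (lead_coeff P))\<^sup>2) * (\<integral>z. \<mu> z \<partial>lborel) + root_sum P (\<lambda>a. \<integral>z. ln ((cmod (z - a))\<^sup>2) * \<mu> z \<partial>lborel)"
    using \<mu> ln by (simp add: root_sum_def)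
  finally show "(\<integral>z. ln ((cmod (poly P z))\<^sup>2) * \<mu> z \<partial>lborel)
      = ln ((cmod (lead_coeff P))\<^sup>2) * (\<integral>z. \<mu> z \<partial>lborel) + root_sum P (\<lambda>a. \<integral>z. ln ((cmod (z - a))\<^sup>2) * \<mu> z \<partial>lborel)" .
qed

text \<open>\<open>rel_log k P\<close> is the logarithm of the squared pointwise norm of \<open>P\<close>, regarded as a section of \<open>O(k)\<close>.\<close>

definition rel_log :: "nat \<Rightarrow> complex poly \<Rightarrow> complex \<Rightarrow> real" where
  "rel_log k P z = ln ((cmod (poly P z))\<^sup>2) - real k * ln (1 + (cmod z)\<^sup>2)"

text \<open>By \<open>integral_ln_fs\<close> this is the spherical average of
  \<open>ln |P|\<^sup>2\<close>, an analogue of the logarithmic Mahler measure with the sphere in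
  place of the circle.\<close>

definition log_height :: "complex poly \<Rightarrow> real" where
  "log_height P = ln ((cmod (lead_coeff P))\<^sup>2) + root_sum P (\<lambda>x. ln (1 + (cmod x)\<^sup>2))"

lemma borel_measurable_rel_log [measurable]: "rel_log k P \<in> borel_measurable borel"
  unfolding rel_log_def by measurable

lemma
  assumes "P \<noteq> 0"
  shows integrable_rel_log_fs: "integrable lborel (\<lambda>z. rel_log k P z * fs z)"
    and integral_rel_log_fs: "(\<integral>z. rel_log k P z * fs z \<partial>lborel)
      = 4 * pi * log_height P - real k * (\<integral>z. ln (1 + (cmod z)\<^sup>2) * fs z \<partial>lborel)"
proof -
  have i: "integrable lborel (\<lambda>z. ln ((cmod (poly P z))\<^sup>2) * fs z)"
    by (rule integrable_ln_poly[OF assms integrable_fs integrable_ln_fs])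
  have e: "(\<lambda>z. rel_log k P z * fs z) = (\<lambda>z. ln ((cmod (poly P z))\<^sup>2) * fs z - real k * (ln (1 + (cmod z)\<^sup>2) * fs z))"
    by (auto simp: rel_log_def algebra_simps)
  show "integrable lborel (\<lambda>z. rel_log k P z * fs z)"
    unfolding e using i integrable_ln_one_plus_fs by simp
  show "(\<integral>z. rel_log k P z * fs z \<partial>lborel)
      = 4 * pi * log_height P - real k * (\<integral>z. ln (1 + (cmod z)\<^sup>2) * fs z \<partial>lborel)"
  proof -
    have "(\<integral>z. ln ((cmod (poly P z))\<^sup>2) * fs z \<partial>lborel) = 4 * pi * log_height P"
      unfolding integral_ln_poly[OF assms integrable_fs integrable_ln_fs] integral_fs integral_ln_fs
        root_sum_linear log_height_def by (simp add: algebra_simps)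
    then show ?thesis unfolding e using i integrable_ln_one_plus_fs by simp
  qed
qed

text \<open>Both sides equal the logarithm of the squared resultant of \<open>P\<close> and \<open>Q\<close>
  as binary forms of degree \<open>k\<close>.\<close>

lemma log_resultant_symmetric:
  assumes P: "P \<noteq> 0" and Q: "Q \<noteq> 0" and deg: "degree P \<le> k" "degree Q \<le> k"
    and coprime: "\<And>x. poly P x = 0 \<Longrightarrow> poly Q x \<noteq> 0"
  shows "real k * log_height P + root_sum P (rel_log k Q) + real (k - degree P) * ln ((cmod (lead_coeff Q))\<^sup>2)
       = real k * log_height Q + root_sum Q (rel_log k P) + real (k - degree Q) * ln ((cmod (lead_coeff P))\<^sup>2)"
proof -
  \<comment> \<open>The weights \<open>k * ln (1 + |x|\<^sup>2)\<close> in \<open>rel_log\<close>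
    cancel the root part of \<open>k * log_height P\<close>. What remains is symmetric in the two
    polynomials once the double root sum is swapped.\<close>
  have *: "real k * log_height P + root_sum P (rel_log k Q) + real (k - degree P) * ln ((cmod (lead_coeff Q))\<^sup>2)
      = real k * ln ((cmod (lead_coeff P))\<^sup>2) + real k * ln ((cmod (lead_coeff Q))\<^sup>2)
        + root_sum P (\<lambda>x. root_sum Q (\<lambda>y. ln ((cmod (x - y))\<^sup>2)))"
    if P: "P \<noteq> 0" and Q: "Q \<noteq> 0" and d: "degree P \<le> k" and cop: "\<And>x. poly P x = 0 \<Longrightarrow> poly Q x \<noteq> 0" for P Q
  proof -
    have "root_sum P (rel_log k Q) = root_sum P (\<lambda>x. (ln ((cmod (lead_coeff Q))\<^sup>2) + root_sum Q (\<lambda>y. ln ((cmod (x - y))\<^sup>2)))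
        - real k * ln (1 + (cmod x)\<^sup>2))"
      unfolding rel_log_def using ln_norm_poly[OF Q] cop by (intro root_sum_cong) auto
    also have "\<dots> = real (degree P) * ln ((cmod (lead_coeff Q))\<^sup>2) + root_sum P (\<lambda>x. root_sum Q (\<lambda>y. ln ((cmod (x - y))\<^sup>2)))
        - real k * root_sum P (\<lambda>x. ln (1 + (cmod x)\<^sup>2))"
      by (simp only: root_sum_linear root_sum_const[OF P])
    finally show ?thesis using d by (simp add: log_height_def algebra_simps of_nat_diff)
  qed
  have "poly P x \<noteq> 0" if "poly Q x = 0" for x using coprime that by blast
  with *[OF P Q deg(1) coprime] *[OF Q P deg(2)]
  show ?thesis using root_sum_swap[of P Q "\<lambda>x y. ln ((cmod (x - y))\<^sup>2)"]
    by (simp add: norm_minus_commute)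
qed

text \<open>Counting the zero at infinity, whose value is a leading coefficient, each side of the
  resultant identity carries total weight exactly \<open>k\<close>. The pointwise bounds
  \<open>l\<close> and \<open>u\<close> therefore enter multiplied by \<open>k\<close>, and division
  by \<open>k\<close> removes the degree.\<close>

lemma log_height_compare:
  assumes P: "P \<noteq> 0" and Q: "Q \<noteq> 0" and deg: "degree P \<le> k" "degree Q \<le> k" and k: "0 < k"
    and coprime: "\<And>x. poly P x = 0 \<Longrightarrow> poly Q x \<noteq> 0"
    and lo: "\<And>y. poly Q y = 0 \<Longrightarrow> l \<le> rel_log k P y" "degree Q < k \<Longrightarrow> l \<le> ln ((cmod (lead_coeff P))\<^sup>2)"
    and up: "\<And>x. poly P x = 0 \<Longrightarrow> rel_log k Q x \<le> u" "degree P < k \<Longrightarrow> ln ((cmod (lead_coeff Q))\<^sup>2) \<le> u"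
  shows "log_height Q + l - u \<le> log_height P"
proof -
  have "real (degree Q) * l \<le> root_sum Q (rel_log k P)"
    using root_sum_mono[of Q "\<lambda>_. l" "rel_log k P"] lo(1) root_sum_const[OF Q] by simp
  moreover have "real (k - degree Q) * l \<le> real (k - degree Q) * ln ((cmod (lead_coeff P))\<^sup>2)"
    by (cases "degree Q < k") (auto intro!: mult_left_mono lo(2))
  moreover have "real (degree Q) * l + real (k - degree Q) * l = real k * l"
    using deg by (simp add: of_nat_diff algebra_simps)
  moreover have "root_sum P (rel_log k Q) \<le> real (degree P) * u"
    using root_sum_mono[of P "rel_log k Q" "\<lambda>_. u"] up(1) root_sum_const[OF P] by simp
  moreover have "real (k - degree P) * ln ((cmod (lead_coeff Q))\<^sup>2) \<le> real (k - degree P) * u"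
    by (cases "degree P < k") (auto intro!: mult_left_mono up(2))
  moreover have "real (degree P) * u + real (k - degree P) * u = real k * u"
    using deg by (simp add: of_nat_diff algebra_simps)
  ultimately have "real k * log_height Q + real k * l - real k * u \<le> real k * log_height P"
    using log_resultant_symmetric[OF P Q deg coprime] by linarith
  then have "real k * (log_height Q + l - u) \<le> real k * log_height P" by (simp add: algebra_simps)
  then show ?thesis using k by simp
qed

section \<open>Dehomogenised forms and the discrepancy of their zeros\<close>

lemma coeff_dehom: "coeff (dehom c k) j = (if j \<le> k then c j else 0)"
  by (auto simp: dehom_def coeff_sum if_distrib[of "\<lambda>x. x = _"] coeff_monom)

lemma degree_dehom: "degree (dehom c k) \<le> k"
  by (intro degree_le) (simp add: coeff_dehom)

lemma poly_dehom: "poly (dehom c k) z = hom_eval c k z 1"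
  by (simp add: dehom_def hom_eval_def poly_sum poly_monom)

lemma zero_sum_eq: "zero_sum c k f = root_sum (dehom c k) (\<lambda>x. f (Some x)) + real (k - degree (dehom c k)) * f None"
  by (simp add: zero_sum_def root_sum_def)

lemma sphere_integral_eq:
  assumes "C2_sphere f"
  shows "sphere_integral f = (\<integral>z. (chart0 f z - f None) * fs z \<partial>lborel) + 4 * pi * f None"
proof -
  \<comment> \<open>\<open>fs\<close> is the Laplacian of \<open>logp 1 0\<close>, so this is one of
    the integrability claims that accompany Green's identity.\<close>
  have i: "integrable lborel (\<lambda>z. (chart0 f z - f None) * fs z)"
    using integrable_laplacian_tempered[OF decaying_C2_sphere[OF assms] tempered_logp[of 1 0]] laplacian_logp_one[of 0]
    by simp
  have e: "(\<lambda>z. chart0 f z * fs z) = (\<lambda>z. (chart0 f z - f None) * fs z + f None * fs z)"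
    by (auto simp: algebra_simps)
  have i2: "integrable lborel (\<lambda>z. chart0 f z * fs z)" unfolding e using i integrable_fs by simp
  have "sphere_integral f = (\<integral>z. chart0 f z * fs z \<partial>lborel)"
    using integral_lborel[OF i2] by (simp add: sphere_integral_def chart0_def fs_def)
  also have "\<dots> = (\<integral>z. (chart0 f z - f None) * fs z \<partial>lborel) + 4 * pi * f None"
    unfolding e using i integrable_fs integral_fs by simp
  finally show ?thesis .
qed

lemma zero_sum_discrepancy:
  assumes f: "C2_sphere f" and P: "dehom c k \<noteq> 0"
  shows "\<bar>zero_sum c k f - real k * sphere_integral f / (4 * pi)\<bar>
       \<le> sup_norm (sphere_lap f) / (4 * pi) * (\<integral>z. \<bar>rel_log k (dehom c k) z\<bar> * fs z \<partial>lborel)"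
proof -
  let ?P = "dehom c k" and ?lap = "lap_plane (chart0 f)" and ?S = "sup_norm (sphere_lap f)"
  note dec = decaying_C2_sphere[OF f]
  note [measurable] = borel_measurable_decaying[OF dec, unfolded axis2_laplacian]
  have i0: "integrable lborel ?lap" and z0: "(\<integral>z. ?lap z \<partial>lborel) = 0"
    using integrable_laplacian[OF dec] integral_laplacian[OF dec] by (simp_all add: axis2_laplacian)
  have ln: "integrable lborel (\<lambda>z. ln ((cmod (z - a))\<^sup>2) * ?lap z)" for a
    using integrable_ln_laplacian[OF dec] by (simp add: axis2_laplacian)
  have lnv: "(\<integral>z. ln ((cmod (z - a))\<^sup>2) * ?lap z \<partial>lborel) = 4 * pi * (f (Some a) - f None)" for a
    using integral_ln_laplacian[OF dec] by (simp add: axis2_laplacian chart0_def)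
  have iP: "integrable lborel (\<lambda>z. ln ((cmod (poly ?P z))\<^sup>2) * ?lap z)"
    by (rule integrable_ln_poly[OF P i0 ln])
  \<comment> \<open>Each root contributes \<open>f (Some x) - f None\<close>. A zero at infinity
    would contribute 0, so after adding \<open>k - degree\<close> such zeros exactly
    \<open>k * f None\<close> is subtracted.\<close>
  have vP: "(\<integral>z. ln ((cmod (poly ?P z))\<^sup>2) * ?lap z \<partial>lborel) = 4 * pi * (zero_sum c k f - real k * f None)"
    unfolding integral_ln_poly[OF P i0 ln] lnv z0 zero_sum_eq root_sum_linear root_sum_const[OF P]
    using degree_dehom[of c k] by (simp add: of_nat_diff algebra_simps)
  have i1: "integrable lborel (\<lambda>z. logp 1 0 z * ?lap z)"
    using integrable_tempered_laplacian[OF dec tempered_logp[of 1 0]] by (simp add: axis2_laplacian)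
  have v1: "(\<integral>z. logp 1 0 z * ?lap z \<partial>lborel) = sphere_integral f - 4 * pi * f None"
    using green_identity[OF dec tempered_logp[of 1 0]] sphere_integral_eq[OF f] laplacian_logp_one[of 0]
    by (simp add: axis2_laplacian)
  have e: "(\<lambda>z. rel_log k ?P z * ?lap z) = (\<lambda>z. ln ((cmod (poly ?P z))\<^sup>2) * ?lap z - real k * (logp 1 0 z * ?lap z))"
    by (auto simp: rel_log_def logp_def algebra_simps)
  have iU: "integrable lborel (\<lambda>z. rel_log k ?P z * ?lap z)" unfolding e using iP i1 by simp
  have "(\<integral>z. rel_log k ?P z * ?lap z \<partial>lborel) = 4 * pi * (zero_sum c k f - real k * sphere_integral f / (4 * pi))"
  proof -
    have "(\<integral>z. rel_log k ?P z * ?lap z \<partial>lborel)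
        = (\<integral>z. ln ((cmod (poly ?P z))\<^sup>2) * ?lap z \<partial>lborel) - real k * (\<integral>z. logp 1 0 z * ?lap z \<partial>lborel)"
      unfolding e using iP i1 by simp
    then show ?thesis unfolding vP v1 by (simp add: algebra_simps)
  qed
  moreover have "\<bar>\<integral>z. rel_log k ?P z * ?lap z \<partial>lborel\<bar> \<le> ?S * (\<integral>z. \<bar>rel_log k ?P z\<bar> * fs z \<partial>lborel)"
  proof -
    have ia: "integrable lborel (\<lambda>z. \<bar>rel_log k ?P z\<bar> * fs z)"
      using integrable_abs[OF integrable_rel_log_fs[OF P, of k]] by (simp add: abs_mult)
    have "\<bar>\<integral>z. rel_log k ?P z * ?lap z \<partial>lborel\<bar> \<le> (\<integral>z. \<bar>rel_log k ?P z * ?lap z\<bar> \<partial>lborel)"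
      by (rule integral_abs_bound)
    also have "\<dots> \<le> (\<integral>z. ?S * (\<bar>rel_log k ?P z\<bar> * fs z) \<partial>lborel)"
    proof (rule integral_mono)
      fix z
      have "\<bar>rel_log k ?P z\<bar> * \<bar>?lap z\<bar> \<le> \<bar>rel_log k ?P z\<bar> * (?S * fs z)"
        by (intro mult_left_mono abs_laplacian_le_sup_norm[OF f]) auto
      then show "\<bar>rel_log k ?P z * ?lap z\<bar> \<le> ?S * (\<bar>rel_log k ?P z\<bar> * fs z)"
        by (simp add: abs_mult mult_ac)
    qed (use iU ia in auto)
    finally show ?thesis by simp
  qed
  ultimately have "4 * pi * \<bar>zero_sum c k f - real k * sphere_integral f / (4 * pi)\<bar> \<le> ?S * (\<integral>z. \<bar>rel_log k ?P z\<bar> * fs z \<partial>lborel)"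
    by (simp add: abs_mult)
  then show ?thesis by (simp add: field_simps)
qed

section \<open>Pencils of polynomials and the main estimate\<close>

text \<open>Two coefficients instead of one affine parameter, so that the fibre over infinity, cut
  out by \<open>B\<close> alone, is included.\<close>

definition comb :: "complex \<Rightarrow> complex \<Rightarrow> complex poly \<Rightarrow> complex poly \<Rightarrow> complex poly" where
  "comb \<alpha> \<beta> A B = smult \<alpha> A + smult \<beta> B"

text \<open>The annulus condition squared and rescaled from the unit sphere to the points
  \<open>(z, 1)\<close>. The last line is the same condition at the point at infinity, where a form
  takes its coefficient of index \<open>k\<close> as value.\<close>

definition annular :: "real \<Rightarrow> nat \<Rightarrow> complex poly \<Rightarrow> complex poly \<Rightarrow> bool" where
  "annular \<eta> k A B \<longleftrightarrow> degree A \<le> k \<and> degree B \<le> k \<and>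
     (\<forall>z. \<eta> * (1 + (cmod z)\<^sup>2) ^ k \<le> (cmod (poly A z))\<^sup>2 + (cmod (poly B z))\<^sup>2 \<and>
          (cmod (poly A z))\<^sup>2 + (cmod (poly B z))\<^sup>2 \<le> (1 + (cmod z)\<^sup>2) ^ k) \<and>
     \<eta> \<le> (cmod (coeff A k))\<^sup>2 + (cmod (coeff B k))\<^sup>2 \<and> (cmod (coeff A k))\<^sup>2 + (cmod (coeff B k))\<^sup>2 \<le> 1"

lemma poly_comb: "poly (comb \<alpha> \<beta> A B) z = \<alpha> * poly A z + \<beta> * poly B z"
  by (simp add: comb_def)

lemma coeff_comb: "coeff (comb \<alpha> \<beta> A B) n = \<alpha> * coeff A n + \<beta> * coeff B n"
  by (simp add: comb_def)

lemma degree_comb: "annular \<eta> k A B \<Longrightarrow> degree (comb \<alpha> \<beta> A B) \<le> k"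
  unfolding comb_def annular_def by (meson degree_add_le degree_smult_le order_trans)

lemma hom_eval_scale: "hom_eval c k (s * z) (s * w) = s ^ k * hom_eval c k z w"
proof -
  have "s ^ j * s ^ (k - j) = s ^ k" if "j \<le> k" for j using that by (simp flip: power_add)
  then have "c j * (s * z) ^ j * (s * w) ^ (k - j) = s ^ k * (c j * z ^ j * w ^ (k - j))" if "j \<le> k" for j
  proof -
    have "c j * (s * z) ^ j * (s * w) ^ (k - j) = (s ^ j * s ^ (k - j)) * (c j * z ^ j * w ^ (k - j))"
      by (simp add: power_mult_distrib)
    with \<open>\<And>j. j \<le> k \<Longrightarrow> s ^ j * s ^ (k - j) = s ^ k\<close>[OF that] show ?thesis by (simp only:)
  qed
  then show ?thesis unfolding hom_eval_def sum_distrib_left by (intro sum.cong) auto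
qed

lemma hom_eval_infinity: "hom_eval c k 1 0 = c k"
proof -
  have "hom_eval c k 1 0 = (\<Sum>j\<le>k. if j = k then c j else 0)"
    unfolding hom_eval_def by (intro sum.cong) auto
  then show ?thesis by simp
qed

lemma annular_dehom:
  assumes "0 < \<eta>"
    and H: "\<And>z0 z1. (cmod z0)\<^sup>2 + (cmod z1)\<^sup>2 = 1 \<Longrightarrow>
      sqrt \<eta> \<le> sqrt ((cmod (hom_eval a k z0 z1))\<^sup>2 + (cmod (hom_eval b k z0 z1))\<^sup>2) \<and>
      sqrt ((cmod (hom_eval a k z0 z1))\<^sup>2 + (cmod (hom_eval b k z0 z1))\<^sup>2) \<le> 1"
  shows "annular \<eta> k (dehom a k) (dehom b k)"
  unfolding annular_def
proof (intro conjI allI degree_dehom)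
  show "\<eta> \<le> (cmod (coeff (dehom a k) k))\<^sup>2 + (cmod (coeff (dehom b k) k))\<^sup>2"
    "(cmod (coeff (dehom a k) k))\<^sup>2 + (cmod (coeff (dehom b k) k))\<^sup>2 \<le> 1"
    using H[of 1 0] by (simp_all add: coeff_dehom hom_eval_infinity)
  fix z
  define D where "D = 1 + (cmod z)\<^sup>2"
  define s where "s = complex_of_real (1 / sqrt D)"
  have D: "0 < D" by (simp add: D_def)
  have s: "(cmod s)\<^sup>2 = 1 / D" using D by (simp add: s_def norm_divide power_divide)
  have one: "(cmod (s * z))\<^sup>2 + (cmod (s * 1))\<^sup>2 = 1"
  proof -
    have "(cmod (s * z))\<^sup>2 + (cmod (s * 1))\<^sup>2 = (cmod s)\<^sup>2 * D"
      by (simp add: norm_mult power_mult_distrib D_def algebra_simps)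
    then show ?thesis using s D by simp
  qed
  have e: "(cmod (hom_eval c k (s * z) (s * 1)))\<^sup>2 = (cmod (poly (dehom c k) z))\<^sup>2 / D ^ k" for c
  proof -
    have "(cmod (hom_eval c k (s * z) (s * 1)))\<^sup>2 = ((cmod s)\<^sup>2) ^ k * (cmod (poly (dehom c k) z))\<^sup>2"
      unfolding hom_eval_scale poly_dehom
      by (simp add: norm_mult norm_power power_mult_distrib power_mult[symmetric] mult.commute)
    then show ?thesis by (simp add: s power_divide)
  qed
  have "\<eta> \<le> ((cmod (poly (dehom a k) z))\<^sup>2 + (cmod (poly (dehom b k) z))\<^sup>2) / D ^ k"
    "((cmod (poly (dehom a k) z))\<^sup>2 + (cmod (poly (dehom b k) z))\<^sup>2) / D ^ k \<le> 1"
    using H[OF one] unfolding e by (simp_all add: add_divide_distrib)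
  then show "\<eta> * (1 + (cmod z)\<^sup>2) ^ k \<le> (cmod (poly (dehom a k) z))\<^sup>2 + (cmod (poly (dehom b k) z))\<^sup>2"
    "(cmod (poly (dehom a k) z))\<^sup>2 + (cmod (poly (dehom b k) z))\<^sup>2 \<le> (1 + (cmod z)\<^sup>2) ^ k"
    using D by (simp_all add: divide_simps flip: D_def)
qed

lemma norm_combination_le:
  "(cmod (\<alpha> * x + \<beta> * y))\<^sup>2 \<le> ((cmod \<alpha>)\<^sup>2 + (cmod \<beta>)\<^sup>2) * ((cmod x)\<^sup>2 + (cmod y)\<^sup>2)"
proof -
  have "cmod (\<alpha> * x + \<beta> * y) \<le> cmod \<alpha> * cmod x + cmod \<beta> * cmod y"
    using norm_triangle_ineq[of "\<alpha> * x" "\<beta> * y"] by (simp add: norm_mult)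
  then have "(cmod (\<alpha> * x + \<beta> * y))\<^sup>2 \<le> (cmod \<alpha> * cmod x + cmod \<beta> * cmod y)\<^sup>2" by (intro power_mono) auto
  also have "\<dots> \<le> ((cmod \<alpha>)\<^sup>2 + (cmod \<beta>)\<^sup>2) * ((cmod x)\<^sup>2 + (cmod y)\<^sup>2)"
    using zero_le_power2[of "cmod \<alpha> * cmod y - cmod \<beta> * cmod x"] by (simp add: power2_eq_square algebra_simps)
  finally show ?thesis .
qed

lemma rel_log_comb_le:
  assumes ann: "annular \<eta> k A B" and \<sigma>: "1 \<le> \<sigma>" "(cmod \<alpha>)\<^sup>2 + (cmod \<beta>)\<^sup>2 \<le> \<sigma>"
  shows "rel_log k (comb \<alpha> \<beta> A B) z \<le> ln \<sigma>"
    and "ln ((cmod (coeff (comb \<alpha> \<beta> A B) k))\<^sup>2) \<le> ln \<sigma>"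
proof -
  define D where "D = 1 + (cmod z)\<^sup>2"
  have D: "1 \<le> D" by (simp add: D_def)
  have "rel_log k (comb \<alpha> \<beta> A B) z \<le> ln \<sigma>"
  proof (cases "poly (comb \<alpha> \<beta> A B) z = 0")
    case True
    \<comment> \<open>At a zero the convention \<open>ln 0 = 0\<close> gives \<open>rel_log\<close>
      the value \<open>- k * ln D\<close>, which is still below \<open>ln \<sigma>\<close> because
      \<open>1 \<le> \<sigma>\<close>.\<close>
    have "0 \<le> real k * ln D" "0 \<le> ln \<sigma>" using D \<sigma> by auto
    then show ?thesis using True by (simp add: rel_log_def flip: D_def)
  next
    case False
    have "(cmod (poly (comb \<alpha> \<beta> A B) z))\<^sup>2 \<le> ((cmod \<alpha>)\<^sup>2 + (cmod \<beta>)\<^sup>2) * ((cmod (poly A z))\<^sup>2 + (cmod (poly B z))\<^sup>2)"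
      unfolding poly_comb by (rule norm_combination_le)
    also have "\<dots> \<le> \<sigma> * D ^ k" using ann \<sigma> unfolding annular_def D_def by (intro mult_mono) auto
    finally have "ln ((cmod (poly (comb \<alpha> \<beta> A B) z))\<^sup>2) \<le> ln (\<sigma> * D ^ k)"
      using False \<sigma> D by (subst ln_le_cancel_iff) auto
    also have "\<dots> = ln \<sigma> + real k * ln D" using \<sigma> D by (simp add: ln_mult ln_realpow)
    finally show ?thesis by (simp add: rel_log_def flip: D_def)
  qed
  then show "rel_log k (comb \<alpha> \<beta> A B) z \<le> ln \<sigma>" .
  show "ln ((cmod (coeff (comb \<alpha> \<beta> A B) k))\<^sup>2) \<le> ln \<sigma>"
  proof (cases "coeff (comb \<alpha> \<beta> A B) k = 0")
    case False
    have "(cmod (coeff (comb \<alpha> \<beta> A B) k))\<^sup>2 \<le> ((cmod \<alpha>)\<^sup>2 + (cmod \<beta>)\<^sup>2) * ((cmod (coeff A k))\<^sup>2 + (cmod (coeff B k))\<^sup>2)"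
      unfolding coeff_comb by (rule norm_combination_le)
    also have "\<dots> \<le> \<sigma> * 1" using ann \<sigma> unfolding annular_def by (intro mult_mono) auto
    finally show ?thesis using False \<sigma> by (subst ln_le_cancel_iff) auto
  qed (use \<sigma> in simp)
qed

text \<open>On the line \<open>x = w * y\<close> the combination equals
  \<open>(\<alpha> * w + \<beta>) * y\<close>, and \<open>y\<close> carries the fixed share
  \<open>1 / (1 + |w|\<^sup>2)\<close> of the squared length. The hypothesis keeps the two members
  of the pencil apart.\<close>

lemma norm_combination_ge:
  assumes "x - w * y = 0" "1 \<le> cmod (\<alpha> * w + \<beta>)"
  shows "((cmod x)\<^sup>2 + (cmod y)\<^sup>2) / (1 + (cmod w)\<^sup>2) \<le> (cmod (\<alpha> * x + \<beta> * y))\<^sup>2"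
proof -
  have x: "x = w * y" using assms by simp
  have "\<alpha> * x + \<beta> * y = (\<alpha> * w + \<beta>) * y" by (simp add: x algebra_simps)
  then have "(cmod (\<alpha> * x + \<beta> * y))\<^sup>2 = (cmod (\<alpha> * w + \<beta>))\<^sup>2 * (cmod y)\<^sup>2" by (simp add: norm_mult power_mult_distrib)
  moreover have "1 * (cmod y)\<^sup>2 \<le> (cmod (\<alpha> * w + \<beta>))\<^sup>2 * (cmod y)\<^sup>2"
    using assms(2) by (intro mult_right_mono) (auto simp: one_le_power)
  moreover have "((cmod x)\<^sup>2 + (cmod y)\<^sup>2) = (1 + (cmod w)\<^sup>2) * (cmod y)\<^sup>2"
    by (simp add: x norm_mult power_mult_distrib algebra_simps)
  ultimately show ?thesis by simp
qed

text \<open>If \<open>P\<close> vanished identically, every zero of \<open>Q\<close> would be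
  common; then \<open>Q\<close> is constant, and as \<open>0 < k\<close> both forms vanish at
  infinity.\<close>

lemma nonzero_of_no_common_zero:
  fixes P Q :: "complex poly"
  assumes "0 < k" "\<And>x. poly P x = 0 \<Longrightarrow> poly Q x \<noteq> 0" "coeff P k \<noteq> 0 \<or> coeff Q k \<noteq> 0"
  shows "P \<noteq> 0"
proof
  assume P: "P = 0"
  then have "\<And>x. poly Q x \<noteq> 0" using assms(2) by simp
  then have "degree Q = 0"
    using fundamental_theorem_of_algebra_alt[of Q] by (metis degree_pCons_0)
  then have "coeff Q k = 0" using assms(1) by (intro coeff_eq_0) simp
  with P assms(3) show False by simp
qed

text \<open>At the zeros of the member with parameter \<open>w\<close> the annulus bounds the target
  below by \<open>\<eta> / (1 + |w|\<^sup>2)\<close>, while that member is at most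
  \<open>1 + |w|\<^sup>2\<close> everywhere by Cauchy-Schwarz. These are the two bounds fed into
  \<open>log_height_compare\<close>; no common zero occurs, even at infinity.\<close>

lemma comb_properties:
  assumes ann: "annular \<eta> k A B" and \<eta>: "0 < \<eta>" and k: "0 < k" and w: "1 \<le> cmod (\<alpha> * w + \<beta>)"
  shows comb_nonzero: "comb \<alpha> \<beta> A B \<noteq> 0"
    and comb_fibre_nonzero: "comb 1 (- w) A B \<noteq> 0"
    and log_height_comb: "log_height (comb 1 (- w) A B) + ln (\<eta> / (1 + (cmod w)\<^sup>2)) - ln (1 + (cmod w)\<^sup>2)
        \<le> log_height (comb \<alpha> \<beta> A B)"
proof -
  let ?P = "comb \<alpha> \<beta> A B" and ?Q = "comb 1 (- w) A B"
  have W: "0 < 1 + (cmod w)\<^sup>2" by simp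
  have lo: "\<eta> / (1 + (cmod w)\<^sup>2) * (1 + (cmod y)\<^sup>2) ^ k \<le> (cmod (poly ?P y))\<^sup>2" if "poly ?Q y = 0" for y
  proof -
    have "\<eta> * (1 + (cmod y)\<^sup>2) ^ k / (1 + (cmod w)\<^sup>2) \<le> ((cmod (poly A y))\<^sup>2 + (cmod (poly B y))\<^sup>2) / (1 + (cmod w)\<^sup>2)"
      using ann W unfolding annular_def by (intro divide_right_mono) auto
    also have "\<dots> \<le> (cmod (poly ?P y))\<^sup>2"
      unfolding poly_comb using that w by (intro norm_combination_ge) (simp_all add: poly_comb)
    finally show ?thesis by simp
  qed
  have pos: "0 < \<eta> / (1 + (cmod w)\<^sup>2) * (1 + (cmod y)\<^sup>2) ^ k" for y using \<eta> by simp
  have cop: "poly ?P y \<noteq> 0" if "poly ?Q y = 0" for y using lo[OF that] pos[of y] by auto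
  then have cop': "poly ?Q y \<noteq> 0" if "poly ?P y = 0" for y using that by blast
  have loi: "\<eta> / (1 + (cmod w)\<^sup>2) \<le> (cmod (coeff ?P k))\<^sup>2" if "coeff ?Q k = 0"
  proof -
    have "\<eta> / (1 + (cmod w)\<^sup>2) \<le> ((cmod (coeff A k))\<^sup>2 + (cmod (coeff B k))\<^sup>2) / (1 + (cmod w)\<^sup>2)"
      using ann W unfolding annular_def by (intro divide_right_mono) auto
    also have "\<dots> \<le> (cmod (coeff ?P k))\<^sup>2"
      unfolding coeff_comb using that w by (intro norm_combination_ge) (simp_all add: coeff_comb)
    finally show ?thesis .
  qed
  have posi: "0 < \<eta> / (1 + (cmod w)\<^sup>2)" using \<eta> by simp
  have copi: "coeff ?P k \<noteq> 0" if "coeff ?Q k = 0" using loi[OF that] posi by auto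
  show P: "?P \<noteq> 0" using nonzero_of_no_common_zero[OF k, of ?P ?Q] cop' copi by blast
  show Q: "?Q \<noteq> 0" using nonzero_of_no_common_zero[OF k, of ?Q ?P] cop copi by blast
  have d: "degree ?P \<le> k" "degree ?Q \<le> k" using degree_comb[OF ann] by auto
  have s: "1 \<le> 1 + (cmod w)\<^sup>2" "(cmod 1)\<^sup>2 + (cmod (- w))\<^sup>2 \<le> 1 + (cmod w)\<^sup>2" by auto
  show "log_height ?Q + ln (\<eta> / (1 + (cmod w)\<^sup>2)) - ln (1 + (cmod w)\<^sup>2) \<le> log_height ?P"
  proof (rule log_height_compare[OF P Q d k cop'])
    fix y assume y: "poly ?Q y = 0"
    have "ln (\<eta> / (1 + (cmod w)\<^sup>2) * (1 + (cmod y)\<^sup>2) ^ k) \<le> ln ((cmod (poly ?P y))\<^sup>2)"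
      using lo[OF y] pos[of y] by (subst ln_le_cancel_iff) auto
    also have "ln (\<eta> / (1 + (cmod w)\<^sup>2) * (1 + (cmod y)\<^sup>2) ^ k) = ln (\<eta> / (1 + (cmod w)\<^sup>2)) + real k * ln (1 + (cmod y)\<^sup>2)"
      using posi by (subst ln_mult_pos) (auto simp: ln_realpow)
    finally show "ln (\<eta> / (1 + (cmod w)\<^sup>2)) \<le> rel_log k ?P y" by (simp add: rel_log_def)
  next
    assume "degree ?Q < k"
    then have c: "coeff ?Q k = 0" by (rule coeff_eq_0)
    \<comment> \<open>Infinity is a zero of \<open>?Q\<close>, hence not of \<open>?P\<close>, so
      the leading coefficient of \<open>?P\<close> is its value at infinity.\<close>
    then have "degree ?P = k" using copi d by (intro antisym le_degree) auto
    then show "ln (\<eta> / (1 + (cmod w)\<^sup>2)) \<le> ln ((cmod (lead_coeff ?P))\<^sup>2)"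
      using loi[OF c] posi copi[OF c] by (subst ln_le_cancel_iff) auto
  next
    fix x
    show "rel_log k ?Q x \<le> ln (1 + (cmod w)\<^sup>2)" by (rule rel_log_comb_le[OF ann s])
  next
    assume "degree ?P < k"
    then have "coeff ?P k = 0" by (rule coeff_eq_0)
    then have "degree ?Q = k" using copi d by (intro antisym le_degree) auto
    then show "ln ((cmod (lead_coeff ?Q))\<^sup>2) \<le> ln (1 + (cmod w)\<^sup>2)"
      using rel_log_comb_le(2)[OF ann s] by simp
  qed
qed

section \<open>Averaging over the pencil and the uniform bound\<close>

text \<open>Unitary invariance suggests that the average depends only on the length of
  \<open>(p, q)\<close>. Factoring out \<open>q\<close> reduces it to the spherical mean of a
  logarithm centred at \<open>p / q\<close>.\<close>

lemma
  fixes p q :: complex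
  assumes "p \<noteq> 0 \<or> q \<noteq> 0"
  shows integrable_ln_pencil: "integrable lborel (\<lambda>w. ln ((cmod (p - w * q))\<^sup>2) * fs w)"
    and integral_ln_pencil: "(\<integral>w. ln ((cmod (p - w * q))\<^sup>2) * fs w \<partial>lborel) = 4 * pi * ln ((cmod p)\<^sup>2 + (cmod q)\<^sup>2)"
proof -
  have "integrable lborel (\<lambda>w. ln ((cmod (p - w * q))\<^sup>2) * fs w)
      \<and> (\<integral>w. ln ((cmod (p - w * q))\<^sup>2) * fs w \<partial>lborel) = 4 * pi * ln ((cmod p)\<^sup>2 + (cmod q)\<^sup>2)"
  proof (cases "q = 0")
    case True
    then show ?thesis using integrable_fs integral_fs by simp
  next
    case False
    let ?h = "\<lambda>w. ln ((cmod q)\<^sup>2) * fs w + ln ((cmod (w - p / q))\<^sup>2) * fs w"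
    have h: "integrable lborel ?h" using integrable_fs integrable_ln_fs by simp
    have ae: "AE w in lborel. ?h w = ln ((cmod (p - w * q))\<^sup>2) * fs w"
      using AE_lborel_singleton[of "p / q"]
    proof eventually_elim
      case (elim w)
      have "p - w * q = q * (p / q - w)" using False by (simp add: algebra_simps)
      then have "(cmod (p - w * q))\<^sup>2 = (cmod q)\<^sup>2 * (cmod (w - p / q))\<^sup>2"
        by (simp add: norm_mult power_mult_distrib norm_minus_commute)
      then have "ln ((cmod (p - w * q))\<^sup>2) = ln ((cmod q)\<^sup>2) + ln ((cmod (w - p / q))\<^sup>2)"
        using elim False by (simp only:) (subst ln_mult_pos, auto)
      then show ?case by (simp add: distrib_right)
    qed
    have "integrable lborel (\<lambda>w. ln ((cmod (p - w * q))\<^sup>2) * fs w)"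
      by (rule integrable_cong_AE_imp[OF h _ ae]) measurable
    moreover have "(\<integral>w. ln ((cmod (p - w * q))\<^sup>2) * fs w \<partial>lborel) = (\<integral>w. ?h w \<partial>lborel)"
      by (rule integral_cong_AE) (use ae in \<open>auto elim: eventually_mono\<close>)
    moreover have "(\<integral>w. ?h w \<partial>lborel) = 4 * pi * (ln ((cmod q)\<^sup>2) + ln (1 + (cmod (p / q))\<^sup>2))"
      using integrable_fs integrable_ln_fs by (simp add: integral_fs integral_ln_fs distrib_left)
    moreover have "ln ((cmod q)\<^sup>2) + ln (1 + (cmod (p / q))\<^sup>2) = ln ((cmod p)\<^sup>2 + (cmod q)\<^sup>2)"
    proof -
      have "(cmod q)\<^sup>2 * (1 + (cmod (p / q))\<^sup>2) = (cmod p)\<^sup>2 + (cmod q)\<^sup>2"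
        using False by (simp add: norm_divide power_divide field_simps)
      then show ?thesis using False ln_mult_pos[of "(cmod q)\<^sup>2" "1 + (cmod (p / q))\<^sup>2"] by simp
    qed
    ultimately show ?thesis by simp
  qed
  then show "integrable lborel (\<lambda>w. ln ((cmod (p - w * q))\<^sup>2) * fs w)"
    "(\<integral>w. ln ((cmod (p - w * q))\<^sup>2) * fs w \<partial>lborel) = 4 * pi * ln ((cmod p)\<^sup>2 + (cmod q)\<^sup>2)" by auto
qed

definition fs_energy :: real where
  "fs_energy = (\<integral>z. ln (1 + (cmod z)\<^sup>2) * fs z \<partial>lborel)"

lemma fs_energy_nonneg: "0 \<le> fs_energy"
  unfolding fs_energy_def by (intro integral_nonneg_AE AE_I2 mult_nonneg_nonneg) auto

lemma fs_ge_on_ball: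
  assumes "w \<in> ball c 1" shows "4 / (1 + (cmod c + 1)\<^sup>2)\<^sup>2 \<le> fs w"
proof -
  have "cmod w \<le> cmod c + 1"
    using assms norm_triangle_ineq[of c "w - c"] by (simp add: dist_norm norm_minus_commute)
  then have "(1 + (cmod w)\<^sup>2)\<^sup>2 \<le> (1 + (cmod c + 1)\<^sup>2)\<^sup>2" by (intro power_mono add_mono) auto
  moreover have "0 < (1 + (cmod c + 1)\<^sup>2)\<^sup>2" by (intro zero_less_power add_pos_nonneg) auto
  ultimately show ?thesis unfolding fs_def by (intro divide_left_mono) auto
qed

text \<open>By contradiction: the nonnegative defect \<open>N w z\<close> is integrated over both
  variables. Integrating over \<open>w\<close> first bounds the total through the annulus;
  integrating over \<open>z\<close> first makes it too large if every \<open>w\<close> in the ball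
  has a very negative mean. The threshold does not involve \<open>k\<close>.\<close>

lemma exists_fibre_with_large_integral:
  assumes ann: "annular \<eta> k A B" and \<eta>: "0 < \<eta>" "\<eta> \<le> 1"
    and nz: "\<And>w. w \<in> ball c 1 \<Longrightarrow> comb 1 (- w) A B \<noteq> 0"
  shows "\<exists>w\<in>ball c 1. - ((4 * pi * (fs_energy - 4 * pi * ln \<eta>) + 1) / (4 * pi / (1 + (cmod c + 1)\<^sup>2)\<^sup>2))
     \<le> (\<integral>z. rel_log k (comb 1 (- w) A B) z * fs z \<partial>lborel)"
proof (rule ccontr)
  define m where "m = 4 / (1 + (cmod c + 1)\<^sup>2)\<^sup>2"
  define T0 where "T0 = fs_energy - 4 * pi * ln \<eta>"
  \<comment> \<open>\<open>m\<close> bounds \<open>fs\<close> below on the ball and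
    \<open>pi\<close> is the flat area of the ball, so the lower bound for the double integral is
    \<open>T1 * m * pi\<close>; the extra 1 makes it exceed the upper bound
    \<open>4 * pi * T0\<close>.\<close>
  define T1 where "T1 = (4 * pi * T0 + 1) / (pi * m)"
  have m: "0 < m" unfolding m_def by (intro divide_pos_pos zero_less_power add_pos_nonneg) auto
  have "ln \<eta> \<le> 0" using \<eta> by simp
  then have T0: "0 \<le> T0" using fs_energy_nonneg mult_nonneg_nonpos[of "4 * pi" "ln \<eta>"] by (simp add: T0_def)
  have T1: "0 \<le> T1" using T0 m by (simp add: T1_def)
  have pm: "pi * m = 4 * pi / (1 + (cmod c + 1)\<^sup>2)\<^sup>2" by (simp add: m_def)
  assume "\<not> (\<exists>w\<in>ball c 1. - ((4 * pi * (fs_energy - 4 * pi * ln \<eta>) + 1) / (4 * pi / (1 + (cmod c + 1)\<^sup>2)\<^sup>2))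
     \<le> (\<integral>z. rel_log k (comb 1 (- w) A B) z * fs z \<partial>lborel))"
  then have small: "(\<integral>z. rel_log k (comb 1 (- w) A B) z * fs z \<partial>lborel) \<le> - T1" if "w \<in> ball c 1" for w
    using that by (force simp: T1_def T0_def pm)
  \<comment> \<open>Subtracting from the Cauchy-Schwarz upper bound makes the integrand nonnegative,
    so the order of integration may be exchanged without joint integrability.\<close>
  define N where "N = (\<lambda>w z. ln (1 + (cmod w)\<^sup>2) - rel_log k (comb 1 (- w) A B) z)"
  have N_eq: "N w z = ln (1 + (cmod w)\<^sup>2) - ln ((cmod (poly A z - w * poly B z))\<^sup>2) + real k * ln (1 + (cmod z)\<^sup>2)" for w z
    by (simp add: N_def rel_log_def poly_comb)
  have N0: "0 \<le> N w z" for w z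
    unfolding N_def using rel_log_comb_le(1)[OF ann, of "1 + (cmod w)\<^sup>2" 1 "- w" z] by simp
  have inner: "(\<integral>\<^sup>+w. ennreal (N w z * fs w * fs z) \<partial>lborel) \<le> ennreal (T0 * fs z)" for z
  proof -
    define S where "S = (cmod (poly A z))\<^sup>2 + (cmod (poly B z))\<^sup>2"
    have S: "\<eta> * (1 + (cmod z)\<^sup>2) ^ k \<le> S" using ann by (simp add: annular_def S_def)
    have p: "0 < \<eta> * (1 + (cmod z)\<^sup>2) ^ k" using \<eta> by simp
    have ne: "poly A z \<noteq> 0 \<or> poly B z \<noteq> 0" using S p by (auto simp: S_def)
    have e: "(\<lambda>w. N w z * fs w * fs z) = (\<lambda>w. (ln (1 + (cmod w)\<^sup>2) * fs w - ln ((cmod (poly A z - w * poly B z))\<^sup>2) * fs w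
        + real k * ln (1 + (cmod z)\<^sup>2) * fs w) * fs z)"
      by (auto simp: N_eq algebra_simps)
    have i: "integrable lborel (\<lambda>w. N w z * fs w * fs z)"
      unfolding e using integrable_ln_one_plus_fs integrable_ln_pencil[OF ne] integrable_fs by simp
    have "(\<integral>w. N w z * fs w * fs z \<partial>lborel)
        = (fs_energy - 4 * pi * ln S + real k * ln (1 + (cmod z)\<^sup>2) * (4 * pi)) * fs z"
      unfolding e using integrable_ln_one_plus_fs integrable_ln_pencil[OF ne] integrable_fs
      by (simp add: integral_ln_pencil[OF ne] integral_fs S_def fs_energy_def)
    also have "\<dots> \<le> T0 * fs z"
    proof (rule mult_right_mono)
      have "ln (\<eta> * (1 + (cmod z)\<^sup>2) ^ k) \<le> ln S" using S p by (subst ln_le_cancel_iff) auto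
      also have "ln (\<eta> * (1 + (cmod z)\<^sup>2) ^ k) = ln \<eta> + real k * ln (1 + (cmod z)\<^sup>2)"
        using \<eta> by (subst ln_mult_pos) (auto simp: ln_realpow)
      finally have "4 * pi * (ln \<eta> + real k * ln (1 + (cmod z)\<^sup>2)) \<le> 4 * pi * ln S"
        by (intro mult_left_mono) auto
      then show "fs_energy - 4 * pi * ln S + real k * ln (1 + (cmod z)\<^sup>2) * (4 * pi) \<le> T0"
        by (simp add: T0_def algebra_simps)
    qed simp
    finally have "(\<integral>w. N w z * fs w * fs z \<partial>lborel) \<le> T0 * fs z" .
    then show ?thesis using i N0
      by (subst nn_integral_eq_integral) (auto intro!: ennreal_leI)
  qed
  have outer: "ennreal (T1 * m) * indicator (ball c 1) w \<le> (\<integral>\<^sup>+z. ennreal (N w z * fs w * fs z) \<partial>lborel)" for w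
  proof (cases "w \<in> ball c 1")
    case True
    have i: "integrable lborel (\<lambda>z. rel_log k (comb 1 (- w) A B) z * fs z)"
      by (rule integrable_rel_log_fs[OF nz[OF True]])
    have e: "(\<lambda>z. N w z * fs w * fs z) = (\<lambda>z. (ln (1 + (cmod w)\<^sup>2) * fs z - rel_log k (comb 1 (- w) A B) z * fs z) * fs w)"
      by (auto simp: N_def algebra_simps)
    have iN: "integrable lborel (\<lambda>z. N w z * fs w * fs z)"
      unfolding e using i integrable_fs by simp
    have "T1 * m \<le> T1 * fs w" using fs_ge_on_ball[OF True] T1 by (intro mult_left_mono) (auto simp: m_def)
    also have "\<dots> \<le> (ln (1 + (cmod w)\<^sup>2) * (4 * pi) - (\<integral>z. rel_log k (comb 1 (- w) A B) z * fs z \<partial>lborel)) * fs w"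
    proof (rule mult_right_mono)
      have "0 \<le> ln (1 + (cmod w)\<^sup>2) * (4 * pi)" by (intro mult_nonneg_nonneg) auto
      then show "T1 \<le> ln (1 + (cmod w)\<^sup>2) * (4 * pi) - (\<integral>z. rel_log k (comb 1 (- w) A B) z * fs z \<partial>lborel)"
        using small[OF True] by linarith
    qed simp
    also have "\<dots> = (\<integral>z. N w z * fs w * fs z \<partial>lborel)"
      unfolding e using i integrable_fs by (simp add: integral_fs)
    finally have "ennreal (T1 * m) \<le> ennreal (\<integral>z. N w z * fs w * fs z \<partial>lborel)" by (rule ennreal_leI)
    also have "\<dots> = (\<integral>\<^sup>+z. ennreal (N w z * fs w * fs z) \<partial>lborel)"
      using iN N0 by (subst nn_integral_eq_integral) auto
    finally show ?thesis using True by simp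
  qed simp
  have meas: "(\<lambda>(w, z). ennreal (N w z * fs w * fs z)) \<in> borel_measurable (lborel \<Otimes>\<^sub>M lborel)"
    unfolding N_eq by measurable
  have "ennreal (T1 * m * pi) = (\<integral>\<^sup>+w. ennreal (T1 * m) * indicator (ball c 1) w \<partial>lborel)"
    using T1 m by (simp add: nn_integral_cmult_indicator emeasure_ball unit_ball_vol_2 ennreal_mult)
  also have "\<dots> \<le> (\<integral>\<^sup>+w. (\<integral>\<^sup>+z. ennreal (N w z * fs w * fs z) \<partial>lborel) \<partial>lborel)"
    by (intro nn_integral_mono outer)
  also have "\<dots> = (\<integral>\<^sup>+z. (\<integral>\<^sup>+w. ennreal (N w z * fs w * fs z) \<partial>lborel) \<partial>lborel)"
    using lborel_pair.Fubini'[OF meas] by simp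
  also have "\<dots> \<le> (\<integral>\<^sup>+z. ennreal (T0 * fs z) \<partial>lborel)"
    by (intro nn_integral_mono inner)
  also have "\<dots> = ennreal (T0 * (4 * pi))"
    using integrable_fs T0 by (subst nn_integral_eq_integral) (auto simp: integral_fs)
  finally have "T1 * m * pi \<le> T0 * (4 * pi)" using T0 by (subst (asm) ennreal_le_iff) auto
  moreover have "T1 * m * pi = 4 * pi * T0 + 1" using m by (simp add: T1_def)
  ultimately show False by simp
qed

lemma rel_log_comb_L1_bound:
  assumes \<eta>: "0 < \<eta>" "\<eta> \<le> 1" and ball: "\<And>w. w \<in> ball c 1 \<Longrightarrow> 1 \<le> cmod (\<alpha> * w + \<beta>)"
  shows "\<exists>C. \<forall>k A B. 0 < k \<longrightarrow> annular \<eta> k A B \<longrightarrow> comb \<alpha> \<beta> A B \<noteq> 0 \<and>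
      (\<integral>z. \<bar>rel_log k (comb \<alpha> \<beta> A B) z\<bar> * fs z \<partial>lborel) \<le> C"
proof -
  define \<sigma> where "\<sigma> = 1 + (cmod \<alpha>)\<^sup>2 + (cmod \<beta>)\<^sup>2"
  define \<rho> where "\<rho> = 1 + (cmod c + 1)\<^sup>2"
  define T where "T = (4 * pi * (fs_energy - 4 * pi * ln \<eta>) + 1) / (4 * pi / (1 + (cmod c + 1)\<^sup>2)\<^sup>2)"
  \<comment> \<open>From \<open>U \<le> ln \<sigma>\<close> and \<open>0 \<le> ln \<sigma>\<close>
    follows \<open>|U| \<le> 2 * ln \<sigma> - U\<close>, whose first term integrates to
    \<open>8 * pi * ln \<sigma>\<close>. The rest bounds minus the integral of \<open>U\<close>:
    \<open>T\<close> for the good member, and \<open>4 * pi\<close> times the height lost in passing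
    to the target, where \<open>\<rho>\<close> bounds \<open>1 + |w|\<^sup>2\<close> on the
    ball.\<close>
  define C where "C = 8 * pi * ln \<sigma> + T - 4 * pi * (ln \<eta> - 2 * ln \<rho>)"
  have \<sigma>: "1 \<le> \<sigma>" "(cmod \<alpha>)\<^sup>2 + (cmod \<beta>)\<^sup>2 \<le> \<sigma>" by (auto simp: \<sigma>_def)
  have "comb \<alpha> \<beta> A B \<noteq> 0 \<and> (\<integral>z. \<bar>rel_log k (comb \<alpha> \<beta> A B) z\<bar> * fs z \<partial>lborel) \<le> C"
    if k: "0 < k" and ann: "annular \<eta> k A B" for k A B
  proof -
    let ?P = "comb \<alpha> \<beta> A B"
    have nz: "comb 1 (- w) A B \<noteq> 0" if "w \<in> ball c 1" for w
      by (rule comb_fibre_nonzero[OF ann \<eta>(1) k ball[OF that]])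
    obtain w where w: "w \<in> ball c 1" and wT: "- T \<le> (\<integral>z. rel_log k (comb 1 (- w) A B) z * fs z \<partial>lborel)"
      using exists_fibre_with_large_integral[OF ann \<eta> nz] unfolding T_def by blast
    note props = comb_properties[OF ann \<eta>(1) k ball[OF w]]
    have "cmod w \<le> cmod c + 1"
      using w norm_triangle_ineq[of c "w - c"] by (simp add: dist_norm norm_minus_commute)
    then have "1 + (cmod w)\<^sup>2 \<le> \<rho>" unfolding \<rho>_def by (intro add_mono power_mono) auto
    then have \<rho>: "ln (1 + (cmod w)\<^sup>2) \<le> ln \<rho>"
      using one_plus_norm_sq_pos(1)[of w] by (subst ln_le_cancel_iff) linarith+
    have "ln (\<eta> / (1 + (cmod w)\<^sup>2)) = ln \<eta> - ln (1 + (cmod w)\<^sup>2)"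
      using \<eta> by (subst ln_divide_pos) auto
    with props(3) \<rho> have "log_height (comb 1 (- w) A B) + (ln \<eta> - 2 * ln \<rho>) \<le> log_height ?P" by linarith
    then have "4 * pi * (log_height (comb 1 (- w) A B) + (ln \<eta> - 2 * ln \<rho>)) \<le> 4 * pi * log_height ?P"
      by (intro mult_left_mono) auto
    \<comment> \<open>The only term growing with \<open>k\<close> in the two means, \<open>k\<close>
      times the integral of \<open>ln (1 + |z|\<^sup>2)\<close>, is common to both members and
      cancels.\<close>
    then have M: "- T + 4 * pi * (ln \<eta> - 2 * ln \<rho>) \<le> (\<integral>z. rel_log k ?P z * fs z \<partial>lborel)"
      using wT unfolding integral_rel_log_fs[OF props(1)] integral_rel_log_fs[OF props(2)]
      by (simp add: distrib_left)
    have i: "integrable lborel (\<lambda>z. rel_log k ?P z * fs z)" by (rule integrable_rel_log_fs[OF props(1)])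
    have "(\<integral>z. \<bar>rel_log k ?P z\<bar> * fs z \<partial>lborel) \<le> (\<integral>z. 2 * ln \<sigma> * fs z - rel_log k ?P z * fs z \<partial>lborel)"
    proof (rule integral_mono)
      show "integrable lborel (\<lambda>z. \<bar>rel_log k ?P z\<bar> * fs z)" using integrable_abs[OF i] by (simp add: abs_mult)
      show "integrable lborel (\<lambda>z. 2 * ln \<sigma> * fs z - rel_log k ?P z * fs z)" using i integrable_fs by simp
      fix z
      have "0 \<le> ln \<sigma>" using \<sigma> by simp
      then have "\<bar>rel_log k ?P z\<bar> \<le> 2 * ln \<sigma> - rel_log k ?P z"
        using rel_log_comb_le(1)[OF ann \<sigma>, of z] by linarith
      then have "\<bar>rel_log k ?P z\<bar> * fs z \<le> (2 * ln \<sigma> - rel_log k ?P z) * fs z" by (rule mult_right_mono) simp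
      then show "\<bar>rel_log k ?P z\<bar> * fs z \<le> 2 * ln \<sigma> * fs z - rel_log k ?P z * fs z" by (simp add: left_diff_distrib)
    qed
    also have "\<dots> = 8 * pi * ln \<sigma> - (\<integral>z. rel_log k ?P z * fs z \<partial>lborel)"
      using i integrable_fs by (simp add: integral_fs)
    also have "\<dots> \<le> C" using M by (simp add: C_def)
    finally show ?thesis using props(1) by simp
  qed
  then show ?thesis by blast
qed

lemma dehom_combination: "dehom (\<lambda>j. \<alpha> * a j + \<beta> * b j) k = comb \<alpha> \<beta> (dehom a k) (dehom b k)"
  by (rule poly_eqI) (simp add: coeff_comb coeff_dehom)

lemma fiber_sum_bound:
  assumes \<eta>: "0 < \<eta>" "\<eta> \<le> 1"
  shows "\<exists>C. \<forall>k a b f. 0 < k \<longrightarrow> annular \<eta> k (dehom a k) (dehom b k) \<longrightarrow> C2_sphere f \<longrightarrow>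
     \<bar>fiber_sum a b k w f / real k - sphere_integral f / sphere_area\<bar> \<le> C * sup_norm (sphere_lap f) / real k"
proof -
  obtain \<alpha> \<beta> c where fib: "\<And>a b k f. fiber_sum a b k w f = zero_sum (\<lambda>j. \<alpha> * a j + \<beta> * b j) k f"
    and ball: "\<And>v. v \<in> ball c 1 \<Longrightarrow> 1 \<le> cmod (\<alpha> * v + \<beta>)"
  proof (cases w)
    case None
    \<comment> \<open>For the fibre over infinity \<open>\<alpha> * v + \<beta>\<close> is
      constantly 1, so any ball will do.\<close>
    show thesis by (rule that[of 0 1 0]) (auto simp: fiber_sum_def None)
  next
    case (Some c)
    \<comment> \<open>Shifting the centre by 2 keeps the unit ball at distance at least 1 from
      \<open>c\<close>.\<close>
    show thesis
    proof (rule that[of 1 "- c" "c + 2"])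
      show "fiber_sum a b k w f = zero_sum (\<lambda>j. 1 * a j + - c * b j) k f" for a b k f
        by (simp add: fiber_sum_def Some)
      fix v assume "v \<in> ball (c + 2) 1"
      then have "cmod (c + 2 - v) < 1" by (simp add: dist_norm)
      moreover have "cmod 2 \<le> cmod (c + 2 - v) + cmod (v - c)"
        using norm_triangle_ineq[of "c + 2 - v" "v - c"] by simp
      ultimately show "1 \<le> cmod (1 * v + - c)" by simp
    qed
  qed
  obtain C where C': "\<forall>k A B. 0 < k \<longrightarrow> annular \<eta> k A B \<longrightarrow> comb \<alpha> \<beta> A B \<noteq> 0 \<and>
      (\<integral>z. \<bar>rel_log k (comb \<alpha> \<beta> A B) z\<bar> * fs z \<partial>lborel) \<le> C"
    using rel_log_comb_L1_bound[OF \<eta> ball] by (rule exE)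
  have C: "comb \<alpha> \<beta> A B \<noteq> 0" "(\<integral>z. \<bar>rel_log k (comb \<alpha> \<beta> A B) z\<bar> * fs z \<partial>lborel) \<le> C"
    if "0 < k" "annular \<eta> k A B" for k A B
    using C' that by auto
  have "\<bar>fiber_sum a b k w f / real k - sphere_integral f / sphere_area\<bar> \<le> C / (4 * pi) * sup_norm (sphere_lap f) / real k"
    if k: "0 < k" and ann: "annular \<eta> k (dehom a k) (dehom b k)" and f: "C2_sphere f" for k a b f
  proof -
    let ?S = "sup_norm (sphere_lap f)"
    have "\<bar>fiber_sum a b k w f - real k * sphere_integral f / (4 * pi)\<bar> \<le> ?S / (4 * pi) * (\<integral>z. \<bar>rel_log k (comb \<alpha> \<beta> (dehom a k) (dehom b k)) z\<bar> * fs z \<partial>lborel)"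
      using zero_sum_discrepancy[OF f, of "\<lambda>j. \<alpha> * a j + \<beta> * b j" k] C(1)[OF k ann]
      by (simp add: fib dehom_combination)
    also have "\<dots> \<le> ?S / (4 * pi) * C"
      using C(2)[OF k ann] sup_norm_nonneg[OF f] by (intro mult_left_mono) auto
    finally have "\<bar>fiber_sum a b k w f - real k * sphere_integral f / (4 * pi)\<bar> / real k \<le> ?S / (4 * pi) * C / real k"
      by (intro divide_right_mono) auto
    moreover have "fiber_sum a b k w f / real k - sphere_integral f / sphere_area
        = (fiber_sum a b k w f - real k * sphere_integral f / (4 * pi)) / real k"
      using k by (simp add: sphere_area_def diff_divide_distrib)
    ultimately show ?thesis by (simp add: mult_ac)
  qed
  then show ?thesis by blast
qed

theorem theorem2:
  fixes \<eta> :: real and a b :: "nat \<Rightarrow> nat \<Rightarrow> complex"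
  assumes "0 < \<eta>" and "\<eta> \<le> 1"
    and "\<exists>K0. \<forall>k\<ge>K0. \<forall>z0 z1. (cmod z0)\<^sup>2 + (cmod z1)\<^sup>2 = 1 \<longrightarrow>
            sqrt \<eta> \<le> sqrt ((cmod (hom_eval (a k) k z0 z1))\<^sup>2 + (cmod (hom_eval (b k) k z0 z1))\<^sup>2) \<and>
            sqrt ((cmod (hom_eval (a k) k z0 z1))\<^sup>2 + (cmod (hom_eval (b k) k z0 z1))\<^sup>2) \<le> 1"
  shows "\<forall>w::cp1. (\<exists>C::real. \<exists>K. \<forall>k\<ge>K. \<forall>f. C2_sphere f \<longrightarrow>
             \<bar>fiber_sum (a k) (b k) k w f / real k - sphere_integral f / sphere_area\<bar>
               \<le> C * sup_norm (sphere_lap f) / real k)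
          \<and> (\<forall>f. C2_sphere f \<longrightarrow>
             ((\<lambda>k. \<bar>fiber_sum (a k) (b k) k w f / real k - sphere_integral f / sphere_area\<bar>)
                \<longlonglongrightarrow> 0))"
proof
  fix w :: cp1
  obtain K0 where K0: "\<forall>k\<ge>K0. \<forall>z0 z1. (cmod z0)\<^sup>2 + (cmod z1)\<^sup>2 = 1 \<longrightarrow>
            sqrt \<eta> \<le> sqrt ((cmod (hom_eval (a k) k z0 z1))\<^sup>2 + (cmod (hom_eval (b k) k z0 z1))\<^sup>2) \<and>
            sqrt ((cmod (hom_eval (a k) k z0 z1))\<^sup>2 + (cmod (hom_eval (b k) k z0 z1))\<^sup>2) \<le> 1"
    using assms(3) by blast
  have ann: "annular \<eta> k (dehom (a k) k) (dehom (b k) k)" if "K0 \<le> k" for k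
    using K0 that by (intro annular_dehom[OF assms(1)]) blast
  obtain C where C: "\<And>k a b f. 0 < k \<Longrightarrow> annular \<eta> k (dehom a k) (dehom b k) \<Longrightarrow> C2_sphere f \<Longrightarrow>
     \<bar>fiber_sum a b k w f / real k - sphere_integral f / sphere_area\<bar> \<le> C * sup_norm (sphere_lap f) / real k"
    using fiber_sum_bound[OF assms(1,2), of w] by blast
  \<comment> \<open>The maximum with 1 excludes \<open>k = 0\<close>, for which
    \<open>fiber_sum_bound\<close> says nothing.\<close>
  have bound: "\<bar>fiber_sum (a k) (b k) k w f / real k - sphere_integral f / sphere_area\<bar> \<le> C * sup_norm (sphere_lap f) / real k"
    if "max K0 1 \<le> k" "C2_sphere f" for k f
    using that ann by (intro C) auto
  show "(\<exists>C::real. \<exists>K. \<forall>k\<ge>K. \<forall>f. C2_sphere f \<longrightarrow>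
             \<bar>fiber_sum (a k) (b k) k w f / real k - sphere_integral f / sphere_area\<bar>
               \<le> C * sup_norm (sphere_lap f) / real k)
          \<and> (\<forall>f. C2_sphere f \<longrightarrow>
             ((\<lambda>k. \<bar>fiber_sum (a k) (b k) k w f / real k - sphere_integral f / sphere_area\<bar>)
                \<longlonglongrightarrow> 0))"
  proof (intro conjI allI impI)
    show "\<exists>C::real. \<exists>K. \<forall>k\<ge>K. \<forall>f. C2_sphere f \<longrightarrow>
             \<bar>fiber_sum (a k) (b k) k w f / real k - sphere_integral f / sphere_area\<bar>
               \<le> C * sup_norm (sphere_lap f) / real k"
      using bound by blast
    fix f assume f: "C2_sphere f"
    show "(\<lambda>k. \<bar>fiber_sum (a k) (b k) k w f / real k - sphere_integral f / sphere_area\<bar>) \<longlonglongrightarrow> 0"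
    proof (rule Lim_null_comparison)
      show "\<forall>\<^sub>F k in sequentially. norm \<bar>fiber_sum (a k) (b k) k w f / real k - sphere_integral f / sphere_area\<bar>
          \<le> C * sup_norm (sphere_lap f) / real k"
        using eventually_ge_at_top[of "max K0 1"] by eventually_elim (use bound f in simp)
      show "(\<lambda>k. C * sup_norm (sphere_lap f) / real k) \<longlonglongrightarrow> 0"
        by (rule lim_const_over_n)
    qed
  qed
qed

end
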